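(* Let $\mathbb{F}$ be a field, $G$ a group, $n>2$, $t,t',g,g'\in G$ with $g\ne g^2=1=(g')^2\ne g'$, and let $\eta,\eta'\in G^{n-1}$ be sequences each having pairwise commuting entries. Then (1) $\Gamma_1(t,\eta)$ and $\Gamma_1(t',\eta')$ are graded isomorphic if and only if $t=t'$ and $\eta\sim\eta'$; (2) $\Gamma_1(t,\eta)$ and $\Gamma_1(t',\eta')$ are practically graded isomorphic if and only if $\eta\sim\eta'$. Assume further that $\mathrm{char}\,\mathbb{F}\neq 2$, that $\eta=\mathrm{rev}\,\eta$ and $\eta'=\mathrm{rev}\,\eta'$, that $g$ commutes with the entries of $\eta$, and that $g'$ commutes with the entries of $\eta'$. Then (3) $\Gamma_2(t,g,\eta)$ and $\Gamma_2(t',g',\eta')$ are graded isomorphic if and only if $g=g'$, $t=t'$, and $\eta\sim_g\eta'$; (4) $\Gamma_2(t,g,\eta)$ and $\Gamma_2(t',g',\eta')$ are practically graded isomorphic if and only if $g=g'$ and $\eta\sim_g\eta'$.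
   Context: $\mathrm{UT}_n^{(-)}=\mathrm{UT}_n^{(-)}(\mathbb{F})$ is the Lie algebra of upper triangular $n\times n$ matrices over $\mathbb{F}$ with bracket $[a,b]=ab-ba$; $e_{ij}$ are the matrix units, $\mathrm{I}$ is the identity matrix, and the centre is $\mathbb{F}\mathrm{I}$. $G$ is written multiplicatively with identity $1$. A $G$-grading on an algebra $\mathcal{A}$ is a vector space decomposition $\mathcal{A}=\bigoplus_{g\in G}\mathcal{A}_g$ with $\mathcal{A}_g\mathcal{A}_h\subseteq\mathcal{A}_{gh}$; nonzero $x\in\mathcal{A}_g$ is homogeneous with $\deg x=g$. A $G$-graded isomorphism is an algebra isomorphism $f$ with $f(\mathcal{A}_g)\subseteq\mathcal{B}_g$ for all $g$; two gradings on the same algebra are graded isomorphic if the corresponding graded algebras are. Two $G$-graded algebras $\mathcal{L}_1,\mathcal{L}_2$ (or their gradings) are practically graded isomorphic if there is an isomorphism of ungraded algebras $\psi:\mathcal{L}_1\to\mathcal{L}_2$ inducing a $G$-graded isomorphism $\mathcal{L}_1/\mathfrak{z}(\mathcal{L}_1)\to\mathcal{L}_2/\mathfrak{z}(\mathcal{L}_2)$, where $\mathfrak{z}$ denotes the centre. For $\eta=(g_1,\dots,g_{n-1})$, $\mathrm{rev}\,\eta=(g_{n-1},\dots,g_1)$. Write $\eta\sim\eta'$ if $\eta=\eta'$ or $\eta=\mathrm{rev}\,\eta'$. For $g$ of order $2$ and $\eta=(g_1,\dots,g_{n-1})$, $\eta'=(g'_1,\dots,g'_{n-1})$ with $\eta=\mathrm{rev}\,\eta$,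 $\eta'=\mathrm{rev}\,\eta'$, write $\eta\sim_g\eta'$ if $g_i\in\{g_i',gg_i'\}$ for each $i=1,\dots,\lfloor\frac{n-1}{2}\rfloor$ and, if $n$ is even, $g_{n/2}=g'_{n/2}$. Practical elementary gradings: for $\eta=(g_1,\dots,g_{n-1})\in G^{n-1}$ with pairwise commuting entries and any $t\in G$, choose a subspace $V$ of the space $\mathscr{D}$ of diagonal matrices with $\mathscr{D}=\mathbb{F}\mathrm{I}\oplus V$. $\Gamma_1(t,\eta)$ is the grading on $\mathrm{UT}_n^{(-)}$ with $\deg e_{ij}=g_i\cdots g_{j-1}$ for $i<j$, $\deg\mathrm{I}=t$, and all nonzero elements of $V$ of degree $1$. Different choices of $V$ give isomorphic gradings. Type 2 gradings ($\mathrm{char}\,\mathbb{F}\ne2$): let $g\in G$ have order $2$ and $\eta=(g_1,\dots,g_{n-1})=\mathrm{rev}\,\eta$, with $g,g_1,\dots,g_{n-1}$ pairwise commuting. Put $X_{ij}^{\pm}=e_{ij}\pm e_{n-j+1,n-i+1}$ for $1\le i\le j\le n$. $\Gamma_2(g,\eta)$ is the grading in which all nonzero $X_{ij}^\pm$ are homogeneous with $\deg X_{ii}^-=1$, $\deg X_{ii}^+=g$, $\deg X_{i,i+1}^-=g_i$, $\deg X_{i,i+1}^+=gg_i$ (whenever nonzero); generally $\deg X_{ij}^-=g_i\cdots g_{j-1}$ and $\deg X_{ij}^+=g\,g_i\cdots g_{j-1}$ for $i<j$. In particular $\deg\mathrm{I}=g$. Practical type 2 gradings: let $\Gamma_2(g,\eta)$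 have homogeneous components $\mathcal{U}_h$, let $t\in G$, and choose $\mathcal{V}$ with $\mathcal{U}_g=\mathcal{V}\oplus\mathbb{F}\mathrm{I}$. $\Gamma_2(t,g,\eta)$ has components $\mathcal{U}'_h=\mathcal{U}_h$ for $h\notin\{g,t\}$, $\mathcal{U}'_t=\mathcal{U}_t+\mathbb{F}\mathrm{I}$, and, if $t\neq g$, $\mathcal{U}'_g=\mathcal{V}$. It is determined up to graded isomorphism by $(t,g,\eta)$.
   Formalization: In the practical type 2 gradings, the complement V with U_g = V ⊕ F·I is required to be such that the resulting components form a G-grading (equivalently, for t ≠ g, V contains the degree-g part of the commutator algebra); an arbitrary complement need not give a grading. *)

theory Defs
  imports "HOL-Algebra.QuotRing" "Jordan_Normal_Form.VS_Connect"
begin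

text \<open>
  A (not necessarily associative) algebra over a field is represented by a module record over
  \<^const>\<open>class_ring\<close> whose multiplication \<open>\<otimes>\<close> is the product of the algebra (here: the Lie
  bracket). The record field \<open>one\<close> plays no role.
\<close>

definition alg_iso ::
  "('f::field, 'a, 'p) module_scheme \<Rightarrow> ('f, 'b, 'q) module_scheme \<Rightarrow> ('a \<Rightarrow> 'b) set" where
  "alg_iso L M = LinearCombinations.module_hom class_ring L M \<inter> iso L M"

definition lie_center :: "('f::field, 'a, 'p) module_scheme \<Rightarrow> 'a set" where
  "lie_center L = {z \<in> carrier L. \<forall>x \<in> carrier L. z \<otimes>\<^bsub>L\<^esub> x = \<zero>\<^bsub>L\<^esub>}"

definition quot_alg :: "('f::field, 'a, 'p) module_scheme \<Rightarrow> 'a set \<Rightarrow> ('f, 'a set) module" where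
  "quot_alg L I = ring.extend (L Quot I)
     (module.fields (\<lambda>c C. \<Union>x\<in>C. I +>\<^bsub>L\<^esub> (c \<odot>\<^bsub>L\<^esub> x)))"

text \<open>
  Gradings are given by the family of their homogeneous components; only the values of the
  family on \<open>carrier G\<close> matter.
\<close>

definition is_grading ::
  "('g, 'r) monoid_scheme \<Rightarrow> ('f::field, 'a, 'p) module_scheme \<Rightarrow> ('g \<Rightarrow> 'a set) \<Rightarrow> bool" where
  "is_grading G L A \<longleftrightarrow>
     (\<forall>h \<in> carrier G. VectorSpace.subspace class_ring (A h) L) \<and>
     (\<forall>x \<in> carrier L. \<exists>!c. c \<in> (\<Pi>\<^sub>E h \<in> carrier G. A h) \<and>
        finite {h \<in> carrier G. c h \<noteq> \<zero>\<^bsub>L\<^esub>} \<and>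
        x = finsum L c {h \<in> carrier G. c h \<noteq> \<zero>\<^bsub>L\<^esub>}) \<and>
     (\<forall>h \<in> carrier G. \<forall>k \<in> carrier G. \<forall>x \<in> A h. \<forall>y \<in> A k.
        x \<otimes>\<^bsub>L\<^esub> y \<in> A (h \<otimes>\<^bsub>G\<^esub> k))"

definition graded_iso ::
  "('g, 'r) monoid_scheme \<Rightarrow> ('f::field, 'a, 'p) module_scheme \<Rightarrow> ('g \<Rightarrow> 'a set) \<Rightarrow>
   ('f, 'b, 'q) module_scheme \<Rightarrow> ('g \<Rightarrow> 'b set) \<Rightarrow> ('a \<Rightarrow> 'b) set" where
  "graded_iso G L A M B = {f \<in> alg_iso L M. \<forall>h \<in> carrier G. f ` A h \<subseteq> B h}"

definition graded_isomorphic ::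
  "('g, 'r) monoid_scheme \<Rightarrow> ('f::field, 'a, 'p) module_scheme \<Rightarrow> ('g \<Rightarrow> 'a set) \<Rightarrow>
   ('f, 'b, 'q) module_scheme \<Rightarrow> ('g \<Rightarrow> 'b set) \<Rightarrow> bool" where
  "graded_isomorphic G L A M B \<longleftrightarrow> graded_iso G L A M B \<noteq> {}"

definition quot_comp ::
  "('f::field, 'a, 'p) module_scheme \<Rightarrow> 'a set \<Rightarrow> ('g \<Rightarrow> 'a set) \<Rightarrow> 'g \<Rightarrow> 'a set set" where
  "quot_comp L I A h = (\<lambda>x. I +>\<^bsub>L\<^esub> x) ` A h"

definition practically_graded_isomorphic ::
  "('g, 'r) monoid_scheme \<Rightarrow> ('f::field, 'a, 'p) module_scheme \<Rightarrow> ('g \<Rightarrow> 'a set) \<Rightarrow>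
   ('f, 'b, 'q) module_scheme \<Rightarrow> ('g \<Rightarrow> 'b set) \<Rightarrow> bool" where
  "practically_graded_isomorphic G L A M B \<longleftrightarrow>
     (\<exists>\<psi> \<in> alg_iso L M.
        \<exists>\<phi> \<in> graded_iso G (quot_alg L (lie_center L)) (quot_comp L (lie_center L) A)
                         (quot_alg M (lie_center M)) (quot_comp M (lie_center M) B).
          \<forall>x \<in> carrier L. \<phi> (lie_center L +>\<^bsub>L\<^esub> x) = lie_center M +>\<^bsub>M\<^esub> \<psi> x)"

definition direct_sum_of ::
  "('f::field, 'a, 'p) module_scheme \<Rightarrow> 'a set \<Rightarrow> 'a set \<Rightarrow> 'a set \<Rightarrow> bool" where
  "direct_sum_of L U V W \<longleftrightarrow>
     VectorSpace.subspace class_ring V L \<and> VectorSpace.subspace class_ring W L \<and>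
     U = V <+>\<^bsub>L\<^esub> W \<and> V \<inter> W = {\<zero>\<^bsub>L\<^esub>}"

definition UT :: "nat \<Rightarrow> ('f::field, 'f mat) module" where
  "UT n = \<lparr>carrier = {A \<in> carrier_mat n n. upper_triangular A},
           mult = (\<lambda>A B. A * B - B * A), one = undefined,
           zero = 0\<^sub>m n n, add = (+), smult = (\<cdot>\<^sub>m)\<rparr>"

abbreviation ut_span :: "nat \<Rightarrow> 'f::field mat set \<Rightarrow> 'f mat set" where
  "ut_span n \<equiv> LinearCombinations.module.span class_ring (UT n)"

definition diag_mats :: "nat \<Rightarrow> 'f::field mat set" where
  "diag_mats n = {A \<in> carrier_mat n n. diagonal_mat A}"

definition scalar_mats :: "nat \<Rightarrow> 'f::field mat set" where
  "scalar_mats n = {c \<cdot>\<^sub>m 1\<^sub>m n | c. True}"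

text \<open>
  Matrix positions are numbered from \<open>0\<close>, so \<open>mat_unit n i j\<close> is the matrix unit usually written
  with indices \<open>i + 1, j + 1\<close>, and the flip \<open>(i, j) \<mapsto> (n - j + 1, n - i + 1)\<close> becomes
  \<open>(i, j) \<mapsto> (n - 1 - j, n - 1 - i)\<close>. The sequence \<open>\<eta> = (g\<^sub>1, \<dots>, g\<^sub>n\<^sub>-\<^sub>1)\<close> is a list, with
  \<open>g\<^sub>i = \<eta> ! (i - 1)\<close>.
\<close>

definition mat_unit :: "nat \<Rightarrow> nat \<Rightarrow> nat \<Rightarrow> 'f::field mat" where
  "mat_unit n i j = mat n n (\<lambda>(r, c). if r = i \<and> c = j then 1 else 0)"

definition X_minus :: "nat \<Rightarrow> nat \<Rightarrow> nat \<Rightarrow> 'f::field mat" where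
  "X_minus n i j = mat_unit n i j - mat_unit n (n - 1 - j) (n - 1 - i)"

definition X_plus :: "nat \<Rightarrow> nat \<Rightarrow> nat \<Rightarrow> 'f::field mat" where
  "X_plus n i j = mat_unit n i j + mat_unit n (n - 1 - j) (n - 1 - i)"

text \<open>The product \<open>\<eta>!i \<otimes> \<dots> \<otimes> \<eta>!(j - 1)\<close>; a fold, since the group need not be commutative.\<close>

definition deg_prod :: "('g, 'r) monoid_scheme \<Rightarrow> 'g list \<Rightarrow> nat \<Rightarrow> nat \<Rightarrow> 'g" where
  "deg_prod G \<eta> i j = foldr (\<lambda>k x. \<eta> ! k \<otimes>\<^bsub>G\<^esub> x) [i..<j] \<one>\<^bsub>G\<^esub>"

definition pairwise_commuting :: "('g, 'r) monoid_scheme \<Rightarrow> 'g list \<Rightarrow> bool" where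
  "pairwise_commuting G \<eta> \<longleftrightarrow>
     (\<forall>x \<in> set \<eta>. \<forall>y \<in> set \<eta>. x \<otimes>\<^bsub>G\<^esub> y = y \<otimes>\<^bsub>G\<^esub> x)"

definition seq_sim :: "'g list \<Rightarrow> 'g list \<Rightarrow> bool" where
  "seq_sim \<eta> \<eta>' \<longleftrightarrow> \<eta> = \<eta>' \<or> \<eta> = rev \<eta>'"

text \<open>Only used for \<open>\<eta>\<close>, \<open>\<eta>'\<close> of length \<open>n - 1\<close> that are fixed by \<^const>\<open>rev\<close>.\<close>

definition seq_sim_mod ::
  "('g, 'r) monoid_scheme \<Rightarrow> nat \<Rightarrow> 'g \<Rightarrow> 'g list \<Rightarrow> 'g list \<Rightarrow> bool" where
  "seq_sim_mod G n g \<eta> \<eta>' \<longleftrightarrow>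
     (\<forall>i \<in> {1..(n - 1) div 2}. \<eta> ! (i - 1) \<in> {\<eta>' ! (i - 1), g \<otimes>\<^bsub>G\<^esub> \<eta>' ! (i - 1)}) \<and>
     (even n \<longrightarrow> \<eta> ! (n div 2 - 1) = \<eta>' ! (n div 2 - 1))"

text \<open>
  The families below depend on the choice of a complement \<open>V\<close>, which is kept as a parameter.
\<close>

definition Gamma1_choice :: "nat \<Rightarrow> 'f::field mat set \<Rightarrow> bool" where
  "Gamma1_choice n V \<longleftrightarrow> direct_sum_of (UT n) (diag_mats n) (scalar_mats n) V"

definition Gamma1 ::
  "('g, 'r) monoid_scheme \<Rightarrow> nat \<Rightarrow> 'f::field mat set \<Rightarrow> 'g \<Rightarrow> 'g list \<Rightarrow> 'g \<Rightarrow> 'f mat set" where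
  "Gamma1 G n V t \<eta> h = ut_span n
     ({mat_unit n i j | i j. i < j \<and> j < n \<and> deg_prod G \<eta> i j = h} \<union>
      (if h = t then {1\<^sub>m n} else {}) \<union> (if h = \<one>\<^bsub>G\<^esub> then V else {}))"

text \<open>
  Some of the generators below may be zero, which is harmless in a span. The cases \<open>i = j\<close> give
  the degrees \<open>\<one>\<close> and \<open>g\<close> of the diagonal generators.
\<close>

definition Gamma2 ::
  "('g, 'r) monoid_scheme \<Rightarrow> nat \<Rightarrow> 'g \<Rightarrow> 'g list \<Rightarrow> 'g \<Rightarrow> 'f::field mat set" where
  "Gamma2 G n g \<eta> h = ut_span n
     ({X_minus n i j | i j. i \<le> j \<and> j < n \<and> deg_prod G \<eta> i j = h} \<union>
      {X_plus n i j | i j. i \<le> j \<and> j < n \<and> g \<otimes>\<^bsub>G\<^esub> deg_prod G \<eta> i j = h})"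

definition practical_Gamma2 ::
  "('g, 'r) monoid_scheme \<Rightarrow> nat \<Rightarrow> 'f::field mat set \<Rightarrow> 'g \<Rightarrow> 'g \<Rightarrow> 'g list \<Rightarrow> 'g \<Rightarrow> 'f mat set"
  where
  "practical_Gamma2 G n V t g \<eta> h =
     (if h = t then Gamma2 G n g \<eta> t <+>\<^bsub>UT n\<^esub> scalar_mats n
      else if h = g then V
      else Gamma2 G n g \<eta> h)"

text \<open>
  For \<open>t \<noteq> g\<close> an arbitrary complement \<open>V\<close> of the scalar matrices in the component of degree \<open>g\<close>
  need not yield a grading: \<open>V\<close> has to contain the commutators of degree \<open>g\<close>, e.g. it must not
  contain \<open>X + 1\<^sub>m n\<close> with \<open>X\<close> strictly upper triangular of degree \<open>g\<close>. The second conjunct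
  singles out the complements for which the resulting family is indeed a grading.
\<close>

definition Gamma2_choice ::
  "('g, 'r) monoid_scheme \<Rightarrow> nat \<Rightarrow> 'g \<Rightarrow> 'g \<Rightarrow> 'g list \<Rightarrow> 'f::field mat set \<Rightarrow> bool" where
  "Gamma2_choice G n t g \<eta> V \<longleftrightarrow>
     direct_sum_of (UT n) (Gamma2 G n g \<eta> g) V (scalar_mats n) \<and>
     is_grading G (UT n) (practical_Gamma2 G n V t g \<eta>)"

end

theory Submission
  imports Defs
begin

text \<open>
  Both classifications rest on one fact about an arbitrary automorphism \<open>\<psi>\<close> of the Lie algebra of
  upper triangular \<open>n \<times> n\<close> matrices, \<open>superdiagonal_permutation\<close>: modulo second and higher
  superdiagonals, \<open>\<psi>\<close> sends each \<open>e\<^sub>i\<^sub>,\<^sub>i\<^sub>+\<^sub>1\<close> to a nonzero multiple of a single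
  \<open>e\<^sub>j\<^sub>,\<^sub>j\<^sub>+\<^sub>1\<close>, and \<open>i \<mapsto> j\<close> is the identity or the reversal. Indeed \<open>\<psi>\<close> preserves the
  strictly upper triangular matrices \<open>N\<close> and \<open>[N, N]\<close>. On \<open>N / [N, N]\<close> the diagonal matrices act
  with the weights \<open>x \<mapsto> x\<^sub>i\<^sub>i - x\<^sub>i\<^sub>+\<^sub>1\<^sub>,\<^sub>i\<^sub>+\<^sub>1\<close>, which for \<open>n > 2\<close> are pairwise distinct in every
  characteristic, so \<open>\<psi>\<close> permutes the weight spaces. Two of them have a nonzero bracket modulo higher
  superdiagonals exactly when their indices are adjacent, so the permutation is an automorphism of a
  path.

  A (practically) graded isomorphism is an automorphism that respects degrees up to scalar matrices
  (\<open>practically_graded_isomorphic_UT_iff\<close>), and scalar matrices do not meet the superdiagonal. Reading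
  off the degrees of the superdiagonal entries gives necessity. In the elementary case
  (\<open>Gamma1_necessary\<close>) the two sequences agree up to reversal. In the type 2 case
  (\<open>Gamma2_necessary\<close>), the pair of degrees \<open>g\<^sub>i\<close>, \<open>g g\<^sub>i\<close> carried by
  \<open>e\<^sub>i\<^sub>,\<^sub>i\<^sub>+\<^sub>1\<close> and its mirror image is an invariant; it determines \<open>g\<close> and determines \<open>g\<^sub>i\<close> up to
  the factor \<open>g\<close>, while the middle unit, for even \<open>n\<close>, occurs in one degree only. A graded isomorphism also
  maps the identity matrix to a multiple of itself, hence determines \<open>t\<close>.

  For sufficiency, the negative transpose along the antidiagonal reverses an elementary sequence
  (\<open>Gamma1_sufficient\<close>), and conjugation by a diagonal matrix with entries \<open>\<plusminus> 1\<close> exchanges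
  \<open>X\<^sub>i\<^sub>,\<^sub>i\<^sub>+\<^sub>1\<^sup>+\<close> with \<open>X\<^sub>i\<^sub>,\<^sub>i\<^sub>+\<^sub>1\<^sup>-\<close> at any prescribed places, up to sign, which replaces
  \<open>g\<^sub>i\<close> by \<open>g g\<^sub>i\<close> there (\<open>Gamma2_sign_conj\<close>). The chosen complements of the scalar matrices
  are matched afterwards by adding to the automorphism a scalar-valued linear map that vanishes on
  \<open>N\<close> (\<open>central_twist\<close>).
\<close>

section \<open>The Lie algebra of upper triangular matrices\<close>

definition lie_bracket :: "'f::field mat \<Rightarrow> 'f mat \<Rightarrow> 'f mat" where
  "lie_bracket A B = A * B - B * A"

lemma UT_carrier_iff:
  "A \<in> carrier (UT n) \<longleftrightarrow> A \<in> carrier_mat n n \<and> (\<forall>i<n. \<forall>j<i. A $$ (i, j) = 0)"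
  by (auto simp: UT_def upper_triangular_def)

lemma UT_simps:
  "mult (UT n) = lie_bracket" "zero (UT n) = 0\<^sub>m n n" "add (UT n) = (+)"
  "module.smult (UT n) = (\<cdot>\<^sub>m)"
  by (auto simp: UT_def lie_bracket_def fun_eq_iff)

lemma UT_add_closed: "A \<in> carrier (UT n) \<Longrightarrow> B \<in> carrier (UT n) \<Longrightarrow> A + B \<in> carrier (UT n)"
  and UT_diff_closed: "A \<in> carrier (UT n) \<Longrightarrow> B \<in> carrier (UT n) \<Longrightarrow> A - B \<in> carrier (UT n)"
  and UT_smult_closed: "A \<in> carrier (UT n) \<Longrightarrow> c \<cdot>\<^sub>m A \<in> carrier (UT n)"
  and UT_zero_closed: "0\<^sub>m n n \<in> carrier (UT n)"
  and UT_one_closed: "1\<^sub>m n \<in> carrier (UT n)"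
  by (auto simp: UT_carrier_iff)

lemma UT_times_entry:
  assumes "A \<in> carrier (UT n)" "B \<in> carrier (UT n)" "i < n" "j < n"
  shows "(A * B) $$ (i, j) = (\<Sum>k\<in>{i..j}. A $$ (i, k) * B $$ (k, j))"
proof -
  have "(A * B) $$ (i, j) = (\<Sum>k\<in>{0..<n}. A $$ (i, k) * B $$ (k, j))"
    using assms by (auto simp: UT_carrier_iff scalar_prod_def)
  also have "\<dots> = (\<Sum>k\<in>{i..j}. A $$ (i, k) * B $$ (k, j))"
    using assms by (intro sum.mono_neutral_right) (auto simp: UT_carrier_iff)
  finally show ?thesis .
qed

lemma UT_times_closed:
  assumes "A \<in> carrier (UT n)" "B \<in> carrier (UT n)"
  shows "A * B \<in> carrier (UT n)"
  using assms UT_times_entry[OF assms] by (auto simp: UT_carrier_iff)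

lemma UT_bracket_closed:
  "A \<in> carrier (UT n) \<Longrightarrow> B \<in> carrier (UT n) \<Longrightarrow> lie_bracket A B \<in> carrier (UT n)"
  by (simp add: lie_bracket_def UT_diff_closed UT_times_closed)

lemmas UT_closed = UT_add_closed UT_diff_closed UT_smult_closed UT_zero_closed UT_one_closed
  UT_bracket_closed

lemma UT_dim: "A \<in> carrier (UT n) \<Longrightarrow> dim_row A = n \<and> dim_col A = n \<and> A \<in> carrier_mat n n"
  by (auto simp: UT_carrier_iff)

lemma vectorspace_UT: "vectorspace class_ring (UT n :: ('f::field, 'f mat) module)"
proof -
  let ?L = "UT n :: ('f, 'f mat) module"
  have "abelian_group ?L"
  proof (rule abelian_groupI; unfold UT_simps)
    fix x assume x: "x \<in> carrier ?L"
    show "\<exists>y\<in>carrier ?L. y + x = 0\<^sub>m n n"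
      by (rule bexI[of _ "- 1 \<cdot>\<^sub>m x"]) (use x in \<open>auto simp: UT_carrier_iff\<close>)
  qed (auto simp: UT_carrier_iff)
  then have "Module.module class_ring ?L"
    by (intro moduleI class_cring.is_cring)
       (auto simp: UT_simps UT_carrier_iff algebra_simps class_ring_simps)
  then show ?thesis
    unfolding vectorspace_def using class_field by blast
qed

lemma module_UT: "Module.module class_ring (UT n :: ('f::field, 'f mat) module)"
  using vectorspace_UT vectorspace_def by blast

text \<open>
  Graded components are spans of matrix units or of the \<open>X\<^sub>i\<^sub>j\<^sup>\<plusminus>\<close>; a property that is closed
  under linear combinations need only be checked on these.
\<close>

lemma ut_span_induct [consumes 2, case_names zero gen add smult]:
  assumes x: "x \<in> ut_span n S" and S: "S \<subseteq> carrier (UT n)"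
    and zero: "P (0\<^sub>m n n)"
    and gen: "\<And>s. s \<in> S \<Longrightarrow> P s"
    and add: "\<And>x y. x \<in> carrier (UT n) \<Longrightarrow> y \<in> carrier (UT n) \<Longrightarrow> P x \<Longrightarrow> P y \<Longrightarrow> P (x + y)"
    and smult: "\<And>c x. x \<in> carrier (UT n) \<Longrightarrow> P x \<Longrightarrow> P (c \<cdot>\<^sub>m x)"
  shows "P x"
proof -
  have "LinearCombinations.submodule class_ring {x \<in> carrier (UT n). P x} (UT n)"
    unfolding submodule_def using module_UT zero add smult
    by (auto simp: UT_simps UT_closed)
  from LinearCombinations.module.span_is_subset[OF module_UT _ this, of S] show ?thesis
    using S gen x by blast
qed

lemma ut_span_submodule:
  "S \<subseteq> carrier (UT n) \<Longrightarrow> LinearCombinations.submodule class_ring (ut_span n S) (UT n)"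
  using LinearCombinations.module.span_is_submodule[OF module_UT] .

lemma submoduleD:
  assumes "LinearCombinations.submodule class_ring W (UT n)"
  shows "W \<subseteq> carrier (UT n)" "0\<^sub>m n n \<in> W" "x \<in> W \<Longrightarrow> y \<in> W \<Longrightarrow> x + y \<in> W" "x \<in> W \<Longrightarrow> c \<cdot>\<^sub>m x \<in> W"
  using assms unfolding submodule_def by (auto simp: UT_simps)

lemma ut_span_gen: "S \<subseteq> carrier (UT n) \<Longrightarrow> s \<in> S \<Longrightarrow> s \<in> ut_span n S"
  using LinearCombinations.module.in_own_span[OF module_UT] by blast

lemma mat_unit_carrier: "i \<le> j \<Longrightarrow> mat_unit n i j \<in> carrier (UT n)"
  by (auto simp: UT_carrier_iff mat_unit_def)

lemma mat_unit_entry: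
  "r < n \<Longrightarrow> c < n \<Longrightarrow> mat_unit n i j $$ (r, c) = (if r = i \<and> c = j then 1 else 0)"
  by (simp add: mat_unit_def)

text \<open>
  Restricting the case \<open>unit\<close> to the positions where \<open>x\<close> is nonzero makes the rule applicable to the
  ideals of matrices that vanish on the first superdiagonals.
\<close>

lemma mat_unit_induct [consumes 1, case_names zero unit add smult]:
  assumes x: "x \<in> carrier (UT n)"
    and zero: "P (0\<^sub>m n n)"
    and unit: "\<And>a b. a \<le> b \<Longrightarrow> b < n \<Longrightarrow> x $$ (a, b) \<noteq> 0 \<Longrightarrow> P (mat_unit n a b)"
    and add: "\<And>x y. x \<in> carrier (UT n) \<Longrightarrow> y \<in> carrier (UT n) \<Longrightarrow> P x \<Longrightarrow> P y \<Longrightarrow> P (x + y)"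
    and smult: "\<And>c x. x \<in> carrier (UT n) \<Longrightarrow> P x \<Longrightarrow> P (c \<cdot>\<^sub>m x)"
  shows "P x"
proof -
  define S where "S = {(a, b). a \<le> b \<and> b < n \<and> x $$ (a, b) \<noteq> 0}"
  have "S \<subseteq> {..<n} \<times> {..<n}" by (auto simp: S_def)
  then have fin: "finite S" by (rule finite_subset) auto
  have "P y" if "finite S'" "S' \<subseteq> S" "y \<in> carrier (UT n)"
    "\<And>a b. a \<le> b \<Longrightarrow> b < n \<Longrightarrow> y $$ (a, b) \<noteq> 0 \<Longrightarrow> (a, b) \<in> S'" for S' y
    using that
  proof (induction S' arbitrary: y rule: finite_induct)
    case empty
    then have "y = 0\<^sub>m n n"
      by (intro eq_matI) (auto simp: UT_carrier_iff not_le[symmetric] leI)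
    then show ?case using zero by simp
  next
    case (insert p F)
    obtain a b where p: "p = (a, b)" by force
    with insert have ab: "a \<le> b" "b < n" "x $$ (a, b) \<noteq> 0" by (auto simp: S_def)
    define z where "z = y - y $$ (a, b) \<cdot>\<^sub>m mat_unit n a b"
    have z: "z \<in> carrier (UT n)"
      using insert ab by (auto simp: z_def intro!: UT_closed mat_unit_carrier)
    have zab: "z $$ (r, c) = (if (r, c) = (a, b) then 0 else y $$ (r, c))" if "r < n" "c < n" for r c
      using that ab insert.prems by (auto simp: z_def mat_unit_def UT_carrier_iff)
    have "P z"
    proof (rule insert.IH)
      show "(r, c) \<in> F" if "r \<le> c" "c < n" "z $$ (r, c) \<noteq> 0" for r c
        using insert.prems(3)[of r c] that zab[of r c] p by (auto split: if_splits)
    qed (use insert z in auto)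
    moreover have "P (y $$ (a, b) \<cdot>\<^sub>m mat_unit n a b)"
      using ab by (intro smult unit mat_unit_carrier)
    moreover have "y = z + y $$ (a, b) \<cdot>\<^sub>m mat_unit n a b"
      using insert.prems by (intro eq_matI) (auto simp: z_def UT_carrier_iff mat_unit_def)
    ultimately show ?case
      using add[of z "y $$ (a, b) \<cdot>\<^sub>m mat_unit n a b"] z ab by (simp add: UT_closed mat_unit_carrier)
  qed
  from this[OF fin subset_refl x] show ?thesis by (auto simp: S_def)
qed

lemma bracket_diag:
  assumes "A \<in> carrier (UT n)" "B \<in> carrier (UT n)" "i < n"
  shows "lie_bracket A B $$ (i, i) = 0"
  using assms UT_dim[OF assms(1)] UT_dim[OF assms(2)]
  by (simp add: lie_bracket_def UT_times_entry del: index_mult_mat(1))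

lemma bracket_superdiag:
  assumes "A \<in> carrier (UT n)" "B \<in> carrier (UT n)" "Suc i < n"
  shows "lie_bracket A B $$ (i, Suc i) =
    (A $$ (i, i) - A $$ (Suc i, Suc i)) * B $$ (i, Suc i) -
    (B $$ (i, i) - B $$ (Suc i, Suc i)) * A $$ (i, Suc i)"
proof -
  have "{i..Suc i} = {i, Suc i}" by auto
  then show ?thesis
    using assms UT_dim[OF assms(1)] UT_dim[OF assms(2)]
    by (simp add: lie_bracket_def UT_times_entry algebra_simps del: index_mult_mat(1))
qed

lemma bracket_second_diag:
  assumes "A \<in> carrier (UT n)" "B \<in> carrier (UT n)" "Suc (Suc i) < n"
    and "\<And>j. j < n \<Longrightarrow> A $$ (j, j) = 0" "\<And>j. j < n \<Longrightarrow> B $$ (j, j) = 0"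
  shows "lie_bracket A B $$ (i, Suc (Suc i)) =
    A $$ (i, Suc i) * B $$ (Suc i, Suc (Suc i)) - B $$ (i, Suc i) * A $$ (Suc i, Suc (Suc i))"
proof -
  have "{i..Suc (Suc i)} = {i, Suc i, Suc (Suc i)}" by auto
  then show ?thesis
    using assms UT_dim[OF assms(1)] UT_dim[OF assms(2)]
    by (simp add: lie_bracket_def UT_times_entry algebra_simps del: index_mult_mat(1))
qed

lemma unit_times_entry:
  assumes "A \<in> carrier_mat n n" "i < n" "j < n" "a < n" "b < n"
  shows "(mat_unit n a b * A) $$ (i, j) = (if i = a then A $$ (b, j) else 0)"
    and "(A * mat_unit n a b) $$ (i, j) = (if j = b then A $$ (i, a) else 0)"
proof -
  have "(mat_unit n a b * A) $$ (i, j) = (\<Sum>k\<in>{0..<n}. (if i = a \<and> k = b then 1 else 0) * A $$ (k, j))"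
    using assms by (auto simp: mat_unit_def scalar_prod_def)
  also have "\<dots> = (\<Sum>k\<in>{0..<n}. if k = b then (if i = a then A $$ (b, j) else 0) else 0)"
    by (intro sum.cong) auto
  finally show "(mat_unit n a b * A) $$ (i, j) = (if i = a then A $$ (b, j) else 0)"
    using assms by simp
  have "(A * mat_unit n a b) $$ (i, j) = (\<Sum>k\<in>{0..<n}. A $$ (i, k) * (if k = a \<and> j = b then 1 else 0))"
    using assms by (auto simp: mat_unit_def scalar_prod_def)
  also have "\<dots> = (\<Sum>k\<in>{0..<n}. if k = a then (if j = b then A $$ (i, a) else 0) else 0)"
    by (intro sum.cong) auto
  finally show "(A * mat_unit n a b) $$ (i, j) = (if j = b then A $$ (i, a) else 0)"
    using assms by simp
qed

lemma bracket_unit_entry: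
  assumes "A \<in> carrier_mat n n" "i < n" "j < n" "a < n" "b < n"
  shows "lie_bracket A (mat_unit n a b) $$ (i, j) =
    (if j = b then A $$ (i, a) else 0) - (if i = a then A $$ (b, j) else 0)"
proof -
  have "dim_row (mat_unit n a b :: 'a mat) = n" "dim_col (mat_unit n a b :: 'a mat) = n"
    by (simp_all add: mat_unit_def)
  then show ?thesis
    using assms carrier_matD[OF assms(1)]
    by (simp add: lie_bracket_def unit_times_entry del: index_mult_mat(1))
qed

lemma bracket_units:
  assumes "a < n" "b < n" "c < n" "d < n"
  shows "lie_bracket (mat_unit n a b) (mat_unit n c d) =
    (if b = c then mat_unit n a d else 0\<^sub>m n n) - (if d = a then mat_unit n c b else 0\<^sub>m n n)"
    (is "?l = ?r")
proof (rule eq_matI)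
  have c: "mat_unit n a b \<in> carrier_mat n n" for a b :: nat by (simp add: mat_unit_def)
  have r: "?r \<in> carrier_mat n n" using c by (auto simp: mat_unit_def)
  then show "dim_row ?l = dim_row ?r" "dim_col ?l = dim_col ?r" 
    by (auto simp: lie_bracket_def mat_unit_def)
  fix i j assume "i < dim_row ?r" "j < dim_col ?r"
  then have ij: "i < n" "j < n" using r by auto
  show "?l $$ (i, j) = ?r $$ (i, j)"
    unfolding bracket_unit_entry[OF c ij assms(3,4)]
    using ij assms by (cases "b = c"; cases "d = a") (simp_all add: mat_unit_entry mat_unit_def)
qed

section \<open>Automorphisms and the superdiagonal\<close>

text \<open>
  This says that a path has only the two obvious automorphisms. A step taken in one direction fixes the
  direction of all later steps, because turning back would repeat a value.
\<close>

lemma unit_step_path_cases: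
  fixes \<tau> :: "nat \<Rightarrow> nat"
  assumes ran: "\<And>j. j < m \<Longrightarrow> \<tau> j < m"
    and inj: "inj_on \<tau> {..<m}"
    and step: "\<And>j. Suc j < m \<Longrightarrow> \<tau> (Suc j) = Suc (\<tau> j) \<or> \<tau> j = Suc (\<tau> (Suc j))"
  shows "(\<forall>j<m. \<tau> j = j) \<or> (\<forall>j<m. \<tau> j = m - 1 - j)"
proof (cases "m \<le> 1")
  case True
  then show ?thesis using ran by (cases "m = 0") (auto simp: le_Suc_eq)
next
  case False
  have nb: "\<tau> (Suc (Suc j)) \<noteq> \<tau> j" if "Suc (Suc j) < m" for j
    using inj_onD[OF inj, of "Suc (Suc j)" j] that by auto
  from step[of 0] False consider "\<tau> 1 = Suc (\<tau> 0)" | "\<tau> 0 = Suc (\<tau> 1)" by auto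
  then show ?thesis
  proof cases
    case 1
    have up: "Suc j < m \<longrightarrow> \<tau> (Suc j) = Suc (\<tau> j)" for j
    proof (induction j)
      case (Suc j)
      show ?case using Suc step[of "Suc j"] nb[of j] by auto
    qed (use 1 in auto)
    have lin: "j < m \<longrightarrow> \<tau> j = \<tau> 0 + j" for j
      by (induction j) (use up in auto)
    have "\<tau> 0 = 0" using lin[of "m - 1"] ran[of "m - 1"] False by auto
    then show ?thesis using lin by auto
  next
    case 2
    have down: "Suc j < m \<longrightarrow> \<tau> j = Suc (\<tau> (Suc j))" for j
    proof (induction j)
      case (Suc j)
      show ?case using Suc step[of "Suc j"] nb[of j] by auto
    qed (use 2 in auto)
    have lin: "j < m \<longrightarrow> \<tau> 0 = \<tau> j + j" for j
      by (induction j) (use down in auto)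
    have "\<tau> 0 = m - 1" using lin[of "m - 1"] ran[of 0] False by auto
    then show ?thesis using lin by (metis add_diff_cancel_right')
  qed
qed

locale UT_automorphism =
  fixes n :: nat and \<psi> :: "'f::field mat \<Rightarrow> 'f mat"
  assumes bij: "bij_betw \<psi> (carrier (UT n)) (carrier (UT n))"
    and add: "\<And>A B. A \<in> carrier (UT n) \<Longrightarrow> B \<in> carrier (UT n) \<Longrightarrow> \<psi> (A + B) = \<psi> A + \<psi> B"
    and smult: "\<And>c A. A \<in> carrier (UT n) \<Longrightarrow> \<psi> (c \<cdot>\<^sub>m A) = c \<cdot>\<^sub>m \<psi> A"
    and bracket: "\<And>A B. A \<in> carrier (UT n) \<Longrightarrow> B \<in> carrier (UT n) \<Longrightarrow>
      \<psi> (lie_bracket A B) = lie_bracket (\<psi> A) (\<psi> B)"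

lemma alg_iso_UT_iff: "\<psi> \<in> alg_iso (UT n) (UT n) \<longleftrightarrow> UT_automorphism n \<psi>"
  unfolding alg_iso_def LinearCombinations.module_hom_def iso_def hom_def UT_automorphism_def UT_simps
  by (auto dest: bij_betwE)

context UT_automorphism
begin

lemma closed: "A \<in> carrier (UT n) \<Longrightarrow> \<psi> A \<in> carrier (UT n)"
  using bij bij_betwE by blast

lemma dims: "A \<in> carrier (UT n) \<Longrightarrow> dim_row (\<psi> A) = n" "A \<in> carrier (UT n) \<Longrightarrow> dim_col (\<psi> A) = n"
  using UT_dim closed by blast+

lemma map_zero: "\<psi> (0\<^sub>m n n) = 0\<^sub>m n n"
proof -
  have "\<psi> (0 \<cdot>\<^sub>m 0\<^sub>m n n) = 0 \<cdot>\<^sub>m \<psi> (0\<^sub>m n n)" by (rule smult) (rule UT_zero_closed)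
  moreover have "0 \<cdot>\<^sub>m 0\<^sub>m n n = (0\<^sub>m n n :: 'f mat)" "0 \<cdot>\<^sub>m \<psi> (0\<^sub>m n n) = 0\<^sub>m n n"
    using dims[OF UT_zero_closed] by (auto intro!: eq_matI)
  ultimately show ?thesis by simp
qed

lemma diff:
  assumes "A \<in> carrier (UT n)" "B \<in> carrier (UT n)"
  shows "\<psi> (A - B) = \<psi> A - \<psi> B"
proof -
  have "A = (A - B) + B" using assms by (intro eq_matI) (auto simp: UT_carrier_iff)
  then have "\<psi> A = \<psi> (A - B) + \<psi> B" using assms add[of "A - B" B] by (simp add: UT_closed)
  then show ?thesis 
    using assms by (intro eq_matI) (auto simp: dims UT_closed)
qed

lemma inverse: "UT_automorphism n (inv_into (carrier (UT n)) \<psi>)"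
proof -
  let ?L = "carrier (UT n :: ('f, 'f mat) module)"
  let ?\<theta> = "inv_into ?L \<psi>"
  have c: "?\<theta> y \<in> ?L" and r: "\<psi> (?\<theta> y) = y" if "y \<in> ?L" for y
    using that bij bij_betw_inv_into_right[OF bij] bij_betwE[OF bij_betw_inv_into[OF bij]] by auto
  have l: "?\<theta> (\<psi> x) = x" if "x \<in> ?L" for x
    using that bij bij_betw_inv_into_left by fastforce
  show ?thesis
  proof
    show "bij_betw ?\<theta> ?L ?L" by (rule bij_betw_inv_into[OF bij])
    fix A B assume AB: "A \<in> ?L" "B \<in> ?L"
    show "?\<theta> (A + B) = ?\<theta> A + ?\<theta> B"
      using l[of "?\<theta> A + ?\<theta> B"] add[of "?\<theta> A" "?\<theta> B"] AB c r by (simp add: UT_closed)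
    show "?\<theta> (lie_bracket A B) = lie_bracket (?\<theta> A) (?\<theta> B)"
      using l[of "lie_bracket (?\<theta> A) (?\<theta> B)"] bracket[of "?\<theta> A" "?\<theta> B"] AB c r by (simp add: UT_closed)
  next
    fix d A assume A: "A \<in> ?L"
    show "?\<theta> (d \<cdot>\<^sub>m A) = d \<cdot>\<^sub>m ?\<theta> A"
      using l[of "d \<cdot>\<^sub>m ?\<theta> A"] smult[of "?\<theta> A" d] A c r by (simp add: UT_closed)
  qed
qed

text \<open>
  Strictly upper triangular matrices form the derived algebra: \<open>e\<^sub>a\<^sub>b = [e\<^sub>a\<^sub>a, e\<^sub>a\<^sub>b]\<close> for
  \<open>a < b\<close>, and a bracket has zero diagonal.
\<close>

lemma strict_upper:
  assumes x: "x \<in> carrier (UT n)" and "\<And>i. i < n \<Longrightarrow> x $$ (i, i) = 0" and j: "j < n"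
  shows "\<psi> x $$ (j, j) = 0"
proof (rule mat_unit_induct[where P = "\<lambda>x. \<psi> x $$ (j, j) = 0", OF x])
  fix a b assume ab: "a \<le> b" "b < n" "x $$ (a, b) \<noteq> 0"
  then have "a \<noteq> b" using assms by auto
  with ab have "mat_unit n a b = lie_bracket (mat_unit n a a) (mat_unit n a b :: 'f mat)"
    by (subst bracket_units) (auto simp: mat_unit_def)
  then have eq: "\<psi> (mat_unit n a b) = lie_bracket (\<psi> (mat_unit n a a)) (\<psi> (mat_unit n a b))"
    using ab bracket[of "mat_unit n a a" "mat_unit n a b"] by (simp add: mat_unit_carrier)
  show "\<psi> (mat_unit n a b) $$ (j, j) = 0"
    using ab j by (subst eq) (simp add: bracket_diag[where n = n] closed mat_unit_carrier)
qed (use j in \<open>auto simp: map_zero add smult dims\<close>)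

lemma unit_diag: "a < b \<Longrightarrow> b < n \<Longrightarrow> j < n \<Longrightarrow> \<psi> (mat_unit n a b) $$ (j, j) = 0"
  by (rule strict_upper) (auto simp: mat_unit_carrier mat_unit_entry)

text \<open>
  The next term of the series, \<open>[N, N]\<close>: if \<open>b > a + 1\<close>, then
  \<open>e\<^sub>a\<^sub>b = [e\<^sub>a\<^sub>,\<^sub>a\<^sub>+\<^sub>1, e\<^sub>a\<^sub>+\<^sub>1\<^sub>,\<^sub>b]\<close>, and a bracket of strictly upper triangular
  matrices has zero superdiagonal.
\<close>

lemma second_upper:
  assumes x: "x \<in> carrier (UT n)" and d: "\<And>i. i < n \<Longrightarrow> x $$ (i, i) = 0"
    and sd: "\<And>i. Suc i < n \<Longrightarrow> x $$ (i, Suc i) = 0" and j: "Suc j < n"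
  shows "\<psi> x $$ (j, Suc j) = 0"
proof (rule mat_unit_induct[where P = "\<lambda>x. \<psi> x $$ (j, Suc j) = 0", OF x])
  fix a b assume ab: "a \<le> b" "b < n" "x $$ (a, b) \<noteq> 0"
  then have "a \<noteq> b" "b \<noteq> Suc a" using d sd by auto
  with ab have ab': "Suc a < b" by auto
  with ab have "mat_unit n a b = lie_bracket (mat_unit n a (Suc a)) (mat_unit n (Suc a) b :: 'f mat)"
    by (subst bracket_units) (auto simp: mat_unit_def)
  then have "\<psi> (mat_unit n a b) = lie_bracket (\<psi> (mat_unit n a (Suc a))) (\<psi> (mat_unit n (Suc a) b))"
    using ab' bracket[of "mat_unit n a (Suc a)" "mat_unit n (Suc a) b"] by (simp add: mat_unit_carrier)
  then show "\<psi> (mat_unit n a b) $$ (j, Suc j) = 0"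
    using ab ab' j by (simp add: bracket_superdiag[where n = n] closed mat_unit_carrier unit_diag)
qed (use j in \<open>auto simp: map_zero add smult dims\<close>)

text \<open>
  The unit \<open>e\<^sub>i\<^sub>,\<^sub>i\<^sub>+\<^sub>1\<close> is a weight vector modulo \<open>[N, N]\<close>; applying \<open>\<psi>\<close> and comparing entries on
  the superdiagonal shows that the \<open>j\<close>-th weight, pulled back along \<open>\<psi>\<close>, is the \<open>i\<close>-th one.
\<close>

lemma weight_transport:
  assumes x: "x \<in> carrier (UT n)" and i: "Suc i < n" and j: "Suc j < n"
    and nz: "\<psi> (mat_unit n i (Suc i)) $$ (j, Suc j) \<noteq> 0"
  shows "\<psi> x $$ (j, j) - \<psi> x $$ (Suc j, Suc j) = x $$ (i, i) - x $$ (Suc i, Suc i)"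
proof -
  let ?e = "mat_unit n i (Suc i) :: 'f mat" and ?\<alpha> = "x $$ (i, i) - x $$ (Suc i, Suc i)"
  have e: "?e \<in> carrier (UT n)" by (simp add: mat_unit_carrier)
  define y where "y = lie_bracket x ?e - ?\<alpha> \<cdot>\<^sub>m ?e"
  have y: "y \<in> carrier (UT n)" using x e by (simp add: y_def UT_closed)
  have "\<psi> y $$ (j, Suc j) = 0"
  proof (rule second_upper[OF y _ _ j])
    show "y $$ (k, k) = 0" if "k < n" for k
      using that i x e by (auto simp: y_def bracket_diag[where n = n] mat_unit_def)
    show "y $$ (k, Suc k) = 0" if "Suc k < n" for k
      using that i x e by (auto simp: y_def bracket_superdiag[where n = n] mat_unit_def)
  qed
  moreover have "\<psi> y = lie_bracket (\<psi> x) (\<psi> ?e) - ?\<alpha> \<cdot>\<^sub>m \<psi> ?e"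
    unfolding y_def using x e by (simp add: diff UT_closed bracket smult)
  ultimately have "(\<psi> x $$ (j, j) - \<psi> x $$ (Suc j, Suc j)) * \<psi> ?e $$ (j, Suc j)
      = ?\<alpha> * \<psi> ?e $$ (j, Suc j)"
    using i j x e by (simp add: bracket_superdiag[where n = n] closed dims unit_diag)
  then show ?thesis using nz by simp
qed

text \<open>
  Otherwise \<open>\<psi>\<close> would map all of \<open>N\<close> to matrices that vanish at this place. The preimage of
  \<open>e\<^sub>j\<^sub>,\<^sub>j\<^sub>+\<^sub>1\<close> lies in \<open>N\<close> because the inverse of \<open>\<psi>\<close> preserves \<open>N\<close> as well.
\<close>

lemma superdiag_surj:
  assumes j: "Suc j < n"
  shows "\<exists>i. Suc i < n \<and> \<psi> (mat_unit n i (Suc i)) $$ (j, Suc j) \<noteq> 0"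
proof (rule ccontr)
  assume contra: "\<not> ?thesis"
  interpret inv: UT_automorphism n "inv_into (carrier (UT n)) \<psi>" by (rule inverse)
  let ?e = "mat_unit n j (Suc j) :: 'f mat"
  define y where "y = inv_into (carrier (UT n)) \<psi> ?e"
  have e: "?e \<in> carrier (UT n)" by (simp add: mat_unit_carrier)
  have y: "y \<in> carrier (UT n)" "\<psi> y = ?e" 
    using e inv.closed bij_betw_inv_into_right[OF bij] by (auto simp: y_def)
  have yd: "y $$ (i, i) = 0" if "i < n" for i
    unfolding y_def using inv.unit_diag[of j "Suc j" i] j that by simp
  have "\<psi> y $$ (j, Suc j) = 0"
  proof (rule mat_unit_induct[where P = "\<lambda>x. \<psi> x $$ (j, Suc j) = 0", OF y(1)])
    fix a b assume ab: "a \<le> b" "b < n" "y $$ (a, b) \<noteq> 0"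
    then have "a < b" using yd[of a] by (cases "a = b") auto
    show "\<psi> (mat_unit n a b) $$ (j, Suc j) = 0"
    proof (cases "b = Suc a")
      case True
      then show ?thesis using contra ab by blast
    next
      case False
      show ?thesis
        by (rule second_upper) (use False ab \<open>a < b\<close> j in \<open>auto simp: mat_unit_carrier mat_unit_entry\<close>)
    qed
  qed (use j in \<open>auto simp: map_zero add smult dims\<close>)
  then show False using y j by (simp add: mat_unit_entry)
qed

text \<open>
  Two sources would have equal weights, but \<open>e\<^sub>i\<^sub>i\<close> with the smaller index \<open>i\<close> has weight \<open>1\<close> for
  \<open>i\<close> and \<open>0\<close> for the larger index. Evaluating there, and not at the larger index, avoids the
  comparison of \<open>1\<close> with \<open>- 1\<close>, which fails in characteristic 2.
\<close>

lemma superdiag_unique_source: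
  assumes "Suc i < n" "Suc k < n" "Suc j < n"
    and "\<psi> (mat_unit n i (Suc i)) $$ (j, Suc j) \<noteq> 0"
    and "\<psi> (mat_unit n k (Suc k)) $$ (j, Suc j) \<noteq> 0"
  shows "i = k"
proof -
  have False if "i < k" "Suc i < n" "Suc k < n"
    "\<psi> (mat_unit n i (Suc i)) $$ (j, Suc j) \<noteq> 0" "\<psi> (mat_unit n k (Suc k)) $$ (j, Suc j) \<noteq> 0" for i k
  proof -
    have e: "mat_unit n i i \<in> carrier (UT n :: ('f, 'f mat) module)" by (simp add: mat_unit_carrier)
    show False
      using weight_transport[OF e that(2) assms(3) that(4)]
        weight_transport[OF e that(3) assms(3) that(5)] that
      by (simp add: mat_unit_entry)
  qed
  from this[of i k] this[of k i] assms show ?thesis by (meson linorder_neqE_nat)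
qed

text \<open>
  The same comparison of weights on the side of the image; surjectivity of \<open>\<psi>\<close> provides a matrix
  with image \<open>e\<^sub>j\<^sub>j\<close>.
\<close>

lemma superdiag_unique_target:
  assumes "Suc i < n" "Suc j < n" "Suc k < n"
    and "\<psi> (mat_unit n i (Suc i)) $$ (j, Suc j) \<noteq> 0"
    and "\<psi> (mat_unit n i (Suc i)) $$ (k, Suc k) \<noteq> 0"
  shows "j = k"
proof -
  have False if "j < k" "Suc j < n" "Suc k < n"
    "\<psi> (mat_unit n i (Suc i)) $$ (j, Suc j) \<noteq> 0" "\<psi> (mat_unit n i (Suc i)) $$ (k, Suc k) \<noteq> 0" for j k
  proof -
    have e: "mat_unit n j j \<in> carrier (UT n :: ('f, 'f mat) module)" by (simp add: mat_unit_carrier)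
    then obtain x where x: "x \<in> carrier (UT n)" "\<psi> x = mat_unit n j j"
      using bij by (metis bij_betw_iff_bijections)
    show False
      using weight_transport[OF x(1) assms(1) that(2,4)]
        weight_transport[OF x(1) assms(1) that(3,5)] that
      by (simp add: mat_unit_entry x)
  qed
  from this[of j k] this[of k j] assms show ?thesis by (meson linorder_neqE_nat)
qed

text \<open>
  The map \<open>\<tau>\<close> runs from target to source: the superdiagonal entry \<open>j\<close> of the image comes from the
  unit at place \<open>\<tau> j\<close>.
\<close>

theorem superdiagonal_permutation:
  obtains \<tau> where "\<tau> = (\<lambda>j. j) \<or> \<tau> = (\<lambda>j. n - 2 - j)"
    and "\<And>i j. Suc i < n \<Longrightarrow> Suc j < n \<Longrightarrow> \<psi> (mat_unit n i (Suc i)) $$ (j, Suc j) \<noteq> 0 \<longleftrightarrow> i = \<tau> j"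
proof -
  define c where "c i j = \<psi> (mat_unit n i (Suc i)) $$ (j, Suc j)" for i j
  have "\<exists>\<sigma>. \<forall>j. Suc j < n \<longrightarrow> Suc (\<sigma> j) < n \<and> c (\<sigma> j) j \<noteq> 0"
    using superdiag_surj unfolding c_def by metis
  then obtain \<sigma> where \<sigma>: "\<And>j. Suc j < n \<Longrightarrow> Suc (\<sigma> j) < n \<and> c (\<sigma> j) j \<noteq> 0" by blast
  have iff: "c i j \<noteq> 0 \<longleftrightarrow> i = \<sigma> j" if "Suc i < n" "Suc j < n" for i j
    using superdiag_unique_source[of i "\<sigma> j" j] \<sigma>[of j] that unfolding c_def by metis
  \<comment> \<open>Units at non-adjacent places commute, whereas the bracket of their images
    has a nonzero entry on the second superdiagonal when the targets are adjacent.\<close>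
  have step: "\<sigma> (Suc j) = Suc (\<sigma> j) \<or> \<sigma> j = Suc (\<sigma> (Suc j))" if j: "Suc (Suc j) < n" for j
  proof (rule ccontr)
    let ?i = "\<sigma> j" and ?k = "\<sigma> (Suc j)"
    let ?ei = "mat_unit n ?i (Suc ?i) :: 'f mat" and ?ek = "mat_unit n ?k (Suc ?k) :: 'f mat"
    assume "\<not> ?thesis"
    moreover have ik: "Suc ?i < n" "Suc ?k < n" using \<sigma> j by auto
    ultimately have "lie_bracket ?ei ?ek = 0\<^sub>m n n" by (subst bracket_units) auto
    then have "lie_bracket (\<psi> ?ei) (\<psi> ?ek) = 0\<^sub>m n n"
      using bracket[of ?ei ?ek] by (simp add: map_zero mat_unit_carrier)
    moreover have "lie_bracket (\<psi> ?ei) (\<psi> ?ek) $$ (j, Suc (Suc j)) =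
        c ?i j * c ?k (Suc j) - c ?k j * c ?i (Suc j)"
      unfolding c_def using j ik
      by (intro bracket_second_diag) (auto simp: closed mat_unit_carrier unit_diag)
    ultimately have z: "c ?i j * c ?k (Suc j) - c ?k j * c ?i (Suc j) = 0"
      using j by simp
    have "?i \<noteq> ?k"
      using superdiag_unique_target[of ?i j "Suc j"] \<sigma>[of j] \<sigma>[of "Suc j"] j
      by (auto simp: c_def)
    then have "c ?k j = 0" using iff[of ?k j] ik j by simp
    then show False using z \<sigma>[of j] \<sigma>[of "Suc j"] j by simp
  qed
  have "(\<forall>j<n-1. \<sigma> j = j) \<or> (\<forall>j<n-1. \<sigma> j = n - 1 - 1 - j)"
  proof (rule unit_step_path_cases)
    show "\<sigma> j < n - 1" if "j < n - 1" for j
      using \<sigma>[of j] that by (simp add: less_diff_conv)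
    show "inj_on \<sigma> {..<n-1}"
    proof (rule inj_onI)
      fix j k assume "j \<in> {..<n-1}" "k \<in> {..<n-1}" "\<sigma> j = \<sigma> k"
      then show "j = k"
        using superdiag_unique_target[of "\<sigma> j" j k] \<sigma>[of j] \<sigma>[of k] by (auto simp: c_def)
    qed
  qed (use step in auto)
  then show thesis
  proof
    assume "\<forall>j<n-1. \<sigma> j = j"
    then show thesis using iff that[of "\<lambda>j. j"] unfolding c_def by (metis less_diff_conv Suc_eq_plus1)
  next
    assume *: "\<forall>j<n-1. \<sigma> j = n - 1 - 1 - j"
    have "n - 1 - 1 - j = n - 2 - j" for j by simp
    with * show thesis using iff that[of "\<lambda>j. n - 2 - j"] unfolding c_def
      by (metis less_diff_conv Suc_eq_plus1)
  qed
qed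

end

section \<open>The centre and practically graded isomorphisms\<close>

lemma scalar_mats_iff: "z \<in> scalar_mats n \<longleftrightarrow> (\<exists>c. z = c \<cdot>\<^sub>m 1\<^sub>m n)"
  by (auto simp: scalar_mats_def)

lemma scalar_closed: "c \<cdot>\<^sub>m 1\<^sub>m n \<in> carrier (UT n)"
  by (simp add: UT_closed)

lemma lie_center_UT: "lie_center (UT n) = scalar_mats n"
proof (intro equalityI subsetI)
  fix z :: "'a mat" assume "z \<in> lie_center (UT n)"
  then have z: "z \<in> carrier (UT n)" "\<And>x. x \<in> carrier (UT n) \<Longrightarrow> lie_bracket z x = 0\<^sub>m n n"
    by (auto simp: lie_center_def UT_simps)
  have zc: "z \<in> carrier_mat n n" using z(1) UT_dim by blast
  have off: "z $$ (i, j) = 0" if "i \<noteq> j" "i < n" "j < n" for i j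
    using bracket_unit_entry[OF zc, of i j j j] z(2)[of "mat_unit n j j"] that
    by (simp add: mat_unit_carrier)
  have diag: "z $$ (j, j) = z $$ (0, 0)" if "j < n" for j
    using bracket_unit_entry[OF zc, of 0 j 0 j] z(2)[of "mat_unit n 0 j"] that
    by (simp add: mat_unit_carrier)
  have "z = z $$ (0, 0) \<cdot>\<^sub>m 1\<^sub>m n"
  proof (rule eq_matI)
    fix i j assume "i < dim_row (z $$ (0, 0) \<cdot>\<^sub>m 1\<^sub>m n)" "j < dim_col (z $$ (0, 0) \<cdot>\<^sub>m 1\<^sub>m n)"
    then show "z $$ (i, j) = (z $$ (0, 0) \<cdot>\<^sub>m 1\<^sub>m n) $$ (i, j)"
      using off[of i j] diag[of j] by (cases "i = j") auto
  qed (use zc in auto)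
  then show "z \<in> scalar_mats n" unfolding scalar_mats_iff by blast
next
  fix z :: "'a mat" assume "z \<in> scalar_mats n"
  then obtain c where z: "z = c \<cdot>\<^sub>m 1\<^sub>m n" unfolding scalar_mats_iff by blast
  have "lie_bracket z x = 0\<^sub>m n n" if "x \<in> carrier (UT n)" for x
  proof -
    have x: "x \<in> carrier_mat n n" using that UT_dim by blast
    have "z * x = c \<cdot>\<^sub>m x"
      unfolding z using mult_smult_assoc_mat[OF one_carrier_mat x, of c] x by simp
    moreover have "x * z = c \<cdot>\<^sub>m x"
      unfolding z using mult_smult_distrib[OF x one_carrier_mat, of c] x by simp
    ultimately show ?thesis
      unfolding lie_bracket_def using x by (simp add: minus_r_inv_mat)
  qed
  then show "z \<in> lie_center (UT n)"
    by (auto simp: lie_center_def UT_simps z scalar_closed)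
qed

lemma coset_UT: "scalar_mats n +>\<^bsub>UT n\<^esub> x = {c \<cdot>\<^sub>m 1\<^sub>m n + x | c. True}"
  by (auto simp: a_r_coset_def' UT_simps scalar_mats_def)

lemma coset_UT_eq_iff:
  assumes "x \<in> carrier (UT n)" "y \<in> carrier (UT n)"
  shows "scalar_mats n +>\<^bsub>UT n\<^esub> x = scalar_mats n +>\<^bsub>UT n\<^esub> y \<longleftrightarrow> (\<exists>c. x = y + c \<cdot>\<^sub>m 1\<^sub>m n)"
proof
  assume "scalar_mats n +>\<^bsub>UT n\<^esub> x = scalar_mats n +>\<^bsub>UT n\<^esub> y"
  moreover have "x = 0 \<cdot>\<^sub>m 1\<^sub>m n + x"
    using UT_dim[OF assms(1)] by (intro eq_matI) auto
  ultimately obtain c where "x = c \<cdot>\<^sub>m 1\<^sub>m n + y" unfolding coset_UT by blast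
  then have "x = y + c \<cdot>\<^sub>m 1\<^sub>m n" using UT_dim[OF assms(2)] by (intro eq_matI) auto
  then show "\<exists>c. x = y + c \<cdot>\<^sub>m 1\<^sub>m n" by blast
next
  assume "\<exists>c. x = y + c \<cdot>\<^sub>m 1\<^sub>m n"
  then obtain c where c: "x = y + c \<cdot>\<^sub>m 1\<^sub>m n" by blast
  have "d \<cdot>\<^sub>m 1\<^sub>m n + x = (d + c) \<cdot>\<^sub>m 1\<^sub>m n + y" for d
    unfolding c using UT_dim[OF assms(2)] by (intro eq_matI) auto
  moreover have "d \<cdot>\<^sub>m 1\<^sub>m n + y = (d - c) \<cdot>\<^sub>m 1\<^sub>m n + x" for d
    unfolding c using UT_dim[OF assms(2)] by (intro eq_matI) auto
  ultimately show "scalar_mats n +>\<^bsub>UT n\<^esub> x = scalar_mats n +>\<^bsub>UT n\<^esub> y"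
    unfolding coset_UT by blast
qed

lemma quot_alg_simps:
  "carrier (quot_alg L I) = a_rcosets\<^bsub>L\<^esub> I"
  "add (quot_alg L I) = set_add L"
  "mult (quot_alg L I) = rcoset_mult L I"
  "module.smult (quot_alg L I) c C = (\<Union>x\<in>C. I +>\<^bsub>L\<^esub> (c \<odot>\<^bsub>L\<^esub> x))"
  by (auto simp: quot_alg_def FactRing_def ring.defs module.defs)

context UT_automorphism
begin

lemma image_carrier: "\<psi> ` carrier (UT n) = carrier (UT n)"
  using bij bij_betw_imp_surj_on by blast

lemma inj: "inj_on \<psi> (carrier (UT n))"
  using bij bij_betw_imp_inj_on by blast

text \<open>
  An automorphism maps the centre into itself, and so does its inverse.
\<close>

lemma image_center: "\<psi> ` scalar_mats n = scalar_mats n"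
proof -
  have sub: "\<theta> ` lie_center (UT n) \<subseteq> lie_center (UT n)" if "UT_automorphism n \<theta>" for \<theta> :: "'f mat \<Rightarrow> 'f mat"
  proof (rule image_subsetI)
    interpret \<theta>: UT_automorphism n \<theta> by fact
    fix z :: "'f mat" assume "z \<in> lie_center (UT n)"
    then have z: "z \<in> carrier (UT n)" "\<And>x. x \<in> carrier (UT n) \<Longrightarrow> lie_bracket z x = 0\<^sub>m n n"
      by (auto simp: lie_center_def UT_simps)
    have "lie_bracket (\<theta> z) y = 0\<^sub>m n n" if "y \<in> carrier (UT n)" for y
    proof -
      have "y \<in> \<theta> ` carrier (UT n)" using that \<theta>.image_carrier by simp
      then obtain x where x: "x \<in> carrier (UT n)" "y = \<theta> x" by blast
      have "lie_bracket (\<theta> z) (\<theta> x) = \<theta> (lie_bracket z x)"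
        by (rule \<theta>.bracket[symmetric]) (use z x in auto)
      also have "\<dots> = 0\<^sub>m n n" using z(2)[OF x(1)] \<theta>.map_zero by simp
      finally show ?thesis using x by simp
    qed
    then show "\<theta> z \<in> lie_center (UT n)" using z \<theta>.closed by (simp add: lie_center_def UT_simps)
  qed
  have c: "lie_center (UT n) \<subseteq> carrier (UT n :: ('f, 'f mat) module)" by (auto simp: lie_center_def)
  have "\<psi> ` lie_center (UT n) = lie_center (UT n)"
  proof
    show "\<psi> ` lie_center (UT n) \<subseteq> lie_center (UT n)" by (rule sub) unfold_locales
    show "lie_center (UT n) \<subseteq> \<psi> ` lie_center (UT n)"
    proof
      fix z :: "'f mat" assume z: "z \<in> lie_center (UT n)"
      then have "inv_into (carrier (UT n)) \<psi> z \<in> lie_center (UT n)" using sub[OF inverse] by blast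
      moreover have "\<psi> (inv_into (carrier (UT n)) \<psi> z) = z"
        using z c bij_betw_inv_into_right[OF bij] by blast
      ultimately show "z \<in> \<psi> ` lie_center (UT n)" by force
    qed
  qed
  then show ?thesis by (simp add: lie_center_UT)
qed

lemma image_coset:
  assumes "x \<in> carrier (UT n)"
  shows "\<psi> ` (scalar_mats n +>\<^bsub>UT n\<^esub> x) = scalar_mats n +>\<^bsub>UT n\<^esub> \<psi> x"
proof -
  have coset: "scalar_mats n +>\<^bsub>UT n\<^esub> y = (\<lambda>z. z + y) ` scalar_mats n" for y :: "'f mat"
    by (auto simp: a_r_coset_def' UT_simps)
  have "\<psi> (z + x) = \<psi> z + \<psi> x" if "z \<in> scalar_mats n" for z
    using that assms by (auto simp: scalar_mats_iff intro!: add scalar_closed)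
  then have "\<psi> ` (scalar_mats n +>\<^bsub>UT n\<^esub> x) = (\<lambda>z. z + \<psi> x) ` \<psi> ` scalar_mats n"
    by (simp add: coset image_image cong: image_cong)
  then show ?thesis unfolding image_center coset .
qed

text \<open>
  Since \<open>\<psi>\<close> preserves the scalar matrices, taking images of cosets is the induced map on the quotient;
  all operations of the quotient are unions of cosets, with which images commute.
\<close>

lemma quotient_iso:
  "image \<psi> \<in> alg_iso (quot_alg (UT n) (scalar_mats n)) (quot_alg (UT n) (scalar_mats n))"
proof -
  let ?L = "UT n :: ('f, 'f mat) module" and ?Z = "scalar_mats n :: 'f mat set"
  let ?C = "a_rcosets\<^bsub>?L\<^esub> ?Z"
  have C: "D \<in> ?C \<longleftrightarrow> (\<exists>x\<in>carrier ?L. D = ?Z +>\<^bsub>?L\<^esub> x)" for D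
    by (auto simp: A_RCOSETS_def')
  have sub: "D \<subseteq> carrier ?L" if "D \<in> ?C" for D
    using that unfolding C coset_UT by (auto simp: UT_closed)
  have ran: "\<psi> ` D \<in> ?C" if "D \<in> ?C" for D
    using that image_coset closed unfolding C by (elim bexE) auto
  have addh: "\<psi> ` (D <+>\<^bsub>?L\<^esub> E) = \<psi> ` D <+>\<^bsub>?L\<^esub> \<psi> ` E" if "D \<in> ?C" "E \<in> ?C" for D E
  proof -
    have "\<psi> (x + y) = \<psi> x + \<psi> y" if "x \<in> D" "y \<in> E" for x y
      using that sub \<open>D \<in> ?C\<close> \<open>E \<in> ?C\<close> add by blast
    then have "\<psi> ` (\<Union>x\<in>D. \<Union>y\<in>E. {x + y}) = (\<Union>x\<in>D. \<Union>y\<in>E. {\<psi> x + \<psi> y})"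
      by (simp add: image_UN)
    then show ?thesis by (simp add: set_add_def' UT_simps)
  qed
  have UNh: "\<psi> ` (\<Union>x\<in>D. ?Z +>\<^bsub>?L\<^esub> f x) = (\<Union>y\<in>\<psi> ` D. ?Z +>\<^bsub>?L\<^esub> f' y)"
    if "\<And>x. x \<in> D \<Longrightarrow> f x \<in> carrier ?L" "\<And>x. x \<in> D \<Longrightarrow> \<psi> (f x) = f' (\<psi> x)" for D f f'
    using that by (simp add: image_UN image_coset)
  have smulth: "\<psi> ` (\<Union>x\<in>D. ?Z +>\<^bsub>?L\<^esub> (c \<cdot>\<^sub>m x)) = (\<Union>x\<in>\<psi> ` D. ?Z +>\<^bsub>?L\<^esub> (c \<cdot>\<^sub>m x))" if "D \<in> ?C" for c D
  proof (rule UNh)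
    fix x assume "x \<in> D"
    then have x: "x \<in> carrier ?L" using sub[OF that] by blast
    then show "c \<cdot>\<^sub>m x \<in> carrier ?L" "\<psi> (c \<cdot>\<^sub>m x) = c \<cdot>\<^sub>m \<psi> x"
      by (rule UT_smult_closed, rule smult)
  qed
  have multh: "\<psi> ` (\<Union>x\<in>D. \<Union>y\<in>E. ?Z +>\<^bsub>?L\<^esub> lie_bracket x y) =
      (\<Union>x\<in>\<psi> ` D. \<Union>y\<in>\<psi> ` E. ?Z +>\<^bsub>?L\<^esub> lie_bracket x y)" if D: "D \<in> ?C" and E: "E \<in> ?C" for D E
  proof -
    have "\<psi> ` (\<Union>y\<in>E. ?Z +>\<^bsub>?L\<^esub> lie_bracket x y) = (\<Union>y\<in>\<psi> ` E. ?Z +>\<^bsub>?L\<^esub> lie_bracket (\<psi> x) y)"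
      if "x \<in> D" for x
    proof (rule UNh)
      fix y assume "y \<in> E"
      then have "x \<in> carrier ?L" "y \<in> carrier ?L" using sub[OF D] sub[OF E] that by blast+
      then show "lie_bracket x y \<in> carrier ?L" "\<psi> (lie_bracket x y) = lie_bracket (\<psi> x) (\<psi> y)"
        by (rule UT_bracket_closed, rule bracket)
    qed
    then show ?thesis by (simp add: image_UN)
  qed
  have "bij_betw (image \<psi>) ?C ?C"
  proof (rule bij_betwI')
    show "(\<psi> ` D = \<psi> ` E) = (D = E)" if "D \<in> ?C" "E \<in> ?C" for D E
      by (rule inj_on_image_eq_iff[OF inj sub[OF that(1)] sub[OF that(2)]])
    show "\<exists>D\<in>?C. E = \<psi> ` D" if E: "E \<in> ?C" for E
    proof -
      obtain y where y: "y \<in> carrier ?L" "E = ?Z +>\<^bsub>?L\<^esub> y" using E[unfolded C] by blast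
      then obtain x where x: "x \<in> carrier ?L" "y = \<psi> x" using image_carrier by (metis imageE)
      show ?thesis
      proof (rule bexI)
        show "E = \<psi> ` (?Z +>\<^bsub>?L\<^esub> x)" unfolding image_coset[OF x(1)] using x y by simp
        show "?Z +>\<^bsub>?L\<^esub> x \<in> ?C" using C x by blast
      qed
    qed
  qed (rule ran)
  then show ?thesis
    unfolding alg_iso_def LinearCombinations.module_hom_def iso_def hom_def
      quot_alg_simps UT_simps rcoset_mult_def
    using ran addh smulth multh by simp
qed

end

text \<open>
  The induced map on the quotient is determined by \<open>\<psi>\<close>, so the condition can be stated on matrices:
  degrees are respected up to the addition of scalar matrices.
\<close>

lemma practically_graded_isomorphic_UT_iff:
  fixes A B :: "'g \<Rightarrow> 'f::field mat set"
  assumes A: "\<And>h. h \<in> carrier G \<Longrightarrow> A h \<subseteq> carrier (UT n)"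
    and B: "\<And>h. h \<in> carrier G \<Longrightarrow> B h \<subseteq> carrier (UT n)"
  shows "practically_graded_isomorphic G (UT n) A (UT n) B \<longleftrightarrow>
    (\<exists>\<psi>. UT_automorphism n \<psi> \<and>
      (\<forall>h\<in>carrier G. \<forall>x\<in>A h. \<exists>y\<in>B h. \<exists>c. \<psi> x = y + c \<cdot>\<^sub>m 1\<^sub>m n))" (is "?L \<longleftrightarrow> ?R")
proof
  assume ?L
  then obtain \<psi> \<phi> where "\<psi> \<in> alg_iso (UT n) (UT n)"
    and \<phi>: "\<forall>h\<in>carrier G. \<phi> ` quot_comp (UT n) (scalar_mats n) A h
        \<subseteq> quot_comp (UT n) (scalar_mats n) B h"
    and c: "\<forall>x\<in>carrier (UT n).
        \<phi> (scalar_mats n +>\<^bsub>UT n\<^esub> x) = scalar_mats n +>\<^bsub>UT n\<^esub> \<psi> x"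
    unfolding practically_graded_isomorphic_def graded_iso_def lie_center_UT by blast
  then have \<psi>: "UT_automorphism n \<psi>" by (simp add: alg_iso_UT_iff)
  interpret UT_automorphism n \<psi> by fact
  have "\<exists>y\<in>B h. \<exists>c. \<psi> x = y + c \<cdot>\<^sub>m 1\<^sub>m n" if h: "h \<in> carrier G" and x: "x \<in> A h" for h x
  proof -
    have "scalar_mats n +>\<^bsub>UT n\<^esub> \<psi> x \<in> quot_comp (UT n) (scalar_mats n) B h"
      using bspec[OF \<phi> h] bspec[OF c, of x] x A[OF h] by (force simp: quot_comp_def)
    then obtain y where y: "y \<in> B h" "scalar_mats n +>\<^bsub>UT n\<^esub> \<psi> x = scalar_mats n +>\<^bsub>UT n\<^esub> y"
      by (auto simp: quot_comp_def)
    have "x \<in> carrier (UT n)" "y \<in> carrier (UT n)"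
      using A[OF h] B[OF h] x y(1) by blast+
    then have "\<exists>c. \<psi> x = y + c \<cdot>\<^sub>m 1\<^sub>m n" using coset_UT_eq_iff[of "\<psi> x" n y] closed y(2) by simp
    with y(1) show ?thesis by (rule bexI[rotated])
  qed
  then show ?R using \<psi> by blast
next
  assume ?R
  then obtain \<psi> where \<psi>: "UT_automorphism n \<psi>"
    and \<psi>': "\<And>h x. h \<in> carrier G \<Longrightarrow> x \<in> A h \<Longrightarrow> \<exists>y\<in>B h. \<exists>c. \<psi> x = y + c \<cdot>\<^sub>m 1\<^sub>m n" by blast
  interpret UT_automorphism n \<psi> by fact
  have "image \<psi> ` quot_comp (UT n) (scalar_mats n) A h \<subseteq> quot_comp (UT n) (scalar_mats n) B h"
    if h: "h \<in> carrier G" for h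
  proof -
    have "\<psi> ` (scalar_mats n +>\<^bsub>UT n\<^esub> x) \<in> quot_comp (UT n) (scalar_mats n) B h" if x: "x \<in> A h" for x
    proof -
      obtain y where y: "y \<in> B h" "\<exists>c. \<psi> x = y + c \<cdot>\<^sub>m 1\<^sub>m n" using \<psi>'[OF h x] by blast
      have *: "x \<in> carrier (UT n)" "y \<in> carrier (UT n)"
        using A[OF h] B[OF h] x y(1) by blast+
      then have "scalar_mats n +>\<^bsub>UT n\<^esub> \<psi> x = scalar_mats n +>\<^bsub>UT n\<^esub> y"
        using y(2) coset_UT_eq_iff[of "\<psi> x" n y] closed by simp
      then show ?thesis using image_coset[OF *(1)] y(1) by (auto simp: quot_comp_def)
    qed
    then show ?thesis by (auto simp: quot_comp_def)
  qed
  then show ?L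
    unfolding practically_graded_isomorphic_def graded_iso_def lie_center_UT
    using quotient_iso image_coset \<psi>
    by (intro bexI[of _ \<psi>] bexI[of _ "image \<psi>"]) (simp_all add: alg_iso_UT_iff)
qed

lemma graded_isomorphic_UT_iff:
  "graded_isomorphic G (UT n) A (UT n) B \<longleftrightarrow>
    (\<exists>\<psi>. UT_automorphism n \<psi> \<and> (\<forall>h\<in>carrier G. \<forall>x\<in>A h. \<psi> x \<in> B h))"
  unfolding graded_isomorphic_def graded_iso_def alg_iso_UT_iff by blast

section \<open>Three kinds of automorphisms\<close>

lemma times_entry:
  assumes "A \<in> carrier_mat n n" "B \<in> carrier_mat n n" "i < n" "j < n"
  shows "(A * B) $$ (i, j) = (\<Sum>k<n. A $$ (i, k) * B $$ (k, j))"
  using assms by (auto simp: scalar_prod_def atLeast0LessThan)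

lemma bracket_entry:
  assumes "A \<in> carrier_mat n n" "B \<in> carrier_mat n n" "i < n" "j < n"
  shows "lie_bracket A B $$ (i, j) =
    (\<Sum>k<n. A $$ (i, k) * B $$ (k, j)) - (\<Sum>k<n. B $$ (i, k) * A $$ (k, j))"
  using assms times_entry[OF assms] times_entry[OF assms(2,1,3,4)]
  by (simp add: lie_bracket_def del: index_mult_mat(1))

lemma bracket_carrier_mat:
  "A \<in> carrier_mat n n \<Longrightarrow> B \<in> carrier_mat n n \<Longrightarrow> lie_bracket A B \<in> carrier_mat n n"
  by (auto simp: lie_bracket_def)

definition sign_conj :: "nat \<Rightarrow> (nat \<Rightarrow> 'f) \<Rightarrow> 'f::field mat \<Rightarrow> 'f mat" where
  "sign_conj n d A = mat n n (\<lambda>(i, j). d i * A $$ (i, j) * d j)"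

text \<open>
  The negative of the transpose along the antidiagonal; the sign turns an anti-automorphism of the
  matrix algebra into an automorphism of the Lie algebra.
\<close>

definition neg_flip :: "nat \<Rightarrow> 'f::field mat \<Rightarrow> 'f mat" where
  "neg_flip n A = mat n n (\<lambda>(i, j). - A $$ (n - 1 - j, n - 1 - i))"

lemma UT_automorphism_id: "UT_automorphism n (\<lambda>x. x)"
  by unfold_locales (auto simp: bij_betw_def)

lemma UT_automorphism_sign_conj:
  fixes d :: "nat \<Rightarrow> 'f::field"
  assumes d: "\<And>i. i < n \<Longrightarrow> d i * d i = 1"
  shows "UT_automorphism n (sign_conj n d)"
proof
  let ?L = "carrier (UT n :: ('f, 'f mat) module)"
  have c: "sign_conj n d A \<in> ?L" if "A \<in> ?L" for A
    using that by (auto simp: sign_conj_def UT_carrier_iff)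
  have inv: "sign_conj n d (sign_conj n d A) = A" if "A \<in> ?L" for A
  proof (rule eq_matI)
    fix i j assume "i < dim_row A" "j < dim_col A"
    then have ij: "i < n" "j < n" using UT_dim[OF that] by auto
    have "d i * (d i * A $$ (i, j) * d j) * d j = (d i * d i) * A $$ (i, j) * (d j * d j)"
      by (simp only: ac_simps)
    then show "sign_conj n d (sign_conj n d A) $$ (i, j) = A $$ (i, j)"
      using ij d by (simp add: sign_conj_def)
  qed (use UT_dim[OF that] in \<open>auto simp: sign_conj_def\<close>)
  show "bij_betw (sign_conj n d) ?L ?L"
    by (rule bij_betw_byWitness[where f' = "sign_conj n d"]) (use c inv in auto)
  fix A B :: "'f mat" assume A: "A \<in> ?L"
  have Ac: "A \<in> carrier_mat n n" using A UT_dim by blast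
  show "sign_conj n d (k \<cdot>\<^sub>m A) = k \<cdot>\<^sub>m sign_conj n d A" for k
    using Ac by (intro eq_matI) (auto simp: sign_conj_def)
  assume B: "B \<in> ?L"
  have Bc: "B \<in> carrier_mat n n" using B UT_dim by blast
  show "sign_conj n d (A + B) = sign_conj n d A + sign_conj n d B"
    using Ac Bc by (intro eq_matI) (auto simp: sign_conj_def algebra_simps)
  show "sign_conj n d (lie_bracket A B) = lie_bracket (sign_conj n d A) (sign_conj n d B)" (is "?l = ?r")
  proof (rule eq_matI)
    have cc: "sign_conj n d X \<in> carrier_mat n n" for X by (simp add: sign_conj_def)
    have r: "?r \<in> carrier_mat n n" by (intro bracket_carrier_mat cc)
    then show "dim_row ?l = dim_row ?r" "dim_col ?l = dim_col ?r" by (auto simp: sign_conj_def)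
    fix i j assume "i < dim_row ?r" "j < dim_col ?r"
    then have ij: "i < n" "j < n" using r by auto
    have s: "(\<Sum>k<n. sign_conj n d X $$ (i, k) * sign_conj n d Y $$ (k, j)) =
        d i * (\<Sum>k<n. X $$ (i, k) * Y $$ (k, j)) * d j" for X Y
    proof -
      have "sign_conj n d X $$ (i, k) * sign_conj n d Y $$ (k, j) =
          d i * (X $$ (i, k) * Y $$ (k, j)) * d j" if "k < n" for k
      proof -
        have "sign_conj n d X $$ (i, k) * sign_conj n d Y $$ (k, j) =
          (d k * d k) * (d i * (X $$ (i, k) * Y $$ (k, j)) * d j)"
          using that ij by (simp add: sign_conj_def ac_simps)
        then show ?thesis using d[OF that] by simp
      qed
      then show ?thesis by (simp add: sum_distrib_left sum_distrib_right)
    qed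
    show "?l $$ (i, j) = ?r $$ (i, j)"
      unfolding bracket_entry[OF cc cc ij] s
      using ij by (simp add: sign_conj_def[of n d "lie_bracket A B"] bracket_entry[OF Ac Bc ij] algebra_simps)
  qed
qed

lemma UT_automorphism_neg_flip: "UT_automorphism n (neg_flip n :: 'f::field mat \<Rightarrow> 'f mat)"
proof
  let ?L = "carrier (UT n :: ('f, 'f mat) module)"
  have c: "neg_flip n A \<in> ?L" if "A \<in> ?L" for A
    using that by (auto simp: neg_flip_def UT_carrier_iff)
  have inv: "neg_flip n (neg_flip n A) = A" if "A \<in> ?L" for A
    using UT_dim[OF that] by (intro eq_matI) (auto simp: neg_flip_def)
  show "bij_betw (neg_flip n) ?L ?L"
    by (rule bij_betw_byWitness[where f' = "neg_flip n"]) (use c inv in auto)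
  fix A B :: "'f mat" assume A: "A \<in> ?L"
  have Ac: "A \<in> carrier_mat n n" using A UT_dim by blast
  show "neg_flip n (k \<cdot>\<^sub>m A) = k \<cdot>\<^sub>m neg_flip n A" for k
    using Ac by (intro eq_matI) (auto simp: neg_flip_def)
  assume B: "B \<in> ?L"
  have Bc: "B \<in> carrier_mat n n" using B UT_dim by blast
  show "neg_flip n (A + B) = neg_flip n A + neg_flip n B"
    using Ac Bc by (intro eq_matI) (auto simp: neg_flip_def algebra_simps)
  show "neg_flip n (lie_bracket A B) = lie_bracket (neg_flip n A) (neg_flip n B)" (is "?l = ?r")
  proof (rule eq_matI)
    have cc: "neg_flip n X \<in> carrier_mat n n" for X :: "'f mat" by (simp add: neg_flip_def)
    have r: "?r \<in> carrier_mat n n" by (intro bracket_carrier_mat cc)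
    then show "dim_row ?l = dim_row ?r" "dim_col ?l = dim_col ?r" by (auto simp: neg_flip_def)
    fix i j assume "i < dim_row ?r" "j < dim_col ?r"
    then have ij: "i < n" "j < n" using r by auto
    then have ij': "n - 1 - j < n" "n - 1 - i < n" by auto
    have s: "(\<Sum>k<n. neg_flip n X $$ (i, k) * neg_flip n Y $$ (k, j)) =
        (\<Sum>k<n. Y $$ (n - 1 - j, k) * X $$ (k, n - 1 - i))" for X Y :: "'f mat"
    proof -
      have "(\<Sum>k<n. neg_flip n X $$ (i, k) * neg_flip n Y $$ (k, j)) =
          (\<Sum>k<n. Y $$ (n - 1 - j, n - Suc k) * X $$ (n - Suc k, n - 1 - i))"
        using ij by (intro sum.cong) (auto simp: neg_flip_def)
      then show ?thesis
        by (simp only: sum.nat_diff_reindex[of "\<lambda>k. Y $$ (n - 1 - j, k) * X $$ (k, n - 1 - i)"])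
    qed
    have "?l $$ (i, j) = - lie_bracket A B $$ (n - 1 - j, n - 1 - i)"
      using ij by (simp add: neg_flip_def)
    then show "?l $$ (i, j) = ?r $$ (i, j)"
      unfolding bracket_entry[OF cc cc ij] s bracket_entry[OF Ac Bc ij'] by simp
  qed
qed

text \<open>
  These are the projections to the scalar matrices along a complement that contains all strictly upper
  triangular matrices. They are written as functionals, which makes them easy to compose with
  automorphisms.
\<close>

definition central_functional :: "nat \<Rightarrow> ('f::field mat \<Rightarrow> 'f) \<Rightarrow> bool" where
  "central_functional n \<mu> \<longleftrightarrow>
    (\<forall>A\<in>carrier (UT n). \<forall>B\<in>carrier (UT n). \<mu> (A + B) = \<mu> A + \<mu> B) \<and>
    (\<forall>c. \<forall>A\<in>carrier (UT n). \<mu> (c \<cdot>\<^sub>m A) = c * \<mu> A) \<and>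
    (\<forall>A\<in>carrier (UT n). (\<forall>i<n. A $$ (i, i) = 0) \<longrightarrow> \<mu> A = 0) \<and>
    \<mu> (1\<^sub>m n) = 1"

text \<open>
  The added functional vanishes on brackets and on the identity matrix. The first property keeps brackets
  intact, since scalar matrices are central, and the second keeps the map bijective, since the correction
  does not see scalar matrices. If \<open>\<mu>\<close> and \<open>\<mu>'\<close> project along \<open>V\<close> and \<open>V'\<close>, and \<open>\<psi>\<close> maps
  \<open>V\<close> into the space in which \<open>V'\<close> complements the scalar matrices, then the twisted map sends \<open>V\<close>
  into \<open>V'\<close>, because it replaces \<open>\<psi> x\<close> by its projection.
\<close>

lemma (in UT_automorphism) central_twist:
  assumes one: "\<psi> (1\<^sub>m n) = e \<cdot>\<^sub>m 1\<^sub>m n" and e: "e \<noteq> 0"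
    and \<mu>: "central_functional n \<mu>" and \<mu>': "central_functional n \<mu>'"
  shows "UT_automorphism n (\<lambda>x. \<psi> x + (e * \<mu> x - \<mu>' (\<psi> x)) \<cdot>\<^sub>m 1\<^sub>m n)"
proof -
  let ?L = "carrier (UT n :: ('f, 'f mat) module)"
  define l where "l x = e * \<mu> x - \<mu>' (\<psi> x)" for x
  have l_add: "l (A + B) = l A + l B" if "A \<in> ?L" "B \<in> ?L" for A B
    using that \<mu> \<mu>' closed add by (simp add: l_def central_functional_def algebra_simps)
  have l_smult: "l (c \<cdot>\<^sub>m A) = c * l A" if "A \<in> ?L" for c A
    using that \<mu> \<mu>' closed smult by (simp add: l_def central_functional_def algebra_simps)
  have l_bracket: "l (lie_bracket A B) = 0" if "A \<in> ?L" "B \<in> ?L" for A B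
    using that \<mu> \<mu>' closed[of A] closed[of B] bracket[of A B] 
    by (simp add: l_def central_functional_def bracket_diag[where n = n] UT_bracket_closed)
  have l_one: "l (1\<^sub>m n) = 0"
    using \<mu> \<mu>' by (simp add: l_def central_functional_def one UT_one_closed)
  have l_scalar: "l (c \<cdot>\<^sub>m 1\<^sub>m n) = 0" for c
    using l_smult[OF UT_one_closed] l_one by simp
  have scalar: "\<psi> (c \<cdot>\<^sub>m 1\<^sub>m n) = (c * e) \<cdot>\<^sub>m 1\<^sub>m n" for c
    using smult[OF UT_one_closed, of c] one by (auto intro!: eq_matI)
  define F where "F x = \<psi> x + l x \<cdot>\<^sub>m 1\<^sub>m n" for x
  have Fc: "F x \<in> ?L" if "x \<in> ?L" for x using that by (simp add: F_def UT_closed closed)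
  have "UT_automorphism n F"
  proof
    show "bij_betw F ?L ?L"
    proof (rule bij_betwI')
      fix x y assume x: "x \<in> ?L" and y: "y \<in> ?L"
      show "F x = F y \<longleftrightarrow> x = y"
      proof
        assume eq: "F x = F y"
        define d where "d = (l y - l x) / e"
        have "\<psi> x $$ (i, j) + l x * (1\<^sub>m n $$ (i, j)) = \<psi> y $$ (i, j) + l y * (1\<^sub>m n $$ (i, j))"
          if "i < n" "j < n" for i j
          using arg_cong[OF eq, of "\<lambda>M. M $$ (i, j)"] that x y by (simp add: F_def dims)
        then have "\<psi> x = \<psi> y + (l y - l x) \<cdot>\<^sub>m 1\<^sub>m n"
          using x y by (intro eq_matI) (simp_all add: dims algebra_simps)
        also have "\<dots> = \<psi> (y + d \<cdot>\<^sub>m 1\<^sub>m n)"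
          using y e by (simp add: add UT_closed scalar d_def)
        finally have xy: "x = y + d \<cdot>\<^sub>m 1\<^sub>m n"
          using inj x y by (simp add: inj_on_eq_iff UT_closed)
        then have "l x = l y" using l_add[OF y scalar_closed] l_scalar by simp
        then have "d = 0" by (simp add: d_def)
        then show "x = y" unfolding xy using y UT_dim[OF y] by (intro eq_matI) auto
      qed simp
    next
      fix y assume y: "y \<in> ?L"
      then have "y \<in> \<psi> ` ?L" by (simp add: image_carrier)
      then obtain x where x: "x \<in> ?L" "y = \<psi> x" by blast
      define z where "z = x + (- l x / e) \<cdot>\<^sub>m 1\<^sub>m n"
      have z: "z \<in> ?L" using x by (simp add: z_def UT_closed)
      have "l z = l x" using l_add[OF x(1) scalar_closed] l_scalar by (simp add: z_def)
      moreover have "\<psi> z = y + (- l x) \<cdot>\<^sub>m 1\<^sub>m n"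
        using x e add[OF x(1) scalar_closed, of "- l x / e"] by (simp add: z_def scalar)
      ultimately have "F z = y" unfolding F_def using UT_dim[OF y] by (intro eq_matI) auto
      then show "\<exists>x\<in>?L. y = F x" using z by blast
    qed (rule Fc)
    fix A B assume A: "A \<in> ?L"
    show "F (k \<cdot>\<^sub>m A) = k \<cdot>\<^sub>m F A" for k
      using A by (intro eq_matI) (simp_all add: F_def smult l_smult dims algebra_simps)
    assume B: "B \<in> ?L"
    show "F (A + B) = F A + F B"
      using A B by (intro eq_matI) (simp_all add: F_def add l_add dims algebra_simps)
    have A': "\<psi> A \<in> carrier_mat n n" and B': "\<psi> B \<in> carrier_mat n n"
      using A B closed UT_dim by blast+
    have "lie_bracket (F A) (F B) = lie_bracket (\<psi> A) (\<psi> B)"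
    proof (rule eq_matI)
      fix i j assume "i < dim_row (lie_bracket (\<psi> A) (\<psi> B))" "j < dim_col (lie_bracket (\<psi> A) (\<psi> B))"
      then have ij: "i < n" "j < n" using carrier_matD[OF bracket_carrier_mat[OF A' B']] by auto
      have FF: "F A \<in> carrier_mat n n" "F B \<in> carrier_mat n n" using Fc A B UT_dim by blast+
      have s: "(\<Sum>k<n. F X $$ (i, k) * F Y $$ (k, j)) = (\<Sum>k<n. \<psi> X $$ (i, k) * \<psi> Y $$ (k, j))
          + l X * \<psi> Y $$ (i, j) + l Y * \<psi> X $$ (i, j) + (if i = j then l X * l Y else 0)"
        if X: "X \<in> ?L" and Y: "Y \<in> ?L" for X Y
      proof -
        have "F X $$ (i, k) * F Y $$ (k, j) = \<psi> X $$ (i, k) * \<psi> Y $$ (k, j) +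
          (if k = i then l X * \<psi> Y $$ (i, j) else 0) + (if k = j then l Y * \<psi> X $$ (i, j) else 0)
          + (if k = i then if i = j then l X * l Y else 0 else 0)"
          if k: "k < n" for k
          using k ij X Y by (auto simp: F_def dims algebra_simps)
        then have "(\<Sum>k<n. F X $$ (i, k) * F Y $$ (k, j)) = (\<Sum>k<n. \<psi> X $$ (i, k) * \<psi> Y $$ (k, j) +
          (if k = i then l X * \<psi> Y $$ (i, j) else 0) + (if k = j then l Y * \<psi> X $$ (i, j) else 0)
          + (if k = i then if i = j then l X * l Y else 0 else 0))"
          by (intro sum.cong) auto
        also have "\<dots> = (\<Sum>k<n. \<psi> X $$ (i, k) * \<psi> Y $$ (k, j))
          + l X * \<psi> Y $$ (i, j) + l Y * \<psi> X $$ (i, j) + (if i = j then l X * l Y else 0)"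
          unfolding sum.distrib sum.delta[OF finite_lessThan] using ij by simp
        finally show ?thesis .
      qed
      show "lie_bracket (F A) (F B) $$ (i, j) = lie_bracket (\<psi> A) (\<psi> B) $$ (i, j)"
        unfolding bracket_entry[OF FF ij] bracket_entry[OF A' B' ij] s[OF A B] s[OF B A]
        by (simp add: algebra_simps)
    qed (use Fc[OF A] Fc[OF B] A' B' UT_dim in \<open>auto simp: lie_bracket_def F_def\<close>)
    moreover have "F (lie_bracket A B) = lie_bracket (\<psi> A) (\<psi> B)"
      unfolding F_def using A B bracket[OF A B] l_bracket[OF A B] 
        bracket_carrier_mat[OF A' B'] by (intro eq_matI) auto
    ultimately show "F (lie_bracket A B) = lie_bracket (F A) (F B)" by simp
  qed
  then show ?thesis unfolding F_def l_def .
qed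

lemma direct_sum_scalar:
  fixes V :: "'f::field mat set"
  assumes "direct_sum_of (UT n) U V (scalar_mats n) \<or> direct_sum_of (UT n) U (scalar_mats n) V"
  shows "LinearCombinations.submodule class_ring V (UT n)"
    and "V \<inter> scalar_mats n = {0\<^sub>m n n}"
    and "x \<in> U \<Longrightarrow> \<exists>c. x - c \<cdot>\<^sub>m 1\<^sub>m n \<in> V"
    and "x \<in> V \<Longrightarrow> x + c \<cdot>\<^sub>m 1\<^sub>m n \<in> U"
proof -
  show V: "LinearCombinations.submodule class_ring V (UT n)"
    using assms unfolding direct_sum_of_def subspace_def by blast
  show "V \<inter> scalar_mats n = {0\<^sub>m n n}"
    using assms unfolding direct_sum_of_def UT_simps by blast
  have Vc: "v \<in> carrier (UT n)" if "v \<in> V" for v using submoduleD(1)[OF V] that by blast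
  have comm: "v + c \<cdot>\<^sub>m 1\<^sub>m n = c \<cdot>\<^sub>m 1\<^sub>m n + v" if "v \<in> V" for v c
    using UT_dim[OF Vc[OF that]] by (intro eq_matI) auto
  have U: "U = {v + c \<cdot>\<^sub>m 1\<^sub>m n | v c. v \<in> V}"
    using assms
  proof
    assume "direct_sum_of (UT n) U V (scalar_mats n)"
    then show ?thesis unfolding direct_sum_of_def set_add_def' UT_simps scalar_mats_def by blast
  next
    assume "direct_sum_of (UT n) U (scalar_mats n) V"
    then have "U = {c \<cdot>\<^sub>m 1\<^sub>m n + v | v c. v \<in> V}"
      unfolding direct_sum_of_def set_add_def' UT_simps scalar_mats_def by blast
    also have "\<dots> = {v + c \<cdot>\<^sub>m 1\<^sub>m n | v c. v \<in> V}" using comm by metis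
    finally show ?thesis .
  qed
  then show "x \<in> V \<Longrightarrow> x + c \<cdot>\<^sub>m 1\<^sub>m n \<in> U" by blast
  assume "x \<in> U"
  then obtain v c where v: "v \<in> V" "x = v + c \<cdot>\<^sub>m 1\<^sub>m n" using U by blast
  have "x - c \<cdot>\<^sub>m 1\<^sub>m n = v" unfolding v using UT_dim[OF Vc[OF v(1)]] by (intro eq_matI) auto
  then show "\<exists>c. x - c \<cdot>\<^sub>m 1\<^sub>m n \<in> V" using v by blast
qed

definition scalar_part :: "nat \<Rightarrow> 'f::field mat set \<Rightarrow> 'f mat \<Rightarrow> 'f" where
  "scalar_part n V x = (THE c. x - c \<cdot>\<^sub>m 1\<^sub>m n \<in> V)"

lemma submodule_diff:
  assumes "LinearCombinations.submodule class_ring V (UT n)" "x \<in> V" "y \<in> V"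
  shows "x - y \<in> V"
proof -
  have xy: "x \<in> carrier (UT n)" "y \<in> carrier (UT n)" using submoduleD(1)[OF assms(1)] assms(2,3) by blast+
  have "x + (- 1) \<cdot>\<^sub>m y \<in> V" using submoduleD(3,4)[OF assms(1)] assms(2,3) by blast
  moreover have "x + (- 1) \<cdot>\<^sub>m y = x - y"
    using UT_dim[OF xy(1)] UT_dim[OF xy(2)] by (intro eq_matI) auto
  ultimately show ?thesis by simp
qed

text \<open>
  Uniqueness comes from \<open>n > 0\<close>: for \<open>n = 0\<close> all scalar matrices coincide.
\<close>

lemma scalar_part_eqI:
  fixes V :: "'f::field mat set"
  assumes n: "n > 0" and V: "LinearCombinations.submodule class_ring V (UT n)"
    and int: "V \<inter> scalar_mats n = {0\<^sub>m n n}"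
    and x: "x \<in> carrier (UT n)" "x - c \<cdot>\<^sub>m 1\<^sub>m n \<in> V"
  shows "scalar_part n V x = c"
  unfolding scalar_part_def
proof (rule the_equality)
  fix d assume d: "x - d \<cdot>\<^sub>m 1\<^sub>m n \<in> V"
  have "(x - c \<cdot>\<^sub>m 1\<^sub>m n) - (x - d \<cdot>\<^sub>m 1\<^sub>m n) = (d - c) \<cdot>\<^sub>m 1\<^sub>m n"
    using UT_dim[OF x(1)] by (intro eq_matI) (auto simp: algebra_simps)
  then have "(d - c) \<cdot>\<^sub>m 1\<^sub>m n \<in> V \<inter> scalar_mats n"
    using submodule_diff[OF V x(2) d] by (auto simp: scalar_mats_iff)
  then have eq: "(d - c) \<cdot>\<^sub>m 1\<^sub>m n = (0\<^sub>m n n :: 'f mat)" using int by blast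
  have "((d - c) \<cdot>\<^sub>m 1\<^sub>m n) $$ (0, 0) = (0\<^sub>m n n :: 'f mat) $$ (0, 0)" unfolding eq ..
  then show "d = c" using n by simp
qed (rule x)

text \<open>
  The complements only live inside a subspace \<open>U\<close> (the diagonal matrices, or the component of
  degree \<open>g\<close>). A linear map \<open>p\<close> into \<open>U\<close> that depends on the diagonal alone and fixes the identity
  matrix extends the projection along the complement to all upper triangular matrices.
\<close>

lemma central_functional_scalar_part:
  fixes V :: "'f::field mat set"
  assumes n: "n > 0"
    and V: "direct_sum_of (UT n) U V (scalar_mats n) \<or> direct_sum_of (UT n) U (scalar_mats n) V"
    and p_add: "\<And>A B. A \<in> carrier (UT n) \<Longrightarrow> B \<in> carrier (UT n) \<Longrightarrow> p (A + B) = p A + p B"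
    and p_smult: "\<And>c A. A \<in> carrier (UT n) \<Longrightarrow> p (c \<cdot>\<^sub>m A) = c \<cdot>\<^sub>m p A"
    and p_zero: "\<And>A. A \<in> carrier (UT n) \<Longrightarrow> (\<And>i. i < n \<Longrightarrow> A $$ (i, i) = 0) \<Longrightarrow> p A = 0\<^sub>m n n"
    and p_one: "p (1\<^sub>m n) = 1\<^sub>m n"
    and p_U: "\<And>A. A \<in> carrier (UT n) \<Longrightarrow> p A \<in> U" and U: "U \<subseteq> carrier (UT n)"
  shows "central_functional n (\<lambda>x. scalar_part n V (p x))"
    and "x \<in> carrier (UT n) \<Longrightarrow> p x - scalar_part n V (p x) \<cdot>\<^sub>m 1\<^sub>m n \<in> V"
proof -
  let ?L = "carrier (UT n :: ('f, 'f mat) module)"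
  note ds = direct_sum_scalar[OF V]
  note eqI = scalar_part_eqI[OF n ds(1,2)]
  have pc: "p x \<in> ?L" if "x \<in> ?L" for x using p_U[OF that] U by blast
  show sp: "p x - scalar_part n V (p x) \<cdot>\<^sub>m 1\<^sub>m n \<in> V" if x: "x \<in> ?L" for x
  proof -
    obtain c where c: "p x - c \<cdot>\<^sub>m 1\<^sub>m n \<in> V" using ds(3)[OF p_U[OF x]] by blast
    with eqI[OF pc[OF x] c] show ?thesis by simp
  qed
  show "central_functional n (\<lambda>x. scalar_part n V (p x))"
    unfolding central_functional_def
  proof (intro conjI ballI allI impI)
    fix A B assume A: "A \<in> ?L" and B: "B \<in> ?L"
    let ?a = "scalar_part n V (p A)" and ?b = "scalar_part n V (p B)"
    have "p (A + B) - (?a + ?b) \<cdot>\<^sub>m 1\<^sub>m n = (p A - ?a \<cdot>\<^sub>m 1\<^sub>m n) + (p B - ?b \<cdot>\<^sub>m 1\<^sub>m n)"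
      using UT_dim[OF pc[OF A]] UT_dim[OF pc[OF B]]
      by (intro eq_matI) (auto simp: p_add[OF A B] algebra_simps)
    then have "p (A + B) - (?a + ?b) \<cdot>\<^sub>m 1\<^sub>m n \<in> V"
      using submoduleD(3)[OF ds(1) sp[OF A] sp[OF B]] by simp
    then show "scalar_part n V (p (A + B)) = ?a + ?b"
      by (rule eqI[OF pc[OF UT_add_closed[OF A B]]])
  next
    fix k A assume A: "A \<in> ?L"
    let ?a = "scalar_part n V (p A)"
    have "p (k \<cdot>\<^sub>m A) - (k * ?a) \<cdot>\<^sub>m 1\<^sub>m n = k \<cdot>\<^sub>m (p A - ?a \<cdot>\<^sub>m 1\<^sub>m n)"
      using UT_dim[OF pc[OF A]] by (intro eq_matI) (auto simp: p_smult[OF A] algebra_simps)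
    then have "p (k \<cdot>\<^sub>m A) - (k * ?a) \<cdot>\<^sub>m 1\<^sub>m n \<in> V"
      using submoduleD(4)[OF ds(1) sp[OF A]] by simp
    then show "scalar_part n V (p (k \<cdot>\<^sub>m A)) = k * ?a"
      by (rule eqI[OF pc[OF UT_smult_closed[OF A]]])
  next
    fix A assume A: "A \<in> ?L" "\<forall>i<n. A $$ (i, i) = 0"
    then have p0: "p A = 0\<^sub>m n n" using p_zero by blast
    have "0\<^sub>m n n - 0 \<cdot>\<^sub>m 1\<^sub>m n = (0\<^sub>m n n :: 'f mat)" by (intro eq_matI) auto
    then have "0\<^sub>m n n - 0 \<cdot>\<^sub>m 1\<^sub>m n \<in> V" using submoduleD(2)[OF ds(1)] by simp
    then show "scalar_part n V (p A) = 0" unfolding p0 by (rule eqI[OF UT_zero_closed])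
  next
    have "1\<^sub>m n - 1 \<cdot>\<^sub>m 1\<^sub>m n = (0\<^sub>m n n :: 'f mat)" by (intro eq_matI) auto
    then have "1\<^sub>m n - 1 \<cdot>\<^sub>m 1\<^sub>m n \<in> V" using submoduleD(2)[OF ds(1)] by simp
    then show "scalar_part n V (p (1\<^sub>m n)) = 1" unfolding p_one by (rule eqI[OF UT_one_closed])
  qed
qed

lemma central_functional_one: "central_functional n \<mu> \<Longrightarrow> \<mu> (1\<^sub>m n) = 1"
  by (simp add: central_functional_def)

lemma central_functional_scalar: "central_functional n \<mu> \<Longrightarrow> \<mu> (c \<cdot>\<^sub>m 1\<^sub>m n) = c"
  by (simp add: central_functional_def UT_one_closed)

section \<open>Products of degrees\<close>

context group
begin

lemma deg_prod_refl: "deg_prod G \<eta> i i = \<one>"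
  by (simp add: deg_prod_def)

lemma deg_prod_Cons: "i < j \<Longrightarrow> deg_prod G \<eta> i j = \<eta> ! i \<otimes> deg_prod G \<eta> (Suc i) j"
  by (simp add: deg_prod_def upt_conv_Cons)

lemma deg_prod_closed:
  assumes "set \<eta> \<subseteq> carrier G" "i \<le> j" "j \<le> length \<eta>"
  shows "deg_prod G \<eta> i j \<in> carrier G"
  using assms(2)
proof (induction rule: inc_induct)
  case (step i)
  then have "\<eta> ! i \<in> carrier G" using assms by (auto intro!: subsetD[OF assms(1)])
  then show ?case using step by (simp add: deg_prod_Cons)
qed (simp add: deg_prod_refl)

lemma deg_prod_Suc: "set \<eta> \<subseteq> carrier G \<Longrightarrow> i < length \<eta> \<Longrightarrow> deg_prod G \<eta> i (Suc i) = \<eta> ! i"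
  using subsetD[OF _ nth_mem[of i \<eta>]] by (subst deg_prod_Cons) (simp_all add: deg_prod_refl)

lemma deg_prod_snoc:
  assumes "set \<eta> \<subseteq> carrier G" "i \<le> j" "j < length \<eta>"
  shows "deg_prod G \<eta> i (Suc j) = deg_prod G \<eta> i j \<otimes> \<eta> ! j"
  using assms(2)
proof (induction rule: inc_induct)
  case base
  show ?case using assms subsetD[OF _ nth_mem[of j \<eta>]] by (simp add: deg_prod_Suc deg_prod_refl)
next
  case (step i)
  have "\<eta> ! i \<in> carrier G" "\<eta> ! j \<in> carrier G" using assms step by (auto intro!: subsetD[OF assms(1)])
  moreover have "deg_prod G \<eta> (Suc i) j \<in> carrier G" using assms step by (intro deg_prod_closed) auto
  ultimately show ?case using step by (simp add: deg_prod_Cons[of i] m_assoc)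
qed

lemma deg_prod_commute:
  assumes "set \<eta> \<subseteq> carrier G" "i \<le> j" "j \<le> length \<eta>" "x \<in> carrier G"
    and "\<And>y. y \<in> set \<eta> \<Longrightarrow> x \<otimes> y = y \<otimes> x"
  shows "x \<otimes> deg_prod G \<eta> i j = deg_prod G \<eta> i j \<otimes> x"
  using assms(2)
proof (induction rule: inc_induct)
  case (step i)
  have i: "\<eta> ! i \<in> set \<eta>" using assms step by simp
  then have c: "\<eta> ! i \<in> carrier G" "deg_prod G \<eta> (Suc i) j \<in> carrier G"
    using assms step by (auto intro: deg_prod_closed)
  have "x \<otimes> (\<eta> ! i \<otimes> deg_prod G \<eta> (Suc i) j) = \<eta> ! i \<otimes> (x \<otimes> deg_prod G \<eta> (Suc i) j)"
    using c assms(4) assms(5)[OF i] by (simp flip: m_assoc)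
  also have "\<dots> = \<eta> ! i \<otimes> deg_prod G \<eta> (Suc i) j \<otimes> x"
    using step c assms(4) by (simp add: m_assoc)
  finally show ?case using step by (simp add: deg_prod_Cons[of i])
qed (use assms in \<open>simp add: deg_prod_refl\<close>)

text \<open>
  Reversing the sequence also reverses the order of the factors; commutativity of the entries repairs
  this.
\<close>

lemma deg_prod_rev:
  assumes "set \<eta> \<subseteq> carrier G" "pairwise_commuting G \<eta>" "i \<le> j" "j \<le> length \<eta>"
  shows "deg_prod G (rev \<eta>) i j = deg_prod G \<eta> (length \<eta> - j) (length \<eta> - i)"
  using assms(3)
proof (induction rule: inc_induct)
  case (step i)
  define k where "k = length \<eta> - Suc i"
  have k: "length \<eta> - i = Suc k" "k < length \<eta>" "length \<eta> - j \<le> k" using step assms by (auto simp: k_def)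
  have "deg_prod G (rev \<eta>) i j = \<eta> ! k \<otimes> deg_prod G \<eta> (length \<eta> - j) k"
    using step assms by (simp add: deg_prod_Cons[of i] rev_nth k_def)
  also have "\<dots> = deg_prod G \<eta> (length \<eta> - j) k \<otimes> \<eta> ! k"
    using assms k nth_mem[OF k(2)] 
    by (intro deg_prod_commute) (auto simp: pairwise_commuting_def)
  also have "\<dots> = deg_prod G \<eta> (length \<eta> - j) (length \<eta> - i)"
    using deg_prod_snoc[OF assms(1) k(3,2)] k by simp
  finally show ?case .
qed (simp add: deg_prod_refl)

end

section \<open>Practical elementary gradings\<close>

definition diag_part :: "nat \<Rightarrow> 'f::field mat \<Rightarrow> 'f mat" where
  "diag_part n A = mat n n (\<lambda>(i, j). if i = j then A $$ (i, i) else 0)"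

lemma diag_mats_carrier: "diag_mats n \<subseteq> carrier (UT n)"
  by (auto simp: diag_mats_def UT_carrier_iff diagonal_mat_def)

lemma diag_part_diag_mats: "diag_part n A \<in> diag_mats n"
  by (auto simp: diag_part_def diag_mats_def diagonal_mat_def)

lemma diag_part_id: "A \<in> diag_mats n \<Longrightarrow> diag_part n A = A"
  by (intro eq_matI) (auto simp: diag_part_def diag_mats_def diagonal_mat_def)

lemma diag_part_add: "A \<in> carrier (UT n) \<Longrightarrow> B \<in> carrier (UT n) \<Longrightarrow> diag_part n (A + B) = diag_part n A + diag_part n B"
  by (intro eq_matI) (auto simp: diag_part_def UT_carrier_iff)

lemma diag_part_smult: "A \<in> carrier (UT n) \<Longrightarrow> diag_part n (c \<cdot>\<^sub>m A) = c \<cdot>\<^sub>m diag_part n A"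
  by (intro eq_matI) (auto simp: diag_part_def UT_carrier_iff)

lemma diag_part_zero: "(\<And>i. i < n \<Longrightarrow> A $$ (i, i) = 0) \<Longrightarrow> diag_part n A = 0\<^sub>m n n"
  by (intro eq_matI) (auto simp: diag_part_def)

abbreviation Gamma1_gens where
  "Gamma1_gens G n V t \<eta> h \<equiv>
     {mat_unit n i j | i j. i < j \<and> j < n \<and> deg_prod G \<eta> i j = h} \<union>
      (if h = t then {1\<^sub>m n} else {}) \<union> (if h = \<one>\<^bsub>G\<^esub> then V else {})"

locale Gamma1_data =
  group G for G :: "('g, 'r) monoid_scheme" (structure) +
  fixes n :: nat and V :: "'f::field mat set" and t :: 'g and \<eta> :: "'g list"
  assumes n: "n > 2" and t: "t \<in> carrier G"
    and \<eta>: "set \<eta> \<subseteq> carrier G" "length \<eta> = n - 1" "pairwise_commuting G \<eta>"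
    and choice: "Gamma1_choice n V"
begin

abbreviation \<Gamma> where "\<Gamma> \<equiv> Gamma1 G n V t \<eta>"

lemma V_sum: "direct_sum_of (UT n) (diag_mats n) V (scalar_mats n) \<or>
    direct_sum_of (UT n) (diag_mats n) (scalar_mats n) V"
  using choice by (simp add: Gamma1_choice_def)

lemmas V_facts = direct_sum_scalar[OF V_sum]

lemma V_diag: "V \<subseteq> diag_mats n"
proof
  fix v assume v: "v \<in> V"
  then have "v + 0 \<cdot>\<^sub>m 1\<^sub>m n \<in> diag_mats n" by (rule V_facts(4))
  moreover have "v + 0 \<cdot>\<^sub>m 1\<^sub>m n = v"
    using v submoduleD(1)[OF V_facts(1)] UT_dim[of v n] by (intro eq_matI) auto
  ultimately show "v \<in> diag_mats n" by simp
qed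

lemma gens_carrier: "Gamma1_gens G n V t \<eta> h \<subseteq> carrier (UT n)"
  using V_diag diag_mats_carrier UT_one_closed by (auto simp: mat_unit_carrier)

lemma \<Gamma>_submodule: "LinearCombinations.submodule class_ring (\<Gamma> h) (UT n)"
  unfolding Gamma1_def by (rule ut_span_submodule[OF gens_carrier])

lemma \<Gamma>_gen: "s \<in> Gamma1_gens G n V t \<eta> h \<Longrightarrow> s \<in> \<Gamma> h"
  unfolding Gamma1_def by (rule ut_span_gen[OF gens_carrier])

lemma \<Gamma>_carrier: "\<Gamma> h \<subseteq> carrier (UT n)"
  using submoduleD(1)[OF \<Gamma>_submodule] .

lemma \<Gamma>_unit: "i < j \<Longrightarrow> j < n \<Longrightarrow> mat_unit n i j \<in> \<Gamma> (deg_prod G \<eta> i j)"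
  by (rule \<Gamma>_gen) blast

lemma \<Gamma>_superdiag:
  assumes x: "x \<in> \<Gamma> h" and k: "Suc k < n" and nz: "x $$ (k, Suc k) \<noteq> 0"
  shows "h = \<eta> ! k"
proof (rule ccontr)
  assume h: "h \<noteq> \<eta> ! k"
  have "x $$ (k, Suc k) = 0"
    using x[unfolded Gamma1_def] gens_carrier
  proof (induction rule: ut_span_induct)
    case (gen s)
    have "v $$ (k, Suc k) = 0" if "v \<in> V" for v
      using that V_diag k by (auto simp: diag_mats_def diagonal_mat_def)
    moreover have "mat_unit n i j $$ (k, Suc k) = (0 :: 'f)" if "deg_prod G \<eta> i j = h" for i j
      using that k h deg_prod_Suc[OF \<eta>(1), of k] \<eta>(2) by (auto simp: mat_unit_entry)
    ultimately show ?case using gen k by (auto split: if_splits)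
  qed (use k in \<open>auto simp: UT_carrier_iff\<close>)
  then show False using nz by simp
qed

text \<open>
  Off the degree \<open>t\<close>, diagonal parts of homogeneous matrices lie in the complement \<open>V\<close>.
\<close>

lemma \<Gamma>_scalar:
  assumes x: "c \<cdot>\<^sub>m 1\<^sub>m n \<in> \<Gamma> h" and c: "c \<noteq> 0"
  shows "h = t"
proof (rule ccontr)
  assume h: "h \<noteq> t"
  have "diag_part n (c \<cdot>\<^sub>m 1\<^sub>m n) \<in> V"
    using x[unfolded Gamma1_def] gens_carrier
  proof (induction rule: ut_span_induct)
    case zero
    show ?case using submoduleD(2)[OF V_facts(1)] by (subst diag_part_zero) auto
  next
    case (gen s)
    have "diag_part n (mat_unit n i j) = (0\<^sub>m n n :: 'f mat)" if "i < j" for i j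
      using that by (intro diag_part_zero) (auto simp: mat_unit_entry)
    then show ?case
      using gen h submoduleD(2)[OF V_facts(1)] V_diag by (auto simp: diag_part_id subset_iff split: if_splits)
  qed (auto simp: diag_part_add diag_part_smult submoduleD[OF V_facts(1)])
  moreover have "diag_part n (c \<cdot>\<^sub>m 1\<^sub>m n) = c \<cdot>\<^sub>m 1\<^sub>m n"
    by (rule diag_part_id) (auto simp: diag_mats_def diagonal_mat_def)
  ultimately have "c \<cdot>\<^sub>m 1\<^sub>m n \<in> V" by simp
  then have "c \<cdot>\<^sub>m 1\<^sub>m n \<in> V \<inter> scalar_mats n"
    unfolding scalar_mats_def by blast
  then have eq: "c \<cdot>\<^sub>m 1\<^sub>m n = (0\<^sub>m n n :: 'f mat)" unfolding V_facts(2) by blast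
  have "(c \<cdot>\<^sub>m 1\<^sub>m n) $$ (0, 0) = (0\<^sub>m n n :: 'f mat) $$ (0, 0)" unfolding eq ..
  then show False using c n by simp
qed

definition \<mu> :: "'f mat \<Rightarrow> 'f" where "\<mu> x = scalar_part n V (diag_part n x)"

lemma \<mu>_functional: "central_functional n \<mu>"
  and \<mu>_complement: "x \<in> diag_mats n \<Longrightarrow> x - \<mu> x \<cdot>\<^sub>m 1\<^sub>m n \<in> V"
proof -
  have one: "diag_part n (1\<^sub>m n) = (1\<^sub>m n :: 'f mat)"
    by (rule diag_part_id) (auto simp: diag_mats_def diagonal_mat_def)
  note * = central_functional_scalar_part[where p = "diag_part n", OF _ V_sum diag_part_add
      diag_part_smult diag_part_zero one diag_part_diag_mats diag_mats_carrier]
  show "central_functional n \<mu>" unfolding \<mu>_def[abs_def] by (rule *(1)) (use n in auto)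
  show "x - \<mu> x \<cdot>\<^sub>m 1\<^sub>m n \<in> V" if "x \<in> diag_mats n"
    using *(2)[of x] that n diag_mats_carrier[of n] unfolding \<mu>_def by (auto simp: diag_part_id)
qed

lemma \<mu>_V: 
  assumes v: "v \<in> V"
  shows "\<mu> v = 0"
proof -
  have vc: "v \<in> carrier (UT n)" using v V_diag diag_mats_carrier by blast
  have "v - 0 \<cdot>\<^sub>m 1\<^sub>m n = v" using UT_dim[OF vc] by (intro eq_matI) auto
  with v have "v - 0 \<cdot>\<^sub>m 1\<^sub>m n \<in> V" by simp
  then have "scalar_part n V v = 0" using n by (intro scalar_part_eqI[OF _ V_facts(1,2) vc]) auto
  then show ?thesis using v V_diag by (auto simp: \<mu>_def diag_part_id)
qed

end

lemma Gamma1_necessary: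
  assumes "Gamma1_data G n (V :: 'f::field mat set) t \<eta>" "Gamma1_data G n V' t' \<eta>'" "UT_automorphism n \<psi>"
    and gr: "\<forall>h\<in>carrier G. \<forall>x\<in>Gamma1 G n V t \<eta> h. \<exists>y\<in>Gamma1 G n V' t' \<eta>' h. \<exists>c. \<psi> x = y + c \<cdot>\<^sub>m 1\<^sub>m n"
  shows "seq_sim \<eta> \<eta>'"
proof -
  interpret A: Gamma1_data G n V t \<eta> by fact
  interpret B: Gamma1_data G n V' t' \<eta>' by fact
  interpret UT_automorphism n \<psi> by fact
  obtain \<tau> where \<tau>: "\<tau> = (\<lambda>j. j) \<or> \<tau> = (\<lambda>j. n - 2 - j)"
    and iff: "\<And>i j. Suc i < n \<Longrightarrow> Suc j < n \<Longrightarrow> \<psi> (mat_unit n i (Suc i)) $$ (j, Suc j) \<noteq> 0 \<longleftrightarrow> i = \<tau> j"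
    using superdiagonal_permutation by blast
  have eq: "\<eta> ! \<tau> j = \<eta>' ! j" if j: "Suc j < n" for j
  proof -
    have i: "Suc (\<tau> j) < n" using \<tau> j by auto
    have d: "deg_prod G \<eta> (\<tau> j) (Suc (\<tau> j)) = \<eta> ! \<tau> j"
      by (rule A.deg_prod_Suc[OF A.\<eta>(1)]) (use i A.\<eta>(2) in auto)
    have "\<eta> ! \<tau> j \<in> carrier G" using i A.\<eta>(2) by (intro subsetD[OF A.\<eta>(1)] nth_mem) auto
    moreover have "mat_unit n (\<tau> j) (Suc (\<tau> j)) \<in> A.\<Gamma> (\<eta> ! \<tau> j)"
      using A.\<Gamma>_unit[of "\<tau> j" "Suc (\<tau> j)"] i d by simp
    ultimately obtain y c where y: "y \<in> B.\<Gamma> (\<eta> ! \<tau> j)"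
      "\<psi> (mat_unit n (\<tau> j) (Suc (\<tau> j))) = y + c \<cdot>\<^sub>m 1\<^sub>m n" using gr by blast
    have "\<psi> (mat_unit n (\<tau> j) (Suc (\<tau> j))) $$ (j, Suc j) \<noteq> 0" using iff[OF i j] by simp
    moreover have "y \<in> carrier (UT n)" using y(1) B.\<Gamma>_carrier by blast
    ultimately have "y $$ (j, Suc j) \<noteq> 0"
      unfolding y(2) using UT_dim[of y n] j by simp
    then show ?thesis using B.\<Gamma>_superdiag[OF y(1) j] by simp
  qed
  from \<tau> show ?thesis
  proof
    assume t: "\<tau> = (\<lambda>j. j)"
    have "\<eta> = \<eta>'" using eq A.\<eta>(2) B.\<eta>(2) by (intro nth_equalityI) (auto simp: t)
    then show ?thesis by (simp add: seq_sim_def)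
  next
    assume t: "\<tau> = (\<lambda>j. n - 2 - j)"
    have "\<eta>' = rev \<eta>" 
    proof (rule nth_equalityI)
      fix i assume "i < length \<eta>'"
      then show "\<eta>' ! i = rev \<eta> ! i"
        using eq[of i] A.\<eta>(2) B.\<eta>(2) by (simp add: t rev_nth numeral_2_eq_2)
    qed (use A.\<eta>(2) B.\<eta>(2) in simp)
    then show ?thesis by (simp add: seq_sim_def)
  qed
qed

text \<open>
  The condition \<open>t = t' \<longrightarrow> c = 0\<close> in the conclusion serves graded and practically graded
  isomorphisms at the same time: a scalar correction is needed only when the degrees of the identity
  matrix differ.
\<close>

lemma Gamma1_transfer:
  assumes "Gamma1_data G n (V :: 'f::field mat set) t \<eta>" "Gamma1_data G n V' t' \<eta>'" "UT_automorphism n \<psi>"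
    and one: "\<psi> (1\<^sub>m n) = e \<cdot>\<^sub>m 1\<^sub>m n" and e: "e \<noteq> 0"
    and diag: "\<And>x. x \<in> diag_mats n \<Longrightarrow> \<psi> x \<in> diag_mats n"
    and unit: "\<And>i j. i < j \<Longrightarrow> j < n \<Longrightarrow> \<psi> (mat_unit n i j) \<in> Gamma1 G n V' t' \<eta>' (deg_prod G \<eta> i j)"
  shows "\<exists>F. UT_automorphism n F \<and> (\<forall>h\<in>carrier G. \<forall>x\<in>Gamma1 G n V t \<eta> h.
    \<exists>y\<in>Gamma1 G n V' t' \<eta>' h. \<exists>c. F x = y + c \<cdot>\<^sub>m 1\<^sub>m n \<and> (t = t' \<longrightarrow> c = 0))"
proof -
  interpret A: Gamma1_data G n V t \<eta> by fact
  interpret B: Gamma1_data G n V' t' \<eta>' by fact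
  interpret \<psi>: UT_automorphism n \<psi> by fact
  define F where "F x = \<psi> x + (e * A.\<mu> x - B.\<mu> (\<psi> x)) \<cdot>\<^sub>m 1\<^sub>m n" for x
  \<comment> \<open>The twist makes the complements match: it sends \<open>V\<close> into \<open>V'\<close>.\<close>
  interpret F: UT_automorphism n F
    unfolding F_def[abs_def] by (rule \<psi>.central_twist[OF one e A.\<mu>_functional B.\<mu>_functional])
  define P where "P h x \<longleftrightarrow> (\<exists>y\<in>B.\<Gamma> h. \<exists>c. F x = y + c \<cdot>\<^sub>m 1\<^sub>m n \<and> (t = t' \<longrightarrow> c = 0))" for h x
  have P0: "P h x" if "F x \<in> B.\<Gamma> h" "x \<in> carrier (UT n)" for h x
  proof -
    have "F x = F x + 0 \<cdot>\<^sub>m 1\<^sub>m n" using F.dims[OF that(2)] by (intro eq_matI) auto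
    then show ?thesis using that unfolding P_def by blast
  qed
  have "P h x" if "x \<in> A.\<Gamma> h" for h x
    using that[unfolded Gamma1_def] A.gens_carrier
  proof (induction rule: ut_span_induct)
    case zero
    show ?case
      by (rule P0) (use F.map_zero submoduleD(2)[OF B.\<Gamma>_submodule] UT_zero_closed in auto)
  next
    case (add x y)
    then obtain x' c y' d where *: "x' \<in> B.\<Gamma> h" "F x = x' + c \<cdot>\<^sub>m 1\<^sub>m n" "t = t' \<longrightarrow> c = 0"
      "y' \<in> B.\<Gamma> h" "F y = y' + d \<cdot>\<^sub>m 1\<^sub>m n" "t = t' \<longrightarrow> d = 0" unfolding P_def by metis
    have cc: "x' \<in> carrier (UT n)" "y' \<in> carrier (UT n)" using * B.\<Gamma>_carrier by blast+
    have "F (x + y) = (x' + y') + (c + d) \<cdot>\<^sub>m 1\<^sub>m n"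
      unfolding F.add[OF add(1,2)] * using UT_dim[OF cc(1)] UT_dim[OF cc(2)]
      by (intro eq_matI) (auto simp: algebra_simps)
    moreover have "x' + y' \<in> B.\<Gamma> h" using submoduleD(3)[OF B.\<Gamma>_submodule] * by blast
    ultimately show ?case using *(3,6) unfolding P_def by fastforce
  next
    case (smult k x)
    then obtain x' c where *: "x' \<in> B.\<Gamma> h" "F x = x' + c \<cdot>\<^sub>m 1\<^sub>m n" "t = t' \<longrightarrow> c = 0"
      unfolding P_def by metis
    have cc: "x' \<in> carrier (UT n)" using * B.\<Gamma>_carrier by blast
    have "F (k \<cdot>\<^sub>m x) = k \<cdot>\<^sub>m x' + (k * c) \<cdot>\<^sub>m 1\<^sub>m n"
      unfolding F.smult[OF smult(1)] * using UT_dim[OF cc] by (intro eq_matI) (auto simp: algebra_simps)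
    moreover have "k \<cdot>\<^sub>m x' \<in> B.\<Gamma> h" using submoduleD(4)[OF B.\<Gamma>_submodule] * by blast
    ultimately show ?case using *(3) unfolding P_def by fastforce
  next
    case (gen s)
    then consider (unit) i j where "s = mat_unit n i j" "i < j" "j < n" "deg_prod G \<eta> i j = h"
      | (one) "s = 1\<^sub>m n" "h = t" | (V) "s \<in> V" "h = \<one>\<^bsub>G\<^esub>"
      by (auto split: if_splits)
    then show ?case
    proof cases
      case unit
      have sc: "s \<in> carrier (UT n)" using unit by (simp add: mat_unit_carrier)
      have "A.\<mu> s = 0"
        using A.\<mu>_functional sc unit unfolding central_functional_def by (auto simp: mat_unit_entry)
      moreover have "B.\<mu> (\<psi> s) = 0"
        using B.\<mu>_functional \<psi>.closed[OF sc] \<psi>.unit_diag unit unfolding central_functional_def by auto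
      ultimately have "F s = \<psi> s"
        unfolding F_def using \<psi>.dims[OF sc] by (intro eq_matI) auto
      then show ?thesis using assms(7)[OF unit(2,3)] unit sc by (intro P0) auto
    next
      case one
      have "A.\<mu> (1\<^sub>m n) = 1" "B.\<mu> (e \<cdot>\<^sub>m 1\<^sub>m n) = e"
        using A.\<mu>_functional B.\<mu>_functional
        by (simp_all add: central_functional_one central_functional_scalar)
      then have F1: "F s = e \<cdot>\<^sub>m 1\<^sub>m n" unfolding F_def one assms(4) by (intro eq_matI) auto
      show ?thesis
      proof (cases "t = t'")
        case True
        then have "1\<^sub>m n \<in> B.\<Gamma> h" using one by (intro B.\<Gamma>_gen) auto
        then have "F s \<in> B.\<Gamma> h" unfolding F1 by (rule submoduleD(4)[OF B.\<Gamma>_submodule])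
        then show ?thesis using one UT_one_closed by (intro P0) auto
      next
        case False
        have "F s = 0\<^sub>m n n + e \<cdot>\<^sub>m 1\<^sub>m n" unfolding F1 by (intro eq_matI) auto
        then show ?thesis using False submoduleD(2)[OF B.\<Gamma>_submodule] unfolding P_def by blast
      qed
    next
      case V
      have sD: "s \<in> diag_mats n" using V A.V_diag by blast
      then have sc: "s \<in> carrier (UT n)" using diag_mats_carrier by blast
      have "F s = \<psi> s - B.\<mu> (\<psi> s) \<cdot>\<^sub>m 1\<^sub>m n"
        unfolding F_def A.\<mu>_V[OF V(1)] using \<psi>.dims[OF sc] by (intro eq_matI) auto
      then have "F s \<in> V'" using B.\<mu>_complement[OF diag[OF sD]] by simp
      then have "F s \<in> B.\<Gamma> h" using V by (intro B.\<Gamma>_gen) auto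
      then show ?thesis by (rule P0[OF _ sc])
    qed
  qed
  then show ?thesis using F.UT_automorphism_axioms unfolding P_def by blast
qed

lemma Gamma1_sufficient:
  assumes "Gamma1_data G n (V :: 'f::field mat set) t \<eta>" "Gamma1_data G n V' t' \<eta>'"
    and sim: "seq_sim \<eta> \<eta>'"
  shows "\<exists>F. UT_automorphism n F \<and> (\<forall>h\<in>carrier G. \<forall>x\<in>Gamma1 G n V t \<eta> h.
    \<exists>y\<in>Gamma1 G n V' t' \<eta>' h. \<exists>c. F x = y + c \<cdot>\<^sub>m 1\<^sub>m n \<and> (t = t' \<longrightarrow> c = 0))"
proof -
  interpret A: Gamma1_data G n V t \<eta> by fact
  interpret B: Gamma1_data G n V' t' \<eta>' by fact
  show ?thesis
  proof (cases "\<eta> = \<eta>'")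
    case True
    show ?thesis
    proof (rule Gamma1_transfer[OF assms(1,2) UT_automorphism_id])
      show "1\<^sub>m n = (1 :: 'f) \<cdot>\<^sub>m 1\<^sub>m n" by (intro eq_matI) auto
      show "mat_unit n i j \<in> B.\<Gamma> (deg_prod G \<eta> i j)" if "i < j" "j < n" for i j
        using B.\<Gamma>_unit[OF that] True by simp
    qed auto
  next
    case False
    then have rev: "\<eta> = rev \<eta>'" using sim by (simp add: seq_sim_def)
    show ?thesis
    proof (rule Gamma1_transfer[OF assms(1,2) UT_automorphism_neg_flip])
      show "neg_flip n (1\<^sub>m n) = (- 1 :: 'f) \<cdot>\<^sub>m 1\<^sub>m n" by (intro eq_matI) (auto simp: neg_flip_def)
      show "neg_flip n x \<in> diag_mats n" if "x \<in> diag_mats n" for x :: "'f mat"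
        using that by (auto simp: neg_flip_def diag_mats_def diagonal_mat_def)
      fix i j assume ij: "i < j" "j < n"
      have "neg_flip n (mat_unit n i j) = (- 1 :: 'f) \<cdot>\<^sub>m mat_unit n (n - 1 - j) (n - 1 - i)"
        using ij by (intro eq_matI) (auto simp: neg_flip_def mat_unit_def)
      moreover have "deg_prod G \<eta> i j = deg_prod G \<eta>' (n - 1 - j) (n - 1 - i)"
        using A.deg_prod_rev[OF B.\<eta>(1,3), of i j] ij B.\<eta>(2) by (simp add: rev)
      moreover have "n - 1 - j < n - 1 - i" "n - 1 - i < n" using ij by auto
      ultimately show "neg_flip n (mat_unit n i j) \<in> B.\<Gamma> (deg_prod G \<eta> i j)"
        using submoduleD(4)[OF B.\<Gamma>_submodule B.\<Gamma>_unit] by simp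
    qed auto
  qed
qed

section \<open>Practical type 2 gradings\<close>

lemma char_not_two_imp:
  assumes "CHAR('f::field) \<noteq> 2"
  shows "(2 :: 'f) \<noteq> 0"
proof
  assume "(2 :: 'f) = 0"
  then have "of_nat 2 = (0 :: 'f)" by simp
  then have "CHAR('f) dvd 2" using of_nat_eq_0_iff_char_dvd[where 'a = 'f] by blast
  then have "CHAR('f) \<in> {1, 2}" using dvd_imp_le[of "CHAR('f)" 2] by (cases "CHAR('f)") auto
  then show False using assms CHAR_not_1[where 'a = 'f] by auto
qed

lemma X_minus_entry:
  "r < n \<Longrightarrow> c < n \<Longrightarrow> X_minus n i j $$ (r, c) =
    (if r = i \<and> c = j then 1 else 0) - (if r = n - 1 - j \<and> c = n - 1 - i then 1 else (0 :: 'f::field))"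
  by (simp add: X_minus_def mat_unit_def)

lemma X_plus_entry:
  "r < n \<Longrightarrow> c < n \<Longrightarrow> X_plus n i j $$ (r, c) =
    (if r = i \<and> c = j then 1 else 0) + (if r = n - 1 - j \<and> c = n - 1 - i then 1 else (0 :: 'f::field))"
  by (simp add: X_plus_def mat_unit_def)

lemma X_carrier:
  assumes "i \<le> j" "j < n"
  shows "X_minus n i j \<in> carrier (UT n)" "X_plus n i j \<in> carrier (UT n)"
  using assms by (auto simp: X_minus_def X_plus_def intro!: UT_closed mat_unit_carrier)

lemma bracket_diagonal_entry:
  assumes D: "D \<in> carrier (UT n)" "\<And>i j. i < n \<Longrightarrow> j < n \<Longrightarrow> i \<noteq> j \<Longrightarrow> D $$ (i, j) = 0"
    and A: "A \<in> carrier (UT n)" and ij: "i < n" "j < n"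
  shows "lie_bracket D A $$ (i, j) = (D $$ (i, i) - D $$ (j, j)) * A $$ (i, j)"
proof -
  have "(\<Sum>k<n. D $$ (i, k) * A $$ (k, j)) = (\<Sum>k<n. if k = i then D $$ (i, i) * A $$ (i, j) else 0)"
    using ij D(2) by (intro sum.cong) auto
  moreover have "(\<Sum>k<n. A $$ (i, k) * D $$ (k, j)) = (\<Sum>k<n. if k = j then A $$ (i, j) * D $$ (j, j) else 0)"
    using ij D(2) by (intro sum.cong) auto
  moreover have "D \<in> carrier_mat n n" "A \<in> carrier_mat n n" using D(1) A UT_dim by blast+
  ultimately show ?thesis
    using ij by (simp add: bracket_entry algebra_simps)
qed

lemma bracket_minus_scalar:
  assumes "A \<in> carrier (UT n)" "B \<in> carrier (UT n)"
  shows "lie_bracket A (B - c \<cdot>\<^sub>m 1\<^sub>m n) = lie_bracket A B"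
proof -
  have A: "A \<in> carrier_mat n n" and B: "B \<in> carrier_mat n n" using assms UT_dim by blast+
  have 1: "c \<cdot>\<^sub>m 1\<^sub>m n \<in> carrier_mat n n" by simp
  have "A * (B - c \<cdot>\<^sub>m 1\<^sub>m n) = A * B - c \<cdot>\<^sub>m A"
    unfolding mult_minus_distrib_mat[OF A B 1] mult_smult_distrib[OF A one_carrier_mat] using A by simp
  moreover have "(B - c \<cdot>\<^sub>m 1\<^sub>m n) * A = B * A - c \<cdot>\<^sub>m A"
    unfolding minus_mult_distrib_mat[OF B 1 A] mult_smult_assoc_mat[OF one_carrier_mat A] using A by simp
  ultimately show ?thesis
    unfolding lie_bracket_def using A B by (intro eq_matI) (simp_all del: index_mult_mat(1))
qed

text \<open>
  Projection of the diagonal to the span of the matrices \<open>X\<^sub>i\<^sub>i\<^sup>+\<close>, that is, to the part of degree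
  \<open>g\<close>.
\<close>

definition sym_diag :: "nat \<Rightarrow> 'f::field mat \<Rightarrow> 'f mat" where
  "sym_diag n A = mat n n (\<lambda>(i, j). if i = j then (A $$ (i, i) + A $$ (n - 1 - i, n - 1 - i)) / 2 else 0)"

lemma sym_diag_add: "A \<in> carrier (UT n) \<Longrightarrow> B \<in> carrier (UT n) \<Longrightarrow> sym_diag n (A + B) = sym_diag n A + sym_diag n B"
  by (intro eq_matI) (auto simp: sym_diag_def UT_carrier_iff add_divide_distrib)

lemma sym_diag_smult: "A \<in> carrier (UT n) \<Longrightarrow> sym_diag n (c \<cdot>\<^sub>m A) = c \<cdot>\<^sub>m sym_diag n A"
  by (intro eq_matI) (auto simp: sym_diag_def UT_carrier_iff algebra_simps add_divide_distrib)

lemma sym_diag_zero: "(\<And>i. i < n \<Longrightarrow> A $$ (i, i) = 0) \<Longrightarrow> sym_diag n A = 0\<^sub>m n n"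
  by (intro eq_matI) (auto simp: sym_diag_def)

lemma sym_diag_one: "(2 :: 'f::field) \<noteq> 0 \<Longrightarrow> sym_diag n (1\<^sub>m n) = (1\<^sub>m n :: 'f mat)"
  by (intro eq_matI) (auto simp: sym_diag_def)

abbreviation Gamma2_gens where
  "Gamma2_gens G n g \<eta> h \<equiv>
     {X_minus n i j | i j. i \<le> j \<and> j < n \<and> deg_prod G \<eta> i j = h} \<union>
      {X_plus n i j | i j. i \<le> j \<and> j < n \<and> g \<otimes>\<^bsub>G\<^esub> deg_prod G \<eta> i j = h}"

locale Gamma2_data =
  group G for G :: "('g, 'r) monoid_scheme" (structure) +
  fixes n :: nat and V :: "'f::field mat set" and t g :: 'g and \<eta> :: "'g list"
  assumes n: "n > 2" and t: "t \<in> carrier G"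
    and g: "g \<in> carrier G" "g \<noteq> \<one>" "g \<otimes> g = \<one>"
    and \<eta>: "set \<eta> \<subseteq> carrier G" "length \<eta> = n - 1"
    and pal: "rev \<eta> = \<eta>"
    and g_comm: "\<And>x. x \<in> set \<eta> \<Longrightarrow> g \<otimes> x = x \<otimes> g"
    and two: "(2 :: 'f) \<noteq> 0"
    and choice: "Gamma2_choice G n t g \<eta> V"
begin

abbreviation \<Gamma> :: "'g \<Rightarrow> 'f mat set" where "\<Gamma> \<equiv> Gamma2 G n g \<eta>"
abbreviation \<Delta> :: "'g \<Rightarrow> 'f mat set" where "\<Delta> \<equiv> practical_Gamma2 G n V t g \<eta>"

lemma nth_carrier: "Suc k < n \<Longrightarrow> \<eta> ! k \<in> carrier G"
  using \<eta> by (intro subsetD[OF \<eta>(1)] nth_mem) auto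

lemma nth_pal: "Suc k < n \<Longrightarrow> \<eta> ! (n - 2 - k) = \<eta> ! k"
  using arg_cong[OF pal, of "\<lambda>x. x ! k"] \<eta>(2) by (simp add: rev_nth numeral_2_eq_2)

lemma gens_carrier: "Gamma2_gens G n g \<eta> h \<subseteq> carrier (UT n)"
  using X_carrier by blast

lemma \<Gamma>_submodule: "LinearCombinations.submodule class_ring (\<Gamma> h) (UT n)"
  unfolding Gamma2_def by (rule ut_span_submodule[OF gens_carrier])

lemma \<Gamma>_gen: "s \<in> Gamma2_gens G n g \<eta> h \<Longrightarrow> s \<in> \<Gamma> h"
  unfolding Gamma2_def by (rule ut_span_gen[OF gens_carrier])

lemma \<Gamma>_minus: "i \<le> j \<Longrightarrow> j < n \<Longrightarrow> X_minus n i j \<in> \<Gamma> (deg_prod G \<eta> i j)"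
  and \<Gamma>_plus: "i \<le> j \<Longrightarrow> j < n \<Longrightarrow> X_plus n i j \<in> \<Gamma> (g \<otimes> deg_prod G \<eta> i j)"
  by (rule \<Gamma>_gen, blast)+

lemma \<Gamma>_carrier: "\<Gamma> h \<subseteq> carrier (UT n)"
  using submoduleD(1)[OF \<Gamma>_submodule] .

lemma \<Gamma>_induct [consumes 1, case_names zero minus plus add smult]:
  assumes x: "x \<in> \<Gamma> h"
    and zero: "P (0\<^sub>m n n)"
    and minus: "\<And>i j. i \<le> j \<Longrightarrow> j < n \<Longrightarrow> deg_prod G \<eta> i j = h \<Longrightarrow> P (X_minus n i j)"
    and plus: "\<And>i j. i \<le> j \<Longrightarrow> j < n \<Longrightarrow> g \<otimes> deg_prod G \<eta> i j = h \<Longrightarrow> P (X_plus n i j)"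
    and add: "\<And>x y. x \<in> carrier (UT n) \<Longrightarrow> y \<in> carrier (UT n) \<Longrightarrow> P x \<Longrightarrow> P y \<Longrightarrow> P (x + y)"
    and smult: "\<And>c x. x \<in> carrier (UT n) \<Longrightarrow> P x \<Longrightarrow> P (c \<cdot>\<^sub>m x)"
  shows "P x"
  using x[unfolded Gamma2_def] gens_carrier zero _ add smult
proof (rule ut_span_induct)
  fix s :: "'f mat" assume "s \<in> Gamma2_gens G n g \<eta> h"
  then show "P s" using minus plus by blast
qed

lemma V_sum: "direct_sum_of (UT n) (\<Gamma> g) V (scalar_mats n) \<or>
    direct_sum_of (UT n) (\<Gamma> g) (scalar_mats n) V"
  using choice by (simp add: Gamma2_choice_def)

lemmas V_facts = direct_sum_scalar[OF V_sum]

lemma V_carrier: "V \<subseteq> carrier (UT n)"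
  using submoduleD(1)[OF V_facts(1)] .

lemma scalar_add_iff:
  assumes "y \<in> carrier (UT n)" "x \<in> carrier (UT n)"
  shows "x - c \<cdot>\<^sub>m 1\<^sub>m n = y \<longleftrightarrow> x = y + c \<cdot>\<^sub>m 1\<^sub>m n"
proof
  assume eq: "x - c \<cdot>\<^sub>m 1\<^sub>m n = y"
  show "x = y + c \<cdot>\<^sub>m 1\<^sub>m n"
    unfolding eq[symmetric] using UT_dim[OF assms(2)] by (intro eq_matI) auto
next
  assume eq: "x = y + c \<cdot>\<^sub>m 1\<^sub>m n"
  show "x - c \<cdot>\<^sub>m 1\<^sub>m n = y"
    unfolding eq using UT_dim[OF assms(1)] by (intro eq_matI) auto
qed

lemma add_zero_scalar: "x \<in> carrier (UT n) \<Longrightarrow> x + 0 \<cdot>\<^sub>m 1\<^sub>m n = x"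
  using UT_dim[of x n] by (intro eq_matI) auto

lemma \<Delta>_t: "\<Delta> t = {x + c \<cdot>\<^sub>m 1\<^sub>m n | x c. x \<in> \<Gamma> t}"
  unfolding practical_Gamma2_def set_add_def' UT_simps scalar_mats_def by auto

lemma V_subset: "V \<subseteq> \<Gamma> g"
proof
  fix v assume v: "v \<in> V"
  then have "v + 0 \<cdot>\<^sub>m 1\<^sub>m n \<in> \<Gamma> g" by (rule V_facts(4))
  moreover have "v + 0 \<cdot>\<^sub>m 1\<^sub>m n = v" using v V_carrier by (intro add_zero_scalar) blast
  ultimately show "v \<in> \<Gamma> g" by simp
qed

lemma \<Delta>_carrier: "\<Delta> h \<subseteq> carrier (UT n)"
proof (cases "h = t")
  case True
  then show ?thesis unfolding True \<Delta>_t using \<Gamma>_carrier by (auto intro!: UT_add_closed scalar_closed)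
next
  case False
  then show ?thesis using \<Gamma>_carrier V_carrier by (auto simp: practical_Gamma2_def)
qed

lemma \<Delta>_imp_\<Gamma>:
  assumes "x \<in> \<Delta> h"
  obtains y c where "y \<in> \<Gamma> h" "x = y + c \<cdot>\<^sub>m 1\<^sub>m n"
proof (cases "h = t")
  case True
  then show thesis using assms that unfolding True \<Delta>_t by blast
next
  case False
  then have "x \<in> \<Gamma> h" using assms V_subset by (auto simp: practical_Gamma2_def split: if_splits)
  then show thesis using that[of x 0] \<Gamma>_carrier add_zero_scalar by force
qed

lemma \<Gamma>_imp_\<Delta>:
  assumes x: "x \<in> \<Gamma> h"
  obtains y c where "y \<in> \<Delta> h" "x = y + c \<cdot>\<^sub>m 1\<^sub>m n"
proof -
  have xc: "x \<in> carrier (UT n)" using x \<Gamma>_carrier by blast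
  consider "h = t" | "h \<noteq> t" "h = g" | "h \<noteq> t" "h \<noteq> g" by blast
  then show thesis
  proof cases
    case 1
    have "x + 0 \<cdot>\<^sub>m 1\<^sub>m n \<in> \<Delta> h" using x unfolding 1 \<Delta>_t by blast
    then show ?thesis using that[of x 0] add_zero_scalar[OF xc] by simp
  next
    case 2
    then obtain c where c: "x - c \<cdot>\<^sub>m 1\<^sub>m n \<in> V" using x V_facts(3) by blast
    then have "x - c \<cdot>\<^sub>m 1\<^sub>m n \<in> carrier (UT n)" using V_carrier by blast
    then have "x = (x - c \<cdot>\<^sub>m 1\<^sub>m n) + c \<cdot>\<^sub>m 1\<^sub>m n" using scalar_add_iff[of "x - c \<cdot>\<^sub>m 1\<^sub>m n" x c] xc by blast
    moreover have "x - c \<cdot>\<^sub>m 1\<^sub>m n \<in> \<Delta> h" using c 2 by (simp add: practical_Gamma2_def)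
    ultimately show ?thesis using that by blast
  next
    case 3
    then have "x \<in> \<Delta> h" using x by (simp add: practical_Gamma2_def)
    then show ?thesis using that[of x 0] add_zero_scalar[OF xc] by simp
  qed
qed

text \<open>
  Because \<open>\<eta>\<close> is a palindrome, a unit and its mirror image lead to the same degrees. At the middle place
  the unit is its own mirror image, so \<open>X\<^sup>-\<close> vanishes there and only the degree of \<open>X\<^sup>+\<close> remains.
\<close>

lemma \<Gamma>_superdiag:
  assumes x: "x \<in> \<Gamma> h" and k: "Suc k < n" and nz: "x $$ (k, Suc k) \<noteq> 0"
  shows "h = g \<otimes> \<eta> ! k \<or> (h = \<eta> ! k \<and> k \<noteq> n - 2 - k)"
proof (rule ccontr)
  assume h: "\<not> ?thesis"
  have d: "deg_prod G \<eta> i j = \<eta> ! k" if "(k = i \<and> Suc k = j) \<or> (k = n - 1 - j \<and> Suc k = n - 1 - i)"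
    "i \<le> j" "j < n" for i j
  proof -
    have "j = Suc i" "i = k \<or> i = n - 2 - k" using that k by auto
    then show ?thesis using deg_prod_Suc[OF \<eta>(1), of i] k nth_pal[OF k] \<eta>(2) that by auto
  qed
  have "x $$ (k, Suc k) = 0"
    using x
  proof (induction rule: \<Gamma>_induct)
    case (minus i j)
    have "k = i \<and> Suc k = j \<longleftrightarrow> k = n - 1 - j \<and> Suc k = n - 1 - i" if "k = n - 2 - k"
      using that k minus(1,2) by auto
    moreover have "\<not> (k = i \<and> Suc k = j) \<and> \<not> (k = n - 1 - j \<and> Suc k = n - 1 - i)"
      if "k \<noteq> n - 2 - k"
      using d[of i j] h that minus by metis
    ultimately show ?case using k by (cases "k = n - 2 - k") (simp_all add: X_minus_entry)
  next
    case (plus i j)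
    then have "\<not> (k = i \<and> Suc k = j) \<and> \<not> (k = n - 1 - j \<and> Suc k = n - 1 - i)"
      using d[of i j] h by metis
    then show ?case using k by (auto simp: X_plus_entry)
  qed (use k in \<open>auto simp: UT_carrier_iff\<close>)
  then show False using nz by simp
qed

lemma g_mult_inj: "x \<in> carrier G \<Longrightarrow> g \<otimes> x \<noteq> x"
  using g(1,2) by simp

text \<open>
  Each \<open>X\<^sub>i\<^sub>j\<^sup>-\<close> is antisymmetric on the diagonal, and \<open>X\<^sub>i\<^sub>i\<^sup>+\<close> has degree \<open>g\<close>.
\<close>

lemma \<Gamma>_sym_diag_zero:
  assumes x: "x \<in> \<Gamma> h" and h: "h \<noteq> g"
  shows "sym_diag n x = 0\<^sub>m n n"
  using x
proof (induction rule: \<Gamma>_induct)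
  case zero
  show ?case by (rule sym_diag_zero) simp
next
  case (minus i j)
  have "X_minus n i j $$ (r, r) + X_minus n i j $$ (n - 1 - r, n - 1 - r) = (0 :: 'f)" if "r < n" for r
  proof -
    have "n - 1 - r = i \<longleftrightarrow> r = n - 1 - i" "n - 1 - r = j \<longleftrightarrow> r = n - 1 - j"
      "n - 1 - r = n - 1 - i \<longleftrightarrow> r = i" "n - 1 - r = n - 1 - j \<longleftrightarrow> r = j"
      using minus that by auto
    then show ?thesis using that by (simp add: X_minus_entry conj_commute del: diff_diff_left)
  qed
  then show ?case by (intro eq_matI) (simp_all add: sym_diag_def)
next
  case (plus i j)
  then have "i \<noteq> j" using h g(1) by (auto simp: deg_prod_refl)
  then show ?case using plus by (intro sym_diag_zero) (auto simp: X_plus_entry)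
qed (auto simp: sym_diag_add sym_diag_smult)

lemma \<Delta>_one: "1\<^sub>m n \<in> \<Delta> t"
proof -
  have "0\<^sub>m n n + 1 \<cdot>\<^sub>m 1\<^sub>m n \<in> \<Delta> t" unfolding \<Delta>_t using submoduleD(2)[OF \<Gamma>_submodule] by blast
  moreover have "0\<^sub>m n n + 1 \<cdot>\<^sub>m 1\<^sub>m n = (1\<^sub>m n :: 'f mat)" by (intro eq_matI) auto
  ultimately show ?thesis by simp
qed

text \<open>
  For degrees other than \<open>t\<close> and \<open>g\<close>, the symmetrised diagonal vanishes, but it fixes scalar matrices;
  this is where the characteristic matters.
\<close>

lemma \<Delta>_scalar:
  assumes x: "c \<cdot>\<^sub>m 1\<^sub>m n \<in> \<Delta> h" and c: "c \<noteq> 0"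
  shows "h = t"
proof (rule ccontr)
  assume h: "h \<noteq> t"
  have "c \<cdot>\<^sub>m 1\<^sub>m n = (0\<^sub>m n n :: 'f mat)"
  proof (cases "h = g")
    case True
    then have "c \<cdot>\<^sub>m 1\<^sub>m n \<in> V" using x h by (simp add: practical_Gamma2_def)
    then have "c \<cdot>\<^sub>m 1\<^sub>m n \<in> V \<inter> scalar_mats n" unfolding scalar_mats_def by blast
    then show ?thesis unfolding V_facts(2) by blast
  next
    case False
    then have "c \<cdot>\<^sub>m 1\<^sub>m n \<in> \<Gamma> h" using x h by (simp add: practical_Gamma2_def)
    then have "sym_diag n (c \<cdot>\<^sub>m 1\<^sub>m n) = (0\<^sub>m n n :: 'f mat)" by (rule \<Gamma>_sym_diag_zero[OF _ False])
    then show ?thesis using sym_diag_smult[OF UT_one_closed, of n c] sym_diag_one[OF two] by simp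
  qed
  then have "(c \<cdot>\<^sub>m 1\<^sub>m n) $$ (0, 0) = (0\<^sub>m n n :: 'f mat) $$ (0, 0)" by (rule arg_cong)
  then show False using c n by simp
qed

lemma sym_diag_mem: 
  assumes "x \<in> carrier (UT n)"
  shows "sym_diag n x \<in> \<Gamma> g"
  using assms
proof (induction rule: mat_unit_induct)
  case zero
  show ?case using submoduleD(2)[OF \<Gamma>_submodule] by (subst sym_diag_zero) auto
next
  case (unit a b)
  show ?case
  proof (cases "a = b")
    case True
    have "X_plus n a a \<in> \<Gamma> g" using \<Gamma>_plus[of a a] unit True g(1) by (simp add: deg_prod_refl)
    then have "(1 / 2) \<cdot>\<^sub>m X_plus n a a \<in> \<Gamma> g" by (rule submoduleD(4)[OF \<Gamma>_submodule])
    moreover have "(1 / 2) \<cdot>\<^sub>m X_plus n a a = sym_diag n (mat_unit n a b :: 'f mat)"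
      using unit True by (intro eq_matI) (auto simp: sym_diag_def X_plus_def mat_unit_def)
    ultimately show ?thesis by simp
  next
    case False
    then show ?thesis using submoduleD(2)[OF \<Gamma>_submodule]
      by (subst sym_diag_zero) (auto simp: mat_unit_entry)
  qed
next
  case (add x y)
  then show ?case by (simp add: sym_diag_add submoduleD(3)[OF \<Gamma>_submodule])
next
  case (smult c x)
  then show ?case by (simp add: sym_diag_smult submoduleD(4)[OF \<Gamma>_submodule])
qed

text \<open>
  The matrices \<open>X\<^sub>k\<^sub>k\<^sup>-\<close> are diagonal and antisymmetric under the flip, hence act on both units in
  \<open>X\<^sub>i\<^sub>j\<^sup>\<plusminus>\<close> by the same scalar. It is \<open>1\<close> for \<open>k = i\<close>, or \<open>2\<close> if the position lies on the
  antidiagonal; if \<open>i\<close> is the middle index, \<open>X\<^sub>i\<^sub>i\<^sup>-\<close> vanishes and \<open>k = j\<close> gives \<open>- 1\<close>.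
\<close>

lemma eigen_generator:
  assumes ij: "i < j" "j < n" and X: "X = X_minus n i j \<or> X = X_plus n i j"
  obtains H where "H \<in> \<Gamma> \<one>" "lie_bracket H X = X"
proof -
  have Xc: "X \<in> carrier (UT n)" using X X_carrier[of i j n] ij by auto
  have scaled: thesis if k: "k < n" and e: "e \<noteq> 0"
    "\<And>a b. a < n \<Longrightarrow> b < n \<Longrightarrow> X $$ (a, b) \<noteq> 0 \<Longrightarrow>
      X_minus n k k $$ (a, a) - X_minus n k k $$ (b, b) = e" for k and e :: 'f
  proof -
    let ?H = "(1 / e) \<cdot>\<^sub>m X_minus n k k"
    have kc: "X_minus n k k \<in> carrier (UT n :: ('f, 'f mat) module)" using X_carrier k by blast
    have Hc: "?H \<in> carrier (UT n)" by (rule UT_smult_closed[OF kc])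
    have "X_minus n k k \<in> \<Gamma> \<one>" using k \<Gamma>_minus[of k k] by (simp add: deg_prod_refl)
    then have H1: "?H \<in> \<Gamma> \<one>" by (rule submoduleD(4)[OF \<Gamma>_submodule])
    have "lie_bracket ?H X = X"
    proof (rule eq_matI)
      fix a b assume "a < dim_row X" "b < dim_col X"
      then have ab: "a < n" "b < n" using UT_dim[OF Xc] by auto
      have "lie_bracket ?H X $$ (a, b) = (?H $$ (a, a) - ?H $$ (b, b)) * X $$ (a, b)"
        by (rule bracket_diagonal_entry[OF Hc _ Xc ab])
           (use k UT_dim[OF kc] in \<open>auto simp: X_minus_entry\<close>)
      also have "?H $$ (a, a) - ?H $$ (b, b) = (1 / e) * (X_minus n k k $$ (a, a) - X_minus n k k $$ (b, b))"
        using ab UT_dim[OF kc] by (simp add: algebra_simps)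
      finally show "lie_bracket ?H X $$ (a, b) = X $$ (a, b)"
        using e ab by (cases "X $$ (a, b) = 0") auto
    qed (use UT_dim[OF Xc] UT_dim[OF UT_bracket_closed[OF Hc Xc]] in auto)
    then show thesis using H1 \<open>\<And>H. H \<in> \<Gamma> \<one> \<Longrightarrow> lie_bracket H X = X \<Longrightarrow> thesis\<close> by blast
  qed
  have supp: "(a = i \<and> b = j) \<or> (a = n - 1 - j \<and> b = n - 1 - i)"
    if "a < n" "b < n" "X $$ (a, b) \<noteq> 0" for a b
    using that X by (auto simp: X_minus_entry X_plus_entry split: if_splits)
  show thesis
  proof (cases "i = n - 1 - i")
    case False
    show thesis
    proof (rule scaled[of i "if j = n - 1 - i then 2 else 1"])
      fix a b assume ab: "a < n" "b < n" "X $$ (a, b) \<noteq> 0"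
      show "X_minus n i i $$ (a, a) - X_minus n i i $$ (b, b) = (if j = n - 1 - i then 2 else (1 :: 'f))"
        using supp[OF ab] ab False ij by (auto simp: X_minus_entry)
    qed (use ij two in auto)
  next
    case True
    show thesis
    proof (rule scaled[of j "- 1"])
      fix a b assume ab: "a < n" "b < n" "X $$ (a, b) \<noteq> 0"
      show "X_minus n j j $$ (a, a) - X_minus n j j $$ (b, b) = (- 1 :: 'f)"
        using supp[OF ab] ab True ij by (auto simp: X_minus_entry)
    qed (use ij in auto)
  qed
qed

text \<open>
  A strictly upper triangular generator of degree \<open>g\<close> differs from an element of \<open>V\<close> by a scalar matrix. It is the
  bracket of itself with an element of degree \<open>\<one>\<close>, and this bracket does not see the scalar matrix;
  since \<open>V\<close> is the component of degree \<open>g\<close> of a grading, the bracket lies in \<open>V\<close>.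
\<close>

lemma strict_generator_in_V:
  assumes tg: "t \<noteq> g" and ij: "i < j" "j < n" and X: "X = X_minus n i j \<or> X = X_plus n i j"
    and Xg: "X \<in> \<Gamma> g"
  shows "X \<in> V"
proof -
  obtain H where H: "H \<in> \<Gamma> \<one>" "lie_bracket H X = X" by (rule eigen_generator[OF ij X])
  obtain c where v: "X - c \<cdot>\<^sub>m 1\<^sub>m n \<in> V" using V_facts(3)[OF Xg] by blast
  let ?v = "X - c \<cdot>\<^sub>m 1\<^sub>m n"
  have Hc: "H \<in> carrier (UT n)" and Xc: "X \<in> carrier (UT n)" and vc: "?v \<in> carrier (UT n)"
    using H Xg v \<Gamma>_carrier V_carrier by blast+
  have "H \<in> \<Delta> \<one>"
  proof (cases "t = \<one>")
    case True
    have "H + 0 \<cdot>\<^sub>m 1\<^sub>m n \<in> \<Delta> t" unfolding \<Delta>_t using H True by blast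
    then show ?thesis using True add_zero_scalar[OF Hc] by simp
  next
    case False
    then show ?thesis using H g by (simp add: practical_Gamma2_def)
  qed
  moreover have Vg: "\<Delta> g = V" using tg by (simp add: practical_Gamma2_def)
  moreover have "is_grading G (UT n) \<Delta>" using choice by (simp add: Gamma2_choice_def)
  ultimately have "lie_bracket H ?v \<in> \<Delta> (\<one> \<otimes> g)"
    using v g(1) unfolding is_grading_def UT_simps by blast
  then have "lie_bracket H ?v \<in> V" using g(1) Vg by simp
  moreover have "lie_bracket H ?v = lie_bracket H X" by (rule bracket_minus_scalar[OF Hc Xc])
  ultimately show ?thesis using H by simp
qed

text \<open>
  Hence \<open>V\<close>, if \<open>t \<noteq> g\<close>, is determined by its intersection with the span of the \<open>X\<^sub>i\<^sub>i\<^sup>+\<close>.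
\<close>

lemma minus_sym_diag_in_V:
  assumes tg: "t \<noteq> g" and x: "x \<in> \<Gamma> g"
  shows "x - sym_diag n x \<in> V"
  using x
proof (induction rule: \<Gamma>_induct)
  case zero
  have "0\<^sub>m n n - sym_diag n (0\<^sub>m n n) = (0\<^sub>m n n :: 'f mat)"
    by (subst sym_diag_zero) auto
  then show ?case using submoduleD(2)[OF V_facts(1)] by simp
next
  case (minus i j)
  then have "i \<noteq> j" using g(2) by (auto simp: deg_prod_refl)
  then have "X_minus n i j \<in> V"
    using minus \<Gamma>_minus[OF minus(1,2)] by (intro strict_generator_in_V[OF tg]) auto
  moreover have "sym_diag n (X_minus n i j) = (0\<^sub>m n n :: 'f mat)"
    using \<open>i \<noteq> j\<close> minus by (intro sym_diag_zero) (auto simp: X_minus_entry)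
  moreover have "X_minus n i j - 0\<^sub>m n n = (X_minus n i j :: 'f mat)"
    by (intro eq_matI) (auto simp: X_minus_def mat_unit_def)
  ultimately show ?case by simp
next
  case (plus i j)
  show ?case
  proof (cases "j = i")
    case True
    have flip: "X_plus n i i $$ (n - 1 - r, n - 1 - r) = (X_plus n i i $$ (r, r) :: 'f)" if "r < n" for r
    proof -
      have "n - 1 - r = i \<longleftrightarrow> r = n - 1 - i" "n - 1 - r = n - 1 - i \<longleftrightarrow> r = i"
        using plus True that by auto
      then show ?thesis using that by (simp add: X_plus_entry add.commute del: diff_diff_left)
    qed
    have "X_plus n i j - sym_diag n (X_plus n i j) = (0\<^sub>m n n :: 'f mat)"
    proof (rule eq_matI)
      fix r c assume "r < dim_row (0\<^sub>m n n :: 'f mat)" "c < dim_col (0\<^sub>m n n :: 'f mat)"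
      then have rc: "r < n" "c < n" by simp_all
      have off: "r \<noteq> c \<Longrightarrow> X_plus n i i $$ (r, c) = (0 :: 'f)" using rc by (auto simp: X_plus_entry)
      have half: "(x + x) / 2 = x" for x :: 'f using two by (simp add: field_simps flip: mult_2)
      have "sym_diag n (X_plus n i i) $$ (r, c) = (X_plus n i i $$ (r, c) :: 'f)"
      proof (cases "r = c")
        case eq: True
        have "sym_diag n (X_plus n i i) $$ (r, c) =
            (X_plus n i i $$ (r, r) + X_plus n i i $$ (n - 1 - r, n - 1 - r)) / (2 :: 'f)"
          using rc eq by (simp add: sym_diag_def)
        also have "\<dots> = X_plus n i i $$ (r, c)" unfolding flip[OF rc(1)] half using eq by simp
        finally show ?thesis .
      next
        case False
        then show ?thesis using rc off by (simp add: sym_diag_def)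
      qed
      then show "(X_plus n i j - sym_diag n (X_plus n i j)) $$ (r, c) = (0\<^sub>m n n :: 'f mat) $$ (r, c)"
        using rc by (simp add: True sym_diag_def)
    qed (simp_all add: sym_diag_def)
    then show ?thesis using submoduleD(2)[OF V_facts(1)] by simp
  next
    case False
    then have "X_plus n i j \<in> V"
      using plus \<Gamma>_plus[OF plus(1,2)] by (intro strict_generator_in_V[OF tg]) auto
    moreover have "sym_diag n (X_plus n i j) = (0\<^sub>m n n :: 'f mat)"
      using False plus by (intro sym_diag_zero) (auto simp: X_plus_entry)
    moreover have "X_plus n i j - 0\<^sub>m n n = (X_plus n i j :: 'f mat)"
      by (intro eq_matI) (auto simp: X_plus_def mat_unit_def)
    ultimately show ?thesis by simp
  qed
next
  case (add x y)
  have "x + y - sym_diag n (x + y) = (x - sym_diag n x) + (y - sym_diag n y)"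
    unfolding sym_diag_add[OF add(1,2)] using UT_dim[OF add(1)] UT_dim[OF add(2)]
    by (intro eq_matI) (auto simp: sym_diag_def)
  then show ?case using submoduleD(3)[OF V_facts(1) add(3,4)] by simp
next
  case (smult c x)
  have "c \<cdot>\<^sub>m x - sym_diag n (c \<cdot>\<^sub>m x) = c \<cdot>\<^sub>m (x - sym_diag n x)"
    unfolding sym_diag_smult[OF smult(1)] using UT_dim[OF smult(1)]
    by (intro eq_matI) (auto simp: sym_diag_def right_diff_distrib)
  then show ?case using submoduleD(4)[OF V_facts(1) smult(2)] by simp
qed

definition \<mu> :: "'f mat \<Rightarrow> 'f" where "\<mu> x = scalar_part n V (sym_diag n x)"

lemma \<mu>_functional: "central_functional n \<mu>"
  and \<mu>_sym_diag: "x \<in> carrier (UT n) \<Longrightarrow> sym_diag n x - \<mu> x \<cdot>\<^sub>m 1\<^sub>m n \<in> V"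
proof -
  note * = central_functional_scalar_part[where p = "sym_diag n", OF _ V_sum sym_diag_add
      sym_diag_smult sym_diag_zero sym_diag_one[OF two] sym_diag_mem \<Gamma>_carrier]
  show "central_functional n \<mu>" unfolding \<mu>_def[abs_def] by (rule *(1)) (use n in auto)
  show "sym_diag n x - \<mu> x \<cdot>\<^sub>m 1\<^sub>m n \<in> V" if "x \<in> carrier (UT n)"
    unfolding \<mu>_def by (rule *(2)) (use n that in auto)
qed

lemma \<mu>_complement:
  assumes tg: "t \<noteq> g" and x: "x \<in> \<Gamma> g"
  shows "x - \<mu> x \<cdot>\<^sub>m 1\<^sub>m n \<in> V"
proof -
  have xc: "x \<in> carrier (UT n)" using x \<Gamma>_carrier by blast
  have "(x - sym_diag n x) + (sym_diag n x - \<mu> x \<cdot>\<^sub>m 1\<^sub>m n) \<in> V"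
    using submoduleD(3)[OF V_facts(1) minus_sym_diag_in_V[OF tg x] \<mu>_sym_diag[OF xc]] .
  moreover have "(x - sym_diag n x) + (sym_diag n x - \<mu> x \<cdot>\<^sub>m 1\<^sub>m n) = x - \<mu> x \<cdot>\<^sub>m 1\<^sub>m n"
    using UT_dim[OF xc] by (intro eq_matI) (auto simp: sym_diag_def)
  ultimately show ?thesis by simp
qed

lemma \<mu>_V:
  assumes tg: "t \<noteq> g" and v: "v \<in> V"
  shows "\<mu> v = 0"
proof -
  have vc: "v \<in> carrier (UT n)" using v V_carrier by blast
  have "v - (v - \<mu> v \<cdot>\<^sub>m 1\<^sub>m n) \<in> V"
    by (rule submodule_diff[OF V_facts(1) v \<mu>_complement[OF tg subsetD[OF V_subset v]]])
  moreover have "v - (v - \<mu> v \<cdot>\<^sub>m 1\<^sub>m n) = \<mu> v \<cdot>\<^sub>m 1\<^sub>m n" using UT_dim[OF vc] by (intro eq_matI) auto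
  ultimately have "\<mu> v \<cdot>\<^sub>m 1\<^sub>m n \<in> V \<inter> scalar_mats n" unfolding scalar_mats_def by auto
  then have eq: "\<mu> v \<cdot>\<^sub>m 1\<^sub>m n = (0\<^sub>m n n :: 'f mat)" unfolding V_facts(2) by blast
  have "(\<mu> v \<cdot>\<^sub>m 1\<^sub>m n) $$ (0, 0) = (0\<^sub>m n n :: 'f mat) $$ (0, 0)" unfolding eq ..
  then show ?thesis using n by simp
qed

lemma \<mu>_other: 
  assumes "x \<in> \<Gamma> h" "h \<noteq> g"
  shows "\<mu> x = 0"
  unfolding \<mu>_def \<Gamma>_sym_diag_zero[OF assms]
proof (rule scalar_part_eqI[OF _ V_facts(1,2) UT_zero_closed])
  have "0\<^sub>m n n - 0 \<cdot>\<^sub>m 1\<^sub>m n = (0\<^sub>m n n :: 'f mat)" by (intro eq_matI) auto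
  then show "0\<^sub>m n n - 0 \<cdot>\<^sub>m 1\<^sub>m n \<in> V" using submoduleD(2)[OF V_facts(1)] by simp
qed (use n in auto)

end

text \<open>
  For a place \<open>j\<close> off the middle, the set \<open>{g\<^sub>j, g g\<^sub>j}\<close> of degrees of \<open>X\<^sup>-\<close> and \<open>X\<^sup>+\<close> is contained in
  \<open>{g'\<^sub>j, g' g'\<^sub>j}\<close>. Both sets have two elements, which forces \<open>g = g'\<close>. Such a place exists because
  \<open>n > 2\<close>.
\<close>

lemma Gamma2_necessary:
  assumes "Gamma2_data G n (V :: 'f::field mat set) t g \<eta>" "Gamma2_data G n (V' :: 'f mat set) t' g' \<eta>'"
    and "UT_automorphism n \<psi>"
    and gr: "\<forall>h\<in>carrier G. \<forall>x\<in>practical_Gamma2 G n V t g \<eta> h.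
      \<exists>y\<in>practical_Gamma2 G n V' t' g' \<eta>' h. \<exists>c. \<psi> x = y + c \<cdot>\<^sub>m 1\<^sub>m n"
  shows "g = g' \<and> seq_sim_mod G n g \<eta> \<eta>'"
proof -
  interpret A: Gamma2_data G n V t g \<eta> by fact
  interpret B: Gamma2_data G n V' t' g' \<eta>' by fact
  interpret UT_automorphism n \<psi> by fact
  note n = A.n
  obtain \<tau> where \<tau>: "\<tau> = (\<lambda>j. j) \<or> \<tau> = (\<lambda>j. n - 2 - j)"
    and iff: "\<And>i j. Suc i < n \<Longrightarrow> Suc j < n \<Longrightarrow> \<psi> (mat_unit n i (Suc i)) $$ (j, Suc j) \<noteq> 0 \<longleftrightarrow> i = \<tau> j"
    using superdiagonal_permutation by blast
  have deg: "h = g' \<otimes>\<^bsub>G\<^esub> \<eta>' ! j \<or> (h = \<eta>' ! j \<and> j \<noteq> n - 2 - j)"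
    if h: "h \<in> carrier G" and x: "x \<in> A.\<Gamma> h" and j: "Suc j < n" and nz: "\<psi> x $$ (j, Suc j) \<noteq> 0" for h x j
  proof -
    obtain y c where y: "y \<in> A.\<Delta> h" "x = y + c \<cdot>\<^sub>m 1\<^sub>m n" by (rule A.\<Gamma>_imp_\<Delta>[OF x])
    obtain z d where z: "z \<in> B.\<Delta> h" "\<psi> y = z + d \<cdot>\<^sub>m 1\<^sub>m n" using gr h y by blast
    obtain w e where w: "w \<in> B.\<Gamma> h" "z = w + e \<cdot>\<^sub>m 1\<^sub>m n" by (rule B.\<Delta>_imp_\<Gamma>[OF z(1)])
    have yc: "y \<in> carrier (UT n)" and wc: "w \<in> carrier (UT n)"
      using y w A.\<Delta>_carrier B.\<Gamma>_carrier by blast+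
    have "\<psi> (c \<cdot>\<^sub>m 1\<^sub>m n) \<in> scalar_mats n" using image_center scalar_mats_iff by blast
    then obtain c' where c': "\<psi> (c \<cdot>\<^sub>m 1\<^sub>m n) = c' \<cdot>\<^sub>m 1\<^sub>m n" unfolding scalar_mats_iff by blast
    have "\<psi> x = w + e \<cdot>\<^sub>m 1\<^sub>m n + d \<cdot>\<^sub>m 1\<^sub>m n + c' \<cdot>\<^sub>m 1\<^sub>m n"
      unfolding y(2) add[OF yc scalar_closed] c' z(2) w(2) ..
    then have "\<psi> x $$ (j, Suc j) = w $$ (j, Suc j)" using j UT_dim[OF wc] by simp
    with nz show ?thesis using B.\<Gamma>_superdiag[OF w(1) j] by simp
  qed
  \<comment> \<open>The permutation of the superdiagonal is invisible in the degrees, because it is the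
    identity or the reversal and \<open>\<eta>\<close> is a palindrome.\<close>
  have plus: "g \<otimes>\<^bsub>G\<^esub> \<eta> ! j = g' \<otimes>\<^bsub>G\<^esub> \<eta>' ! j \<or> (g \<otimes>\<^bsub>G\<^esub> \<eta> ! j = \<eta>' ! j \<and> j \<noteq> n - 2 - j)"
    and minus: "j \<noteq> n - 2 - j \<Longrightarrow> \<eta> ! j = g' \<otimes>\<^bsub>G\<^esub> \<eta>' ! j \<or> \<eta> ! j = \<eta>' ! j" if j: "Suc j < n" for j
  proof -
    define i where "i = \<tau> j"
    have i: "Suc i < n" and i_eq: "\<eta> ! i = \<eta> ! j" and i_mid: "i = n - 2 - i \<longleftrightarrow> j = n - 2 - j"
      using \<tau> j A.nth_pal[OF j] by (auto simp: i_def)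
    let ?i' = "n - 2 - i"
    have i': "Suc ?i' < n" "n - 1 - Suc i = ?i'" "n - 1 - i = Suc ?i'" using i by auto
    have dg: "deg_prod G \<eta> i (Suc i) = \<eta> ! j"
      using A.deg_prod_Suc[OF A.\<eta>(1), of i] i A.\<eta>(2) i_eq by simp
    have ec: "mat_unit n i (Suc i) \<in> carrier (UT n :: ('f, 'f mat) module)"
      "mat_unit n ?i' (Suc ?i') \<in> carrier (UT n :: ('f, 'f mat) module)" by (simp_all add: mat_unit_carrier)
    have nz: "\<psi> (mat_unit n i (Suc i)) $$ (j, Suc j) \<noteq> 0" using iff[OF i j] by (simp add: i_def)
    have z: "\<psi> (mat_unit n ?i' (Suc ?i')) $$ (j, Suc j) = 0" if "i \<noteq> ?i'"
      using iff[OF i'(1) j] that by (auto simp: i_def)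
    have "\<psi> (X_plus n i (Suc i)) $$ (j, Suc j) \<noteq> 0"
    proof (cases "i = ?i'")
      case True
      then have "X_plus n i (Suc i) = (2 :: 'f) \<cdot>\<^sub>m mat_unit n i (Suc i)"
        unfolding X_plus_def i' by (intro eq_matI) (auto simp: mat_unit_def)
      then show ?thesis using nz A.two j dims[OF ec(1)] by (simp add: smult[OF ec(1)])
    next
      case False
      then show ?thesis using nz z[OF False] j dims[OF ec(1)] dims[OF ec(2)]
        unfolding X_plus_def i' add[OF ec] by simp
    qed
    moreover have "X_plus n i (Suc i) \<in> A.\<Gamma> (g \<otimes>\<^bsub>G\<^esub> \<eta> ! j)" using A.\<Gamma>_plus[of i "Suc i"] i dg by simp
    ultimately show "g \<otimes>\<^bsub>G\<^esub> \<eta> ! j = g' \<otimes>\<^bsub>G\<^esub> \<eta>' ! j \<or> (g \<otimes>\<^bsub>G\<^esub> \<eta> ! j = \<eta>' ! j \<and> j \<noteq> n - 2 - j)"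
      using A.nth_carrier[OF j] A.g(1) by (intro deg j) auto
    assume "j \<noteq> n - 2 - j"
    then have ne: "i \<noteq> ?i'" using i_mid by blast
    have "\<psi> (X_minus n i (Suc i)) $$ (j, Suc j) \<noteq> 0"
      using nz z[OF ne] j dims[OF ec(1)] dims[OF ec(2)]
      unfolding X_minus_def i' diff[OF ec] by simp
    moreover have "X_minus n i (Suc i) \<in> A.\<Gamma> (\<eta> ! j)" using A.\<Gamma>_minus[of i "Suc i"] i dg by simp
    ultimately show "\<eta> ! j = g' \<otimes>\<^bsub>G\<^esub> \<eta>' ! j \<or> \<eta> ! j = \<eta>' ! j"
      using deg[OF A.nth_carrier[OF j] _ j] by blast
  qed
  have gg: "g = g'"
  proof -
    have j: "Suc 0 < n" "0 \<noteq> n - 2 - 0" using n by auto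
    have c: "\<eta> ! 0 \<in> carrier G" "\<eta>' ! 0 \<in> carrier G" using A.nth_carrier[OF j(1)] B.nth_carrier[OF j(1)] by auto
    from minus[OF j] show ?thesis
    proof
      assume e: "\<eta> ! 0 = \<eta>' ! 0"
      then have "g \<otimes>\<^bsub>G\<^esub> \<eta>' ! 0 \<noteq> \<eta>' ! 0" using A.g_mult_inj[OF c(2)] by simp
      then have "g \<otimes>\<^bsub>G\<^esub> \<eta>' ! 0 = g' \<otimes>\<^bsub>G\<^esub> \<eta>' ! 0" using plus[OF j(1)] e by simp
      then show ?thesis using A.g(1) B.g(1) c by simp
    next
      assume e: "\<eta> ! 0 = g' \<otimes>\<^bsub>G\<^esub> \<eta>' ! 0"
      then have "g \<otimes>\<^bsub>G\<^esub> (g' \<otimes>\<^bsub>G\<^esub> \<eta>' ! 0) \<noteq> g' \<otimes>\<^bsub>G\<^esub> \<eta>' ! 0" using A.g_mult_inj[OF c(1)] by simp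
      then have "g \<otimes>\<^bsub>G\<^esub> (g' \<otimes>\<^bsub>G\<^esub> \<eta>' ! 0) = \<eta>' ! 0" using plus[OF j(1)] e by simp
      then have "(g \<otimes>\<^bsub>G\<^esub> g') \<otimes>\<^bsub>G\<^esub> \<eta>' ! 0 = \<eta>' ! 0" using A.g(1) B.g(1) c by (simp add: A.m_assoc)
      then have "g \<otimes>\<^bsub>G\<^esub> g' = \<one>\<^bsub>G\<^esub>" using A.g(1) B.g(1) c by simp
      then have "g \<otimes>\<^bsub>G\<^esub> g' = g' \<otimes>\<^bsub>G\<^esub> g'" using B.g(3) by simp
      then show ?thesis using A.g(1) B.g(1) by simp
    qed
  qed
  have "seq_sim_mod G n g \<eta> \<eta>'"
    unfolding seq_sim_mod_def
  proof (intro conjI ballI impI)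
    fix i assume "i \<in> {1..(n - 1) div 2}"
    then have "Suc (i - 1) < n" "i - 1 \<noteq> n - 2 - (i - 1)" by auto
    then show "\<eta> ! (i - 1) \<in> {\<eta>' ! (i - 1), g \<otimes>\<^bsub>G\<^esub> \<eta>' ! (i - 1)}"
      using minus[of "i - 1"] gg by auto
  next
    assume "even n"
    then obtain m where m: "n = 2 * m" by blast
    let ?j = "n div 2 - 1"
    have j: "Suc ?j < n" "?j = n - 2 - ?j" using n m by auto
    then have "g \<otimes>\<^bsub>G\<^esub> \<eta> ! ?j = g \<otimes>\<^bsub>G\<^esub> \<eta>' ! ?j" using plus[OF j(1)] gg by blast
    then show "\<eta> ! ?j = \<eta>' ! ?j"
      using A.g(1) A.nth_carrier[OF j(1)] B.nth_carrier[OF j(1)] by simp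
  qed
  with gg show ?thesis by blast
qed

text \<open>
  Conjugation multiplies the units in \<open>X\<^sub>i\<^sub>j\<^sup>\<plusminus>\<close> by \<open>d\<^sub>i d\<^sub>j\<close> and by the corresponding product at the mirrored
  indices. The product of these two signs decides whether \<open>X\<^sup>+\<close> and \<open>X\<^sup>-\<close> are exchanged.
\<close>

lemma sign_conj_X:
  fixes d :: "nat \<Rightarrow> 'f::field"
  assumes "i < n" "j < n" and d: "\<And>k. k < n \<Longrightarrow> d k * d k = 1"
  shows "d i * d j * d (n - 1 - i) * d (n - 1 - j) = 1 \<Longrightarrow>
      sign_conj n d (X_minus n i j) = (d i * d j) \<cdot>\<^sub>m X_minus n i j"
    and "d i * d j * d (n - 1 - i) * d (n - 1 - j) = 1 \<Longrightarrow>
      sign_conj n d (X_plus n i j) = (d i * d j) \<cdot>\<^sub>m X_plus n i j"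
    and "d i * d j * d (n - 1 - i) * d (n - 1 - j) = - 1 \<Longrightarrow>
      sign_conj n d (X_minus n i j) = (d i * d j) \<cdot>\<^sub>m X_plus n i j"
    and "d i * d j * d (n - 1 - i) * d (n - 1 - j) = - 1 \<Longrightarrow>
      sign_conj n d (X_plus n i j) = (d i * d j) \<cdot>\<^sub>m X_minus n i j"
proof -
  let ?i = "n - 1 - i" and ?j = "n - 1 - j"
  have ij: "?i < n" "?j < n" using assms by auto
  have prod: "d ?j * d ?i = (d i * d j * d ?i * d ?j) * (d i * d j)"
  proof -
    have "(d i * d j * d ?i * d ?j) * (d i * d j) = (d i * d i) * (d j * d j) * (d ?j * d ?i)"
      by (simp only: ac_simps)
    also have "\<dots> = d ?j * d ?i" by (simp only: d[OF assms(1)] d[OF assms(2)] mult_1)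
    finally show ?thesis by (rule sym)
  qed
  have unit: "sign_conj n d (mat_unit n a b) = (d a * d b) \<cdot>\<^sub>m mat_unit n a b" for a b
    by (intro eq_matI) (auto simp: sign_conj_def mat_unit_def)
  have m: "sign_conj n d (X_minus n i j) = (d i * d j) \<cdot>\<^sub>m mat_unit n i j - (d ?j * d ?i) \<cdot>\<^sub>m mat_unit n ?j ?i"
    unfolding unit[symmetric] by (intro eq_matI) (auto simp: sign_conj_def X_minus_def mat_unit_def)
  have p: "sign_conj n d (X_plus n i j) = (d i * d j) \<cdot>\<^sub>m mat_unit n i j + (d ?j * d ?i) \<cdot>\<^sub>m mat_unit n ?j ?i"
    unfolding unit[symmetric] by (intro eq_matI) (auto simp: sign_conj_def X_plus_def mat_unit_def algebra_simps)
  show "d i * d j * d ?i * d ?j = 1 \<Longrightarrow> sign_conj n d (X_minus n i j) = (d i * d j) \<cdot>\<^sub>m X_minus n i j"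
    unfolding m prod by (intro eq_matI) (auto simp: X_minus_def mat_unit_def)
  show "d i * d j * d ?i * d ?j = 1 \<Longrightarrow> sign_conj n d (X_plus n i j) = (d i * d j) \<cdot>\<^sub>m X_plus n i j"
    unfolding p prod by (intro eq_matI) (auto simp: X_plus_def mat_unit_def algebra_simps)
  show "d i * d j * d ?i * d ?j = - 1 \<Longrightarrow> sign_conj n d (X_minus n i j) = (d i * d j) \<cdot>\<^sub>m X_plus n i j"
    unfolding m prod by (intro eq_matI) (auto simp: X_plus_def mat_unit_def algebra_simps)
  show "d i * d j * d ?i * d ?j = - 1 \<Longrightarrow> sign_conj n d (X_plus n i j) = (d i * d j) \<cdot>\<^sub>m X_minus n i j"
    unfolding p prod by (intro eq_matI) (auto simp: X_minus_def mat_unit_def algebra_simps)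
qed

text \<open>
  Every place where \<open>\<eta>\<close> and \<open>\<eta>'\<close> differ contributes one factor \<open>g\<close> to the degrees and, by the choice
  of the signs, one exchange of \<open>X\<^sup>+\<close> and \<open>X\<^sup>-\<close>, which shifts the degree by \<open>g\<close> as well. Both effects
  cancel since \<open>g\<close> commutes with the entries and has order 2.
\<close>

lemma Gamma2_sign_conj:
  assumes "Gamma2_data G n (V :: 'f::field mat set) t g \<eta>" "Gamma2_data G n (V' :: 'f mat set) t' g \<eta>'"
    and sim: "seq_sim_mod G n g \<eta> \<eta>'"
  shows "\<exists>d :: nat \<Rightarrow> 'f. (\<forall>i. d i * d i = 1) \<and>
    (\<forall>h. \<forall>x\<in>Gamma2 G n g \<eta> h. sign_conj n d x \<in> Gamma2 G n g \<eta>' h)"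
proof -
  interpret A: Gamma2_data G n V t g \<eta> by fact
  interpret B: Gamma2_data G n V' t' g \<eta>' by fact
  note n = A.n
  \<comment> \<open>The sign by which the unit at place \<open>k\<close> is multiplied. It is turned only in
    the left half, so that it differs from the sign at the mirrored place.\<close>
  define s :: "nat \<Rightarrow> 'f" where "s k = (if k < (n - 1) div 2 \<and> \<eta> ! k \<noteq> \<eta>' ! k then - 1 else 1)" for k
  define d where "d i = (\<Prod>k<i. s k)" for i
  have s2: "s k * s k = 1" for k by (simp add: s_def)
  have d2: "d i * d i = 1" for i
    unfolding d_def prod.distrib[symmetric] by (simp add: s2)
  have half: "\<eta> ! k = \<eta>' ! k \<or> \<eta> ! k = g \<otimes>\<^bsub>G\<^esub> \<eta>' ! k" if "k < (n - 1) div 2" for k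
  proof -
    have "\<forall>i\<in>{1..(n - 1) div 2}. \<eta> ! (i - 1) \<in> {\<eta>' ! (i - 1), g \<otimes>\<^bsub>G\<^esub> \<eta>' ! (i - 1)}"
      using sim unfolding seq_sim_mod_def by blast
    moreover have "Suc k \<in> {1..(n - 1) div 2}" using that by simp
    ultimately show ?thesis by (metis diff_Suc_1 insertE singletonD)
  qed
  \<comment> \<open>At the middle place \<open>k = n - 2 - k\<close> the product is a square, in accordance with
    the requirement that the middle entries agree.\<close>
  have u: "(s k * s (n - 2 - k) = 1 \<and> \<eta> ! k = \<eta>' ! k) \<or>
      (s k * s (n - 2 - k) = - 1 \<and> \<eta> ! k = g \<otimes>\<^bsub>G\<^esub> \<eta>' ! k)" if k: "Suc k < n" for k
  proof -
    consider "k < (n - 1) div 2" | "n - 2 - k < (n - 1) div 2" | "even n" "k = n div 2 - 1"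
      using k n by (cases "even n") (auto elim!: evenE oddE; linarith)+
    then show ?thesis
    proof cases
      case 1
      then have "\<not> n - 2 - k < (n - 1) div 2" by linarith
      then show ?thesis using half[OF 1] 1 by (auto simp: s_def)
    next
      case 2
      then have "\<not> k < (n - 1) div 2" by linarith
      then show ?thesis using half[OF 2] 2 A.nth_pal[OF k] B.nth_pal[OF k] by (auto simp: s_def)
    next
      case 3
      then have "\<not> k < (n - 1) div 2" "n - 2 - k = k" using n by (auto elim!: evenE)
      then show ?thesis using sim 3 by (auto simp: s_def seq_sim_mod_def)
    qed
  qed
  let ?\<epsilon> = "\<lambda>i j. d i * d j * d (n - 1 - i) * d (n - 1 - j)"
  \<comment> \<open>Both sides are multiplicative along \<open>[i, j)\<close>.\<close>
  have Q: "(?\<epsilon> i j = 1 \<and> deg_prod G \<eta> i j = deg_prod G \<eta>' i j) \<or>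
      (?\<epsilon> i j = - 1 \<and> deg_prod G \<eta> i j = g \<otimes>\<^bsub>G\<^esub> deg_prod G \<eta>' i j)" if "i \<le> j" "j < n" for i j
    using that
  proof (induction rule: dec_induct)
    case base
    have "?\<epsilon> i i = (d i * d i) * (d (n - 1 - i) * d (n - 1 - i))" by (simp only: ac_simps)
    then show ?case by (simp add: d2 A.deg_prod_refl)
  next
    case (step j)
    have j: "Suc j < n" using step by simp
    have "n - 1 - j = Suc (n - 2 - j)" "n - 1 - Suc j = n - 2 - j" using j by auto
    then have "d (n - 1 - j) * s (n - 2 - j) = d (n - 1 - Suc j) * (s (n - 2 - j) * s (n - 2 - j))"
      by (simp add: d_def mult.assoc)
    then have "d (n - 1 - Suc j) = d (n - 1 - j) * s (n - 2 - j)" by (simp add: s2)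
    moreover have "d (Suc j) = d j * s j" by (simp add: d_def)
    ultimately have \<epsilon>: "?\<epsilon> i (Suc j) = ?\<epsilon> i j * (s j * s (n - 2 - j))" by (simp only: ac_simps)
    define D where "D = deg_prod G \<eta>' i j"
    have D: "D \<in> carrier G" and a: "\<eta>' ! j \<in> carrier G"
      using step B.\<eta>(2) B.nth_carrier[OF j] by (auto simp: D_def intro!: A.deg_prod_closed B.\<eta>(1))
    have gD: "g \<otimes>\<^bsub>G\<^esub> D = D \<otimes>\<^bsub>G\<^esub> g"
      unfolding D_def using step B.\<eta> B.g B.g_comm by (intro A.deg_prod_commute) auto
    have sn: "deg_prod G \<eta> i (Suc j) = deg_prod G \<eta> i j \<otimes>\<^bsub>G\<^esub> \<eta> ! j"
      "deg_prod G \<eta>' i (Suc j) = D \<otimes>\<^bsub>G\<^esub> \<eta>' ! j"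
      unfolding D_def using step A.\<eta> B.\<eta> by (auto intro!: A.deg_prod_snoc)
    have e1: "(g \<otimes>\<^bsub>G\<^esub> D) \<otimes>\<^bsub>G\<^esub> \<eta>' ! j = g \<otimes>\<^bsub>G\<^esub> (D \<otimes>\<^bsub>G\<^esub> \<eta>' ! j)"
      using D a A.g(1) by (simp add: A.m_assoc)
    have e2: "D \<otimes>\<^bsub>G\<^esub> (g \<otimes>\<^bsub>G\<^esub> \<eta>' ! j) = g \<otimes>\<^bsub>G\<^esub> (D \<otimes>\<^bsub>G\<^esub> \<eta>' ! j)"
      using D a A.g(1) gD by (simp flip: A.m_assoc)
    have e3: "(g \<otimes>\<^bsub>G\<^esub> D) \<otimes>\<^bsub>G\<^esub> (g \<otimes>\<^bsub>G\<^esub> \<eta>' ! j) = D \<otimes>\<^bsub>G\<^esub> \<eta>' ! j"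
    proof -
      have "(g \<otimes>\<^bsub>G\<^esub> D) \<otimes>\<^bsub>G\<^esub> (g \<otimes>\<^bsub>G\<^esub> \<eta>' ! j) = g \<otimes>\<^bsub>G\<^esub> (g \<otimes>\<^bsub>G\<^esub> (D \<otimes>\<^bsub>G\<^esub> \<eta>' ! j))"
        using e2 D a A.g(1) by (simp add: A.m_assoc)
      also have "\<dots> = (g \<otimes>\<^bsub>G\<^esub> g) \<otimes>\<^bsub>G\<^esub> (D \<otimes>\<^bsub>G\<^esub> \<eta>' ! j)"
        using D a A.g(1) by (simp only: A.m_assoc A.m_closed)
      also have "\<dots> = D \<otimes>\<^bsub>G\<^esub> \<eta>' ! j" using D a A.g(3) by simp
      finally show ?thesis .
    qed
    have IH: "(?\<epsilon> i j = 1 \<and> deg_prod G \<eta> i j = D) \<or> (?\<epsilon> i j = - 1 \<and> deg_prod G \<eta> i j = g \<otimes>\<^bsub>G\<^esub> D)"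
      unfolding D_def using step by simp
    show ?case
      unfolding \<epsilon> sn using IH u[OF j] e1 e2 e3 by (elim disjE conjE) simp_all
  qed
  have "sign_conj n d x \<in> B.\<Gamma> h" if x: "x \<in> A.\<Gamma> h" for h x
  proof -
    interpret \<psi>: UT_automorphism n "sign_conj n d"
      by (rule UT_automorphism_sign_conj) (rule d2)
    show ?thesis
      using x
    proof (induction rule: A.\<Gamma>_induct)
      case zero
      show ?case using \<psi>.map_zero submoduleD(2)[OF B.\<Gamma>_submodule] by simp
    next
      case (add x y)
      then show ?case using \<psi>.add submoduleD(3)[OF B.\<Gamma>_submodule] by simp
    next
      case (smult c x)
      then show ?case using \<psi>.smult submoduleD(4)[OF B.\<Gamma>_submodule] by simp
    next
      case (minus i j)
      then have i: "i < n" by simp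
      note X = sign_conj_X[OF i minus(2) d2]
      from Q[OF minus(1,2)] show ?case
      proof (elim disjE conjE)
        assume e: "?\<epsilon> i j = 1" "deg_prod G \<eta> i j = deg_prod G \<eta>' i j"
        show ?thesis unfolding X(1)[OF e(1)]
          using B.\<Gamma>_minus[OF minus(1,2)] minus(3) e(2) by (intro submoduleD(4)[OF B.\<Gamma>_submodule]) simp
      next
        assume e: "?\<epsilon> i j = - 1" "deg_prod G \<eta> i j = g \<otimes>\<^bsub>G\<^esub> deg_prod G \<eta>' i j"
        show ?thesis unfolding X(3)[OF e(1)]
          using B.\<Gamma>_plus[OF minus(1,2)] minus(3) e(2) by (intro submoduleD(4)[OF B.\<Gamma>_submodule]) simp
      qed
    next
      case (plus i j)
      then have i: "i < n" by simp
      note X = sign_conj_X[OF i plus(2) d2]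
      from Q[OF plus(1,2)] show ?case
      proof (elim disjE conjE)
        assume e: "?\<epsilon> i j = 1" "deg_prod G \<eta> i j = deg_prod G \<eta>' i j"
        show ?thesis unfolding X(2)[OF e(1)]
          using B.\<Gamma>_plus[OF plus(1,2)] plus(3) e(2) by (intro submoduleD(4)[OF B.\<Gamma>_submodule]) simp
      next
        assume e: "?\<epsilon> i j = - 1" "deg_prod G \<eta> i j = g \<otimes>\<^bsub>G\<^esub> deg_prod G \<eta>' i j"
        have D: "deg_prod G \<eta>' i j \<in> carrier G"
          using plus B.\<eta>(2) by (intro A.deg_prod_closed B.\<eta>(1)) auto
        have "h = (g \<otimes>\<^bsub>G\<^esub> g) \<otimes>\<^bsub>G\<^esub> deg_prod G \<eta>' i j"
          using plus(3) e(2) A.m_assoc[OF A.g(1) A.g(1) D] by simp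
        then have "h = deg_prod G \<eta>' i j" using A.g(3) D by simp
        then show ?thesis unfolding X(4)[OF e(1)]
          using B.\<Gamma>_minus[OF plus(1,2)] by (intro submoduleD(4)[OF B.\<Gamma>_submodule]) simp
      qed
    qed
  qed
  with d2 show ?thesis by blast
qed

text \<open>
  Conjugation already respects the components of the type 2 gradings; the twist by the functionals
  \<open>\<mu>\<close> moves \<open>V\<close> into \<open>V'\<close>. It changes nothing in degrees other than \<open>g\<close> and \<open>t\<close>, where the symmetrised diagonal
  vanishes.
\<close>

lemma Gamma2_sufficient:
  assumes "Gamma2_data G n (V :: 'f::field mat set) t g \<eta>" "Gamma2_data G n (V' :: 'f mat set) t' g \<eta>'"
    and sim: "seq_sim_mod G n g \<eta> \<eta>'"
  shows "\<exists>F. UT_automorphism n F \<and> (\<forall>h\<in>carrier G. \<forall>x\<in>practical_Gamma2 G n V t g \<eta> h.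
      \<exists>y\<in>practical_Gamma2 G n V' t' g \<eta>' h. \<exists>c. F x = y + c \<cdot>\<^sub>m 1\<^sub>m n \<and> (t = t' \<longrightarrow> c = 0))"
proof -
  interpret A: Gamma2_data G n V t g \<eta> by fact
  interpret B: Gamma2_data G n V' t' g \<eta>' by fact
  obtain d :: "nat \<Rightarrow> 'f" where d2: "\<And>i. d i * d i = 1"
    and dG: "\<And>h x. x \<in> A.\<Gamma> h \<Longrightarrow> sign_conj n d x \<in> B.\<Gamma> h"
    using Gamma2_sign_conj[OF assms] by blast
  let ?\<psi> = "sign_conj n d"
  interpret \<psi>: UT_automorphism n ?\<psi> by (rule UT_automorphism_sign_conj) (rule d2)
  have one: "?\<psi> (1\<^sub>m n) = 1 \<cdot>\<^sub>m 1\<^sub>m n" by (intro eq_matI) (auto simp: sign_conj_def d2)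
  define F where "F x = ?\<psi> x + (1 * A.\<mu> x - B.\<mu> (?\<psi> x)) \<cdot>\<^sub>m 1\<^sub>m n" for x
  interpret F: UT_automorphism n F
    unfolding F_def[abs_def] by (rule \<psi>.central_twist[OF one _ A.\<mu>_functional B.\<mu>_functional]) simp
  have "\<exists>y\<in>B.\<Delta> h. \<exists>c. F x = y + c \<cdot>\<^sub>m 1\<^sub>m n \<and> (t = t' \<longrightarrow> c = 0)" if x: "x \<in> A.\<Delta> h" for h x
  proof -
    have xc: "x \<in> carrier (UT n)" using x A.\<Delta>_carrier by blast
    have \<psi>c: "?\<psi> x \<in> carrier (UT n)" by (rule \<psi>.closed[OF xc])
    obtain y c where y: "y \<in> A.\<Gamma> h" "x = y + c \<cdot>\<^sub>m 1\<^sub>m n" by (rule A.\<Delta>_imp_\<Gamma>[OF x])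
    have yc: "y \<in> carrier (UT n)" using y A.\<Gamma>_carrier by blast
    have "?\<psi> x = ?\<psi> y + c \<cdot>\<^sub>m 1\<^sub>m n"
      unfolding y(2) \<psi>.add[OF yc scalar_closed] \<psi>.smult[OF UT_one_closed] one
      using \<psi>.dims[OF yc] by (intro eq_matI) auto
    then have Fx: "F x = ?\<psi> y + (c + (A.\<mu> x - B.\<mu> (?\<psi> x))) \<cdot>\<^sub>m 1\<^sub>m n"
      unfolding F_def using \<psi>.dims[OF yc] by (intro eq_matI) (auto simp: algebra_simps)
    show ?thesis
    proof (cases "t = t'")
      case False
      obtain z e where z: "z \<in> B.\<Delta> h" "?\<psi> y = z + e \<cdot>\<^sub>m 1\<^sub>m n" by (rule B.\<Gamma>_imp_\<Delta>[OF dG[OF y(1)]])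
      have "z \<in> carrier (UT n)" using z B.\<Delta>_carrier by blast
      then have "F x = z + (e + (c + (A.\<mu> x - B.\<mu> (?\<psi> x)))) \<cdot>\<^sub>m 1\<^sub>m n"
        unfolding Fx z(2) using UT_dim[of z n] by (intro eq_matI) (auto simp: algebra_simps)
      then show ?thesis using z(1) False by blast
    next
      case True
      have "F x \<in> B.\<Delta> h"
      proof -
        consider "h = t" | "h \<noteq> t" "h = g" | "h \<noteq> t" "h \<noteq> g" by blast
        then show ?thesis
        proof cases
          case 1
          then have "F x \<in> B.\<Delta> t'" unfolding B.\<Delta>_t Fx using dG[OF y(1)] True by blast
          then show ?thesis using 1 True by simp
        next
          case 2
          then have xV: "x \<in> V" using x by (simp add: practical_Gamma2_def)
          have tg: "t \<noteq> g" "t' \<noteq> g" using 2 True by auto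
          have "F x = ?\<psi> x - B.\<mu> (?\<psi> x) \<cdot>\<^sub>m 1\<^sub>m n"
            unfolding F_def A.\<mu>_V[OF tg(1) xV] using \<psi>.dims[OF xc] by (intro eq_matI) auto
          also have "\<dots> \<in> V'" using xV A.V_subset by (intro B.\<mu>_complement[OF tg(2)] dG) auto
          finally show ?thesis using 2 True by (simp add: practical_Gamma2_def)
        next
          case 3
          then have xG: "x \<in> A.\<Gamma> h" using x by (simp add: practical_Gamma2_def)
          have "F x = ?\<psi> x"
            unfolding F_def A.\<mu>_other[OF xG 3(2)] B.\<mu>_other[OF dG[OF xG] 3(2)]
            using \<psi>.dims[OF xc] by (intro eq_matI) auto
          then show ?thesis using dG[OF xG] 3 True by (simp add: practical_Gamma2_def)
        qed
      qed
      moreover have "F x = F x + 0 \<cdot>\<^sub>m 1\<^sub>m n" using F.dims[OF xc] by (intro eq_matI) auto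
      ultimately show ?thesis by blast
    qed
  qed
  then show ?thesis using F.UT_automorphism_axioms by blast
qed

section \<open>The classification\<close>

text \<open>
  The two kinds of isomorphism differ only in the degree of the identity matrix, which every automorphism
  maps to a nonzero multiple of itself.
\<close>

lemma graded_isomorphism_criteria:
  fixes A B :: "'g \<Rightarrow> 'f::field mat set"
  assumes A: "\<And>h. A h \<subseteq> carrier (UT n)" and B: "\<And>h. B h \<subseteq> carrier (UT n)"
    and n: "n > 0" and t: "t \<in> carrier G"
    and one: "1\<^sub>m n \<in> A t" and scalar: "\<And>c h. c \<cdot>\<^sub>m 1\<^sub>m n \<in> B h \<Longrightarrow> c \<noteq> 0 \<Longrightarrow> h = t'"
    and necessary: "\<And>\<psi>. UT_automorphism n \<psi> \<Longrightarrow>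
      \<forall>h\<in>carrier G. \<forall>x\<in>A h. \<exists>y\<in>B h. \<exists>c. \<psi> x = y + c \<cdot>\<^sub>m 1\<^sub>m n \<Longrightarrow> S"
    and sufficient: "S \<Longrightarrow> \<exists>\<psi>. UT_automorphism n \<psi> \<and> (\<forall>h\<in>carrier G. \<forall>x\<in>A h.
      \<exists>y\<in>B h. \<exists>c. \<psi> x = y + c \<cdot>\<^sub>m 1\<^sub>m n \<and> (t = t' \<longrightarrow> c = 0))"
  shows "graded_isomorphic G (UT n) A (UT n) B \<longleftrightarrow> t = t' \<and> S"
    and "practically_graded_isomorphic G (UT n) A (UT n) B \<longleftrightarrow> S"
proof -
  have zero: "y + 0 \<cdot>\<^sub>m 1\<^sub>m n = y" if "y \<in> carrier (UT n)" for y :: "'f mat"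
    using UT_dim[OF that] by (intro eq_matI) auto
  show "practically_graded_isomorphic G (UT n) A (UT n) B \<longleftrightarrow> S"
    unfolding practically_graded_isomorphic_UT_iff[OF A B] using necessary sufficient by meson
  show "graded_isomorphic G (UT n) A (UT n) B \<longleftrightarrow> t = t' \<and> S"
  proof
    assume "graded_isomorphic G (UT n) A (UT n) B"
    then obtain \<psi> where \<psi>: "UT_automorphism n \<psi>" and gr: "\<And>h x. h \<in> carrier G \<Longrightarrow> x \<in> A h \<Longrightarrow> \<psi> x \<in> B h"
      unfolding graded_isomorphic_UT_iff by blast
    interpret UT_automorphism n \<psi> by fact
    have "\<exists>y\<in>B h. \<exists>c. \<psi> x = y + c \<cdot>\<^sub>m 1\<^sub>m n" if "h \<in> carrier G" "x \<in> A h" for h x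
    proof -
      have "\<psi> x \<in> carrier (UT n)" using gr[OF that] B by blast
      then show ?thesis using gr[OF that] zero[of "\<psi> x"] by metis
    qed
    then have S using necessary[OF \<psi>] by blast
    moreover obtain c where c: "\<psi> (1\<^sub>m n) = c \<cdot>\<^sub>m 1\<^sub>m n"
    proof -
      have "1\<^sub>m n = (1 :: 'f) \<cdot>\<^sub>m 1\<^sub>m n" by (intro eq_matI) auto
      then have "1\<^sub>m n \<in> (scalar_mats n :: 'f mat set)" unfolding scalar_mats_iff by blast
      then have "\<psi> (1\<^sub>m n) \<in> scalar_mats n" using image_center by blast
      then show thesis using that unfolding scalar_mats_iff by blast
    qed
    have "c \<noteq> 0"
    proof
      assume "c = 0"
      then have "\<psi> (1\<^sub>m n) = 0\<^sub>m n n" unfolding c by (intro eq_matI) auto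
      then have "\<psi> (1\<^sub>m n) = \<psi> (0\<^sub>m n n)" unfolding map_zero .
      then have eq: "1\<^sub>m n = (0\<^sub>m n n :: 'f mat)" by (rule inj_onD[OF inj _ UT_one_closed UT_zero_closed])
      have "1\<^sub>m n $$ (0, 0) = (0\<^sub>m n n :: 'f mat) $$ (0, 0)" unfolding eq ..
      then show False using n by simp
    qed
    then have "t = t'" using gr[OF t one] scalar unfolding c by blast
    ultimately show "t = t' \<and> S" by blast
  next
    assume "t = t' \<and> S"
    then obtain \<psi> where \<psi>: "UT_automorphism n \<psi>"
      and gr: "\<And>h x. h \<in> carrier G \<Longrightarrow> x \<in> A h \<Longrightarrow> \<exists>y\<in>B h. \<exists>c. \<psi> x = y + c \<cdot>\<^sub>m 1\<^sub>m n \<and> c = 0"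
      using sufficient by meson
    have "\<psi> x \<in> B h" if h: "h \<in> carrier G" "x \<in> A h" for h x
    proof -
      obtain y where y: "y \<in> B h" "\<psi> x = y + 0 \<cdot>\<^sub>m 1\<^sub>m n" using gr[OF h] by blast
      then have "y \<in> carrier (UT n)" using B by blast
      then show ?thesis using y zero by simp
    qed
    then show "graded_isomorphic G (UT n) A (UT n) B"
      unfolding graded_isomorphic_UT_iff using \<psi> by blast
  qed
qed

lemma Gamma1_classification:
  assumes "Gamma1_data G n (V :: 'f::field mat set) t \<eta>" "Gamma1_data G n V' t' \<eta>'"
  shows "graded_isomorphic G (UT n) (Gamma1 G n V t \<eta>) (UT n) (Gamma1 G n V' t' \<eta>') \<longleftrightarrow>
      t = t' \<and> seq_sim \<eta> \<eta>'"
    and "practically_graded_isomorphic G (UT n) (Gamma1 G n V t \<eta>) (UT n) (Gamma1 G n V' t' \<eta>') \<longleftrightarrow>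
      seq_sim \<eta> \<eta>'"
proof -
  interpret A: Gamma1_data G n V t \<eta> by fact
  interpret B: Gamma1_data G n V' t' \<eta>' by fact
  have n: "n > 0" using A.n by simp
  have one: "1\<^sub>m n \<in> A.\<Gamma> t" by (rule A.\<Gamma>_gen) simp
  note crit = graded_isomorphism_criteria[OF A.\<Gamma>_carrier B.\<Gamma>_carrier n A.t one B.\<Gamma>_scalar
      Gamma1_necessary[OF assms] Gamma1_sufficient[OF assms]]
  show "graded_isomorphic G (UT n) A.\<Gamma> (UT n) B.\<Gamma> \<longleftrightarrow> t = t' \<and> seq_sim \<eta> \<eta>'"
    by (rule crit(1))
  show "practically_graded_isomorphic G (UT n) A.\<Gamma> (UT n) B.\<Gamma> \<longleftrightarrow> seq_sim \<eta> \<eta>'"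
    by (rule crit(2))
qed

lemma Gamma2_classification:
  assumes "Gamma2_data G n (V :: 'f::field mat set) t g \<eta>" "Gamma2_data G n (V' :: 'f mat set) t' g' \<eta>'"
  shows "graded_isomorphic G (UT n) (practical_Gamma2 G n V t g \<eta>)
        (UT n) (practical_Gamma2 G n V' t' g' \<eta>') \<longleftrightarrow> t = t' \<and> g = g' \<and> seq_sim_mod G n g \<eta> \<eta>'"
    and "practically_graded_isomorphic G (UT n) (practical_Gamma2 G n V t g \<eta>)
        (UT n) (practical_Gamma2 G n V' t' g' \<eta>') \<longleftrightarrow> g = g' \<and> seq_sim_mod G n g \<eta> \<eta>'"
proof -
  interpret A: Gamma2_data G n V t g \<eta> by fact
  interpret B: Gamma2_data G n V' t' g' \<eta>' by fact
  have n: "n > 0" using A.n by simp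
  have suff: "\<exists>F. UT_automorphism n F \<and> (\<forall>h\<in>carrier G. \<forall>x\<in>A.\<Delta> h.
      \<exists>y\<in>B.\<Delta> h. \<exists>c. F x = y + c \<cdot>\<^sub>m 1\<^sub>m n \<and> (t = t' \<longrightarrow> c = 0))"
    if "g = g' \<and> seq_sim_mod G n g \<eta> \<eta>'"
  proof -
    have eq: "g = g'" using that by (rule conjunct1)
    have sim: "seq_sim_mod G n g \<eta> \<eta>'" using that by (rule conjunct2)
    have "Gamma2_data G n V' t' g \<eta>'" using assms(2) unfolding eq .
    from Gamma2_sufficient[OF assms(1) this sim] show ?thesis unfolding eq .
  qed
  note crit = graded_isomorphism_criteria[OF A.\<Delta>_carrier B.\<Delta>_carrier n A.t A.\<Delta>_one B.\<Delta>_scalar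
      Gamma2_necessary[OF assms] suff]
  show "graded_isomorphic G (UT n) A.\<Delta> (UT n) B.\<Delta> \<longleftrightarrow> t = t' \<and> g = g' \<and> seq_sim_mod G n g \<eta> \<eta>'"
    by (rule crit(1))
  show "practically_graded_isomorphic G (UT n) A.\<Delta> (UT n) B.\<Delta> \<longleftrightarrow> g = g' \<and> seq_sim_mod G n g \<eta> \<eta>'"
    by (rule crit(2))
qed

theorem theorem14:
  fixes G :: "('g, 'r) monoid_scheme" (structure)
    and n :: nat and t t' g g' :: 'g and \<eta> \<eta>' :: "'g list"
  assumes "group G" and "n > 2"
    and "t \<in> carrier G" and "t' \<in> carrier G"
    and "g \<in> carrier G" and "g \<noteq> \<one>" and "g [^] (2::nat) = \<one>"
    and "g' \<in> carrier G" and "g' \<noteq> \<one>" and "g' [^] (2::nat) = \<one>"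
    and "set \<eta> \<subseteq> carrier G" and "length \<eta> = n - 1" and "pairwise_commuting G \<eta>"
    and "set \<eta>' \<subseteq> carrier G" and "length \<eta>' = n - 1" and "pairwise_commuting G \<eta>'"
  shows
    "(\<forall>V V' :: 'f::field mat set. Gamma1_choice n V \<and> Gamma1_choice n V' \<longrightarrow>
        (graded_isomorphic G (UT n) (Gamma1 G n V t \<eta>) (UT n) (Gamma1 G n V' t' \<eta>') \<longleftrightarrow>
           t = t' \<and> seq_sim \<eta> \<eta>') \<and>
        (practically_graded_isomorphic G (UT n) (Gamma1 G n V t \<eta>) (UT n) (Gamma1 G n V' t' \<eta>') \<longleftrightarrow>
           seq_sim \<eta> \<eta>')) \<and>
     (CHAR('f) \<noteq> 2 \<and> \<eta> = rev \<eta> \<and> \<eta>' = rev \<eta>' \<and>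
      (\<forall>x \<in> set \<eta>. g \<otimes> x = x \<otimes> g) \<and> (\<forall>x \<in> set \<eta>'. g' \<otimes> x = x \<otimes> g') \<longrightarrow>
      (\<forall>V V' :: 'f mat set. Gamma2_choice G n t g \<eta> V \<and> Gamma2_choice G n t' g' \<eta>' V' \<longrightarrow>
        (graded_isomorphic G (UT n) (practical_Gamma2 G n V t g \<eta>)
                             (UT n) (practical_Gamma2 G n V' t' g' \<eta>') \<longleftrightarrow>
           g = g' \<and> t = t' \<and> seq_sim_mod G n g \<eta> \<eta>') \<and>
        (practically_graded_isomorphic G (UT n) (practical_Gamma2 G n V t g \<eta>)
                             (UT n) (practical_Gamma2 G n V' t' g' \<eta>') \<longleftrightarrow>
           g = g' \<and> seq_sim_mod G n g \<eta> \<eta>')))"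
proof -
  have g2: "g \<otimes> g = \<one>" "g' \<otimes> g' = \<one>"
    using assms(7,10) group.is_monoid[OF assms(1)] assms(5,8)
    by (simp_all add: numeral_2_eq_2 monoid.nat_pow_Suc monoid.nat_pow_0 monoid.l_one)
  have data1: "Gamma1_data G n V t \<eta>" "Gamma1_data G n V' t' \<eta>'"
    if "Gamma1_choice n V \<and> Gamma1_choice n V'" for V V' :: "'f mat set"
    using assms that by (auto intro!: Gamma1_data.intro Gamma1_data_axioms.intro)
  have data2: "Gamma2_data G n V t g \<eta>" "Gamma2_data G n V' t' g' \<eta>'"
    if hyps: "CHAR('f) \<noteq> 2 \<and> \<eta> = rev \<eta> \<and> \<eta>' = rev \<eta>' \<and>
      (\<forall>x \<in> set \<eta>. g \<otimes> x = x \<otimes> g) \<and> (\<forall>x \<in> set \<eta>'. g' \<otimes> x = x \<otimes> g')"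
    and choice: "Gamma2_choice G n t g \<eta> V \<and> Gamma2_choice G n t' g' \<eta>' V'" for V V' :: "'f mat set"
  proof -
    have "(2 :: 'f) \<noteq> 0" using hyps char_not_two_imp by blast
    moreover have "rev \<eta> = \<eta>" "rev \<eta>' = \<eta>'" using hyps by simp_all
    ultimately show "Gamma2_data G n V t g \<eta>" "Gamma2_data G n V' t' g' \<eta>'"
      using assms(1-6,8,9,11,12,14,15) g2 hyps choice
      by (intro Gamma2_data.intro Gamma2_data_axioms.intro; blast)+
  qed
  show ?thesis
  proof (intro conjI allI impI, goal_cases)
    case (1 V V')
    show ?case by (rule Gamma1_classification(1)[OF data1[OF 1]])
  next
    case (2 V V')
    show ?case by (rule Gamma1_classification(2)[OF data1[OF 2]])
  next
    case (3 V V')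
    show ?case using Gamma2_classification(1)[OF data2[OF 3]] by blast
  next
    case (4 V V')
    show ?case by (rule Gamma2_classification(2)[OF data2[OF 4]])
  qed
qed

end
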